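(* Consider the sequence $\{\omega_t^s\}_{0\le t\le m-1,\ s\ge 1}$ (ordered lexicographically in $(s,t)$) produced by Algorithm 1 (described in the context) run with $S=\infty$. Assume: (i) $f$ is thrice continuously differentiable and each $f_i$, $i=1,\dots,n$, is twice continuously differentiable; (ii) all iterates stay in a compact neighbourhood $\Omega$ of $\omega^*$; there is $\rho>0$ such that for every $\omega\in\Omega$, with $B(0_\omega,\rho)\subset T_\omega\mathcal M$ the ball of radius $\rho$ centred at $0_\omega$, $R_\omega$ is a diffeomorphism on $B(0_\omega,\rho)$ and $\Omega\subset R_\omega(B(0_\omega,\rho))$; and $R_{\omega_t^s}(-\tau\alpha_t^sV_t^s)\in\Omega$ for all $t\ge 0$, $s\ge 1$, $\tau\in[0,1]$; (iii) $\sum_{s=1}^{\infty}\sum_{t=0}^{m-1}\alpha_t^s=\infty$ and $\sum_{s=1}^{\infty}\sum_{t=0}^{m-1}(\alpha_t^s)^2<\infty$; (iv) the vector transport $\mathcal T$ is continuous and isometric on $\mathcal M$, i.e. $\langle\mathcal T_\eta\xi,\mathcal T_\eta\zeta\rangle=\langle\xi,\zeta\rangle$ for all $\omega\in\mathcal M$ and $\eta,\xi,\zeta\in T_\omega\mathcal M$. Then $\mathbb E[\|\mathrm{grad}f(\omega_t^s)\|^2]\to 0$ (as $s\to\infty$ along the sequence).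
   Context: $\mathcal M$ is a smooth Riemannian manifold with metric $\langle\cdot,\cdot\rangle$ and induced norm $\|\cdot\|$ on tangent spaces. $f_1,\dots,f_n:\mathcal M\to\mathbb R$ and $f=\frac1n\sum_{i=1}^n f_i$; $\mathrm{grad}$ is the Riemannian gradient; $\omega^*$ is a global minimizer of $f$. $R:T\mathcal M\to\mathcal M$ is a retraction: its restriction $R_\omega$ to $T_\omega\mathcal M$ satisfies $R_\omega(0_\omega)=\omega$ and $DR_\omega(0_\omega)[\xi]=\xi$. $\mathcal T$ is a vector transport: a smooth map $(\eta_\omega,\xi_\omega)\mapsto\mathcal T_{\eta_\omega}(\xi_\omega)\in T_{R_\omega(\eta_\omega)}\mathcal M$, linear in $\xi_\omega$, with $\mathcal T_{0_\omega}\xi=\xi$. One writes $\mathcal T_\omega^{R_\omega(\eta)}:=\mathcal T_\eta$ for $\eta \in T_\omega\mathcal M$. Algorithm 1 (R-SHG with adaptive parameters). Input: step sizes $\alpha_t^s>0$, an integer $m\ge1$, a constant $0<\mu<1$, parameters $\phi_t^s,\psi_t^s\ge0$ with $\phi_t^s+\psi_t^s\le1$, and an initial point $\tilde\omega^0$. For $s=1,2,\dots,S$: set $\omega_0^s=\tilde\omega^{s-1}$, $V_0^s=\mathrm{grad}f(\omega_0^s)$, $\omega_1^s=R_{\omega_0^s}(-\alpha_0^sV_0^s)$. For $t=1,\dots,m-1$: choose an index set $I_t^s\subset\{1,\dots,n\}$ of given cardinality $b$ uniformly at random (independently of the past) and write $\mathrm{grad}f_{I_t^s}=\frac1{|I_t^s|}\sum_{i\in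 I_t^s}\mathrm{grad}f_i$; let $D_t^s=\langle\mathcal T_{\omega_{t-1}^s}^{\omega_t^s}(V_{t-1}^s-\mathrm{grad}f(\omega_{t-1}^s)),\mathrm{grad}f(\omega_t^s)\rangle$; put $\tilde\psi_t^s=\min\{\psi_t^s,\ \mu\|\mathrm{grad}f(\omega_t^s)\|^2/|D_t^s|\}$ if $D_t^s\ne0$ and $\tilde\psi_t^s=\psi_t^s$ otherwise; set $$V_t^s=\phi_t^s\big(\mathrm{grad}f_{I_t^s}(\omega_t^s)-\mathcal T_{\omega_0^s}^{\omega_t^s}(\mathrm{grad}f_{I_t^s}(\omega_0^s)-\mathrm{grad}f(\omega_0^s))\big)+\tilde\psi_t^s\big(\mathrm{grad}f_{I_t^s}(\omega_t^s)-\mathcal T_{\omega_{t-1}^s}^{\omega_t^s}(\mathrm{grad}f_{I_t^s}(\omega_{t-1}^s)-V_{t-1}^s)\big)+(1-\phi_t^s-\tilde\psi_t^s)\mathrm{grad}f_{I_t^s}(\omega_t^s)$$ and $\omega_{t+1}^s=R_{\omega_t^s}(-\alpha_t^sV_t^s)$. Then $\tilde\omega^s=\omega_m^s$. *)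

theory Defs
  imports "HOL-Probability.Probability" "HOL-Library.Function_Algebras"
begin

instantiation "fun" :: (type, real_vector) real_vector
begin

definition scaleR_fun :: "real \<Rightarrow> ('a \<Rightarrow> 'b) \<Rightarrow> 'a \<Rightarrow> 'b"
  where "scaleR_fun r f = (\<lambda>x. r *\<^sub>R f x)"

instance
  by standard (simp_all add: scaleR_fun_def plus_fun_def scaleR_add_left scaleR_add_right)

end

section \<open>Maps of class \<open>C\<^sup>k\<close> between normed spaces\<close>

text \<open>Intended for open \<open>S\<close> and finite-dimensional domains, where continuity of all iterated
  directional derivatives of a differentiable map is the usual notion of class \<open>C\<^sup>k\<close>.\<close>

primrec ck_on :: "nat \<Rightarrow> 'a::real_normed_vector set \<Rightarrow> ('a \<Rightarrow> 'b::real_normed_vector) \<Rightarrow> bool" where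
  "ck_on 0 S f \<longleftrightarrow> continuous_on S f"
| "ck_on (Suc k) S f \<longleftrightarrow>
     (\<forall>x\<in>S. f differentiable (at x)) \<and> (\<forall>v. ck_on k S (\<lambda>x. frechet_derivative f (at x) v))"

definition smooth_on :: "'a::real_normed_vector set \<Rightarrow> ('a \<Rightarrow> 'b::real_normed_vector) \<Rightarrow> bool" where
  "smooth_on S f \<longleftrightarrow> (\<forall>k. ck_on k S f)"

section \<open>Smooth manifolds\<close>

text \<open>A chart is a pair of its domain and its coordinate map; the values of the coordinate map
  outside the domain are irrelevant.\<close>

type_synonym ('m, 'e) chart = "'m set \<times> ('m \<Rightarrow> 'e)"

definition chart_img :: "('m, 'e) chart \<Rightarrow> 'e set" where
  "chart_img c = snd c ` fst c"

definition param :: "('m, 'e) chart \<Rightarrow> 'e \<Rightarrow> 'm" where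
  "param c = inv_into (fst c) (snd c)"

definition smooth_manifold ::
  "('m::{t2_space,second_countable_topology}, 'e::euclidean_space) chart set \<Rightarrow> bool" where
  "smooth_manifold A \<longleftrightarrow>
     (\<forall>c\<in>A. open (fst c) \<and> open (chart_img c) \<and>
        homeomorphism (fst c) (chart_img c) (snd c) (param c)) \<and>
     (\<Union>c\<in>A. fst c) = UNIV \<and>
     (\<forall>c\<in>A. \<forall>d\<in>A. smooth_on (snd c ` (fst c \<inter> fst d)) (snd d \<circ> param c))"

definition charts_at :: "('m, 'e) chart set \<Rightarrow> 'm \<Rightarrow> ('m, 'e) chart set" where
  "charts_at A p = {c \<in> A. p \<in> fst c}"

definition mfd_ck ::
  "nat \<Rightarrow> ('m, 'e::euclidean_space) chart set \<Rightarrow> ('m \<Rightarrow> real) \<Rightarrow> bool" where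
  "mfd_ck k A f \<longleftrightarrow> (\<forall>c\<in>A. ck_on k (chart_img c) (f \<circ> param c))"

section \<open>Tangent spaces\<close>

text \<open>A tangent vector at \<open>p\<close> is the family of its coordinate vectors in all charts around \<open>p\<close>,
  related by the differentials of the transition maps. The vector space operations are those of
  the function space. Families do not record their base point, so a point of the tangent bundle
  is a pair \<open>(p, v)\<close> with \<open>v \<in> tangent_space A p\<close>.\<close>

type_synonym ('m, 'e) tvec = "('m, 'e) chart \<Rightarrow> 'e"

definition tangent_space ::
  "('m, 'e::euclidean_space) chart set \<Rightarrow> 'm \<Rightarrow> ('m, 'e) tvec set" where
  "tangent_space A p = {v.
     (\<forall>c\<in>charts_at A p. \<forall>d\<in>charts_at A p.
        v d = frechet_derivative (snd d \<circ> param c) (at (snd c p)) (v c)) \<and>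
     (\<forall>c. c \<notin> charts_at A p \<longrightarrow> v c = 0)}"

text \<open>The tangent vector at \<open>p\<close> with coordinates \<open>u\<close> in the chart \<open>c\<close>.\<close>

definition tvec_of ::
  "('m, 'e::euclidean_space) chart set \<Rightarrow> ('m, 'e) chart \<Rightarrow> 'm \<Rightarrow> 'e \<Rightarrow> ('m, 'e) tvec" where
  "tvec_of A c p u = (\<lambda>d.
     if d \<in> charts_at A p then frechet_derivative (snd d \<circ> param c) (at (snd c p)) u else 0)"

section \<open>Riemannian metrics and gradients\<close>

type_synonym ('m, 'e) metric = "'m \<Rightarrow> ('m, 'e) tvec \<Rightarrow> ('m, 'e) tvec \<Rightarrow> real"

definition riemannian_metric ::
  "('m, 'e::euclidean_space) chart set \<Rightarrow> ('m, 'e) metric \<Rightarrow> bool" where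
  "riemannian_metric A g \<longleftrightarrow>
     (\<forall>p. \<forall>u\<in>tangent_space A p. \<forall>v\<in>tangent_space A p. \<forall>w\<in>tangent_space A p. \<forall>r.
        g p u v = g p v u \<and>
        g p (u + v) w = g p u w + g p v w \<and>
        g p (r *\<^sub>R u) w = r * g p u w \<and>
        (u \<noteq> 0 \<longrightarrow> g p u u > 0)) \<and>
     (\<forall>c\<in>A. \<forall>u w. smooth_on (chart_img c)
        (\<lambda>x. g (param c x) (tvec_of A c (param c x) u) (tvec_of A c (param c x) w)))"

definition rnorm :: "('m, 'e) metric \<Rightarrow> 'm \<Rightarrow> ('m, 'e) tvec \<Rightarrow> real" where
  "rnorm g p v = sqrt (g p v v)"

definition tangent_ball ::
  "('m, 'e::euclidean_space) chart set \<Rightarrow> ('m, 'e) metric \<Rightarrow> 'm \<Rightarrow> real \<Rightarrow> ('m, 'e) tvec set" where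
  "tangent_ball A g p r = {v \<in> tangent_space A p. rnorm g p v < r}"

text \<open>The right-hand side of the characterising equation is the differential of \<open>f\<close> at \<open>p\<close>
  applied to \<open>w\<close>, computed in a chart.\<close>

definition grad ::
  "('m, 'e::euclidean_space) chart set \<Rightarrow> ('m, 'e) metric \<Rightarrow> ('m \<Rightarrow> real) \<Rightarrow> 'm \<Rightarrow> ('m, 'e) tvec" where
  "grad A g f p = (THE v. v \<in> tangent_space A p \<and>
     (\<forall>w\<in>tangent_space A p. \<forall>c\<in>charts_at A p.
        g p v w = frechet_derivative (f \<circ> param c) (at (snd c p)) (w c)))"

section \<open>Retractions and vector transports\<close>

type_synonym ('m, 'e) retr = "'m \<Rightarrow> ('m, 'e) tvec \<Rightarrow> 'm"
type_synonym ('m, 'e) transp = "'m \<Rightarrow> ('m, 'e) tvec \<Rightarrow> ('m, 'e) tvec \<Rightarrow> ('m, 'e) tvec"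

text \<open>\<open>bundle_dom A R c d\<close> is the set of bundle coordinates \<open>(x, u)\<close> in the chart \<open>c\<close> of the
  tangent vectors that \<open>R\<close> maps into the domain of \<open>d\<close>. Openness of all these sets amounts to
  continuity of \<open>R\<close> on the tangent bundle.\<close>

definition bundle_dom ::
  "('m, 'e::euclidean_space) chart set \<Rightarrow> ('m, 'e) retr \<Rightarrow> ('m, 'e) chart \<Rightarrow> ('m, 'e) chart
     \<Rightarrow> ('e \<times> 'e) set" where
  "bundle_dom A R c d =
     {(x, u). x \<in> chart_img c \<and> R (param c x) (tvec_of A c (param c x) u) \<in> fst d}"

text \<open>The last condition is \<open>DR\<^sub>p(0) = id\<close>, with both sides expressed in the chart \<open>c\<close>.\<close>

definition smooth_retraction :: "('m, 'e::euclidean_space) chart set \<Rightarrow> ('m, 'e) retr \<Rightarrow> bool" where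
  "smooth_retraction A R \<longleftrightarrow>
     (\<forall>c\<in>A. \<forall>d\<in>A. open (bundle_dom A R c d) \<and>
        smooth_on (bundle_dom A R c d)
          (\<lambda>(x, u). snd d (R (param c x) (tvec_of A c (param c x) u)))) \<and>
     (\<forall>p. R p 0 = p) \<and>
     (\<forall>p. \<forall>c\<in>charts_at A p.
        ((\<lambda>u. snd c (R p (tvec_of A c p u))) has_derivative (\<lambda>u. u)) (at 0))"

text \<open>Regularity of a transport as a map from pairs of tangent vectors \<open>(\<eta>, \<xi>)\<close> with a common base
  point \<open>p\<close> to the tangent bundle. The base point of its value is \<open>R p \<eta>\<close>, so (for a retraction
  \<open>R\<close>) only the fibre coordinates need to be considered.\<close>

definition transport_ck ::
  "nat \<Rightarrow> ('m, 'e::euclidean_space) chart set \<Rightarrow> ('m, 'e) retr \<Rightarrow> ('m, 'e) transp \<Rightarrow> bool" where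
  "transport_ck k A R T \<longleftrightarrow>
     (\<forall>c\<in>A. \<forall>d\<in>A. ck_on k (bundle_dom A R c d \<times> UNIV)
        (\<lambda>((x, u), w). T (param c x) (tvec_of A c (param c x) u) (tvec_of A c (param c x) w) d))"

definition vector_transport ::
  "('m, 'e::euclidean_space) chart set \<Rightarrow> ('m, 'e) retr \<Rightarrow> ('m, 'e) transp \<Rightarrow> bool" where
  "vector_transport A R T \<longleftrightarrow>
     (\<forall>p. \<forall>\<eta>\<in>tangent_space A p. \<forall>\<xi>\<in>tangent_space A p. \<forall>\<zeta>\<in>tangent_space A p. \<forall>r.
        T p \<eta> \<xi> \<in> tangent_space A (R p \<eta>) \<and>
        T p \<eta> (\<xi> + \<zeta>) = T p \<eta> \<xi> + T p \<eta> \<zeta> \<and>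
        T p \<eta> (r *\<^sub>R \<xi>) = r *\<^sub>R T p \<eta> \<xi> \<and>
        T p 0 \<xi> = \<xi>) \<and>
     (\<forall>k. transport_ck k A R T)"

definition isometric_transport ::
  "('m, 'e::euclidean_space) chart set \<Rightarrow> ('m, 'e) metric \<Rightarrow> ('m, 'e) retr \<Rightarrow> ('m, 'e) transp \<Rightarrow> bool" where
  "isometric_transport A g R T \<longleftrightarrow>
     (\<forall>p. \<forall>\<eta>\<in>tangent_space A p. \<forall>\<xi>\<in>tangent_space A p. \<forall>\<zeta>\<in>tangent_space A p.
        g (R p \<eta>) (T p \<eta> \<xi>) (T p \<eta> \<zeta>) = g p \<xi> \<zeta>)"

text \<open>\<open>F\<close> is a diffeomorphism from the open subset \<open>B\<close> of the tangent space at \<open>p\<close> onto an open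
  subset of the manifold. Smoothness of \<open>F\<close> and of its inverse is expressed in the linear
  coordinates that a chart \<open>c\<close> around \<open>p\<close> induces on the tangent space.\<close>

definition tangent_diffeo ::
  "('m::topological_space, 'e::euclidean_space) chart set \<Rightarrow> 'm \<Rightarrow> ('m, 'e) tvec set \<Rightarrow>
     (('m, 'e) tvec \<Rightarrow> 'm) \<Rightarrow> bool" where
  "tangent_diffeo A p B F \<longleftrightarrow>
     inj_on F B \<and> open (F ` B) \<and>
     (\<forall>c\<in>charts_at A p. open {u. tvec_of A c p u \<in> B} \<and>
        (\<forall>d\<in>A.
           open {u. tvec_of A c p u \<in> B \<and> F (tvec_of A c p u) \<in> fst d} \<and>
           smooth_on {u. tvec_of A c p u \<in> B \<and> F (tvec_of A c p u) \<in> fst d}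
             (\<lambda>u. snd d (F (tvec_of A c p u))) \<and>
           smooth_on (snd d ` (fst d \<inter> F ` B)) (\<lambda>y. inv_into B F (param d y) c)))"

text \<open>The transport from \<open>p\<close> to \<open>q\<close> is the transport along the unique \<open>\<eta>\<close> in the ball of radius
  \<open>\<rho>\<close> of the tangent space at \<open>p\<close> with \<open>R p \<eta> = q\<close>; it is meaningful when \<open>R p\<close> is injective on
  that ball and \<open>q\<close> lies in its image. If \<open>R p\<close> is a diffeomorphism on the ball and the curve
  \<open>\<tau> \<mapsto> R p (\<tau> \<eta>)\<close>, \<open>0 \<le> \<tau> \<le> 1\<close>, stays in the image of the ball, then lifting the curve shows
  that \<open>\<eta>\<close> itself lies in the ball, so that the transport from \<open>p\<close> to \<open>R p \<eta>\<close> is \<open>T p \<eta>\<close>.\<close>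

definition transport_to ::
  "('m, 'e::euclidean_space) chart set \<Rightarrow> ('m, 'e) metric \<Rightarrow> ('m, 'e) retr \<Rightarrow> ('m, 'e) transp \<Rightarrow>
     real \<Rightarrow> 'm \<Rightarrow> 'm \<Rightarrow> ('m, 'e) tvec \<Rightarrow> ('m, 'e) tvec" where
  "transport_to A g R T \<rho> p q = T p (the_inv_into (tangent_ball A g p \<rho>) (R p) q)"

section \<open>The Riemannian stochastic hybrid gradient algorithm\<close>

definition avg_fun :: "nat \<Rightarrow> (nat \<Rightarrow> 'm \<Rightarrow> real) \<Rightarrow> 'm \<Rightarrow> real" where
  "avg_fun n F p = (1 / real n) * (\<Sum>i=1..n. F i p)"

definition batch_grad ::
  "('m, 'e::euclidean_space) chart set \<Rightarrow> ('m, 'e) metric \<Rightarrow> (nat \<Rightarrow> 'm \<Rightarrow> real) \<Rightarrow> nat set \<Rightarrow> 'm \<Rightarrow>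
     ('m, 'e) tvec" where
  "batch_grad A g F B p = (1 / real (card B)) *\<^sub>R (\<Sum>i\<in>B. grad A g (F i) p)"

text \<open>One run of the algorithm with infinitely many outer iterations, for given batches
  \<open>I s t\<close>: \<open>w s t\<close> are the iterates and \<open>V s t\<close> the search directions, where \<open>s \<ge> 1\<close>. The outer
  iterates are \<open>w s 0\<close>; the values at \<open>s = 0\<close> are irrelevant.\<close>

definition rshg_run ::
  "('m, 'e::euclidean_space) chart set \<Rightarrow> ('m, 'e) metric \<Rightarrow> ('m, 'e) retr \<Rightarrow> ('m, 'e) transp \<Rightarrow>
     real \<Rightarrow> nat \<Rightarrow> (nat \<Rightarrow> 'm \<Rightarrow> real) \<Rightarrow> nat \<Rightarrow> real \<Rightarrow>
     (nat \<Rightarrow> nat \<Rightarrow> real) \<Rightarrow> (nat \<Rightarrow> nat \<Rightarrow> real) \<Rightarrow> (nat \<Rightarrow> nat \<Rightarrow> real) \<Rightarrow> 'm \<Rightarrow>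
     (nat \<Rightarrow> nat \<Rightarrow> nat set) \<Rightarrow> (nat \<Rightarrow> nat \<Rightarrow> 'm) \<Rightarrow> (nat \<Rightarrow> nat \<Rightarrow> ('m, 'e) tvec) \<Rightarrow> bool" where
  "rshg_run A g R T \<rho> n F m \<mu> \<alpha> \<phi> \<psi> w0 I w V \<longleftrightarrow>
     (let G = grad A g (avg_fun n F); tr = transport_to A g R T \<rho> in
      w 1 0 = w0 \<and>
      (\<forall>s\<ge>1.
        w (Suc s) 0 = w s m \<and>
        V s 0 = G (w s 0) \<and>
        (\<forall>t<m. w s (Suc t) = R (w s t) (- (\<alpha> s t *\<^sub>R V s t))) \<and>
        (\<forall>t\<in>{1..<m}.
          let b = batch_grad A g F (I s t);
              D = g (w s t) (tr (w s (t - 1)) (w s t) (V s (t - 1) - G (w s (t - 1)))) (G (w s t));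
              \<psi>' = (if D \<noteq> 0 then min (\<psi> s t) (\<mu> * (rnorm g (w s t) (G (w s t)))\<^sup>2 / \<bar>D\<bar>)
                    else \<psi> s t)
          in V s t =
               \<phi> s t *\<^sub>R (b (w s t) - tr (w s 0) (w s t) (b (w s 0) - G (w s 0))) +
               \<psi>' *\<^sub>R (b (w s t) - tr (w s (t - 1)) (w s t) (b (w s (t - 1)) - V s (t - 1))) +
               (1 - \<phi> s t - \<psi>') *\<^sub>R b (w s t))))"

end

theory Submission
  imports Defs
begin

text \<open>
Number the iterates consecutively, \<open>W\<^sub>k\<close> with \<open>k = (s - 1) m + t\<close>, and put
\<open>a\<^sub>k = E \<parallel>grad f (W\<^sub>k)\<parallel>\<^sup>2\<close>. The convergence \<open>a\<^sub>k \<rightarrow> 0\<close> rests on three facts.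

\<^item> On average, the search direction is a descent direction. Averaging over a fresh batch turns every
batch gradient into the full gradient. The correction towards the start of the epoch then cancels,
and what remains of \<open>V\<^sub>t\<close> is \<open>grad f (w\<^sub>t)\<close> plus the damped transport of
\<open>V\<^sub>t\<^sub>-\<^sub>1 - grad f (w\<^sub>t\<^sub>-\<^sub>1)\<close>. The damping factor is chosen so that the second term can spoil at most
the fraction \<open>\<mu>\<close> of \<open>\<parallel>grad f (w\<^sub>t)\<parallel>\<^sup>2\<close>. Hence the mean of \<open>\<langle>grad f (W\<^sub>k), V\<^sub>k\<rangle>\<close> is at least
\<open>(1 - \<mu>) a\<^sub>k\<close> (\<open>sum_metric_direction_ge\<close>).

\<^item> The search directions are bounded. Transports are isometric and gradients are bounded on \<open>\<Omega>\<close>, so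
one update increases the norm by at most a constant, and every \<open>m\<close> updates there is a restart
(\<open>flat_run_bounded\<close>). As the step sizes tend to zero, so do the lengths of the steps
\<open>\<alpha>\<^sub>k V\<^sub>k\<close>.

\<^item> Along short steps \<open>\<eta>\<close> from a point \<open>p\<close> of \<open>\<Omega>\<close>, the function \<open>f\<close> changes by
\<open>\<langle>grad f p, \<eta>\<rangle>\<close> up to an error of order \<open>\<parallel>\<eta>\<parallel>\<^sup>2\<close>, and \<open>\<parallel>grad f\<parallel>\<^sup>2\<close> changes by at most
\<open>O(\<parallel>\<eta>\<parallel>)\<close>, uniformly in \<open>p\<close> (\<open>retraction_bounds_on_compact\<close>). A short step stays in one chart, so
this is a local estimate that compactness of \<open>\<Omega>\<close> makes uniform.

The second-order estimate and the first two facts give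
\<open>E f (W\<^sub>k\<^sub>+\<^sub>1) \<le> E f (W\<^sub>k) - (1 - \<mu>) \<alpha>\<^sub>k a\<^sub>k + O(\<alpha>\<^sub>k\<^sup>2)\<close> for large \<open>k\<close>. As \<open>f\<close> is bounded below and the
step sizes are square summable, \<open>\<Sum>\<alpha>\<^sub>k a\<^sub>k\<close> converges (\<open>summable_if_descent\<close>). The first-order
estimate gives \<open>\<bar>a\<^sub>k\<^sub>+\<^sub>1 - a\<^sub>k\<bar> = O(\<alpha>\<^sub>k)\<close>: between an index with \<open>a\<^sub>k \<ge> \<epsilon>\<close> and a later one with
\<open>a\<^sub>j < \<epsilon>/2\<close> the step sizes add up to a fixed positive amount. With
\<open>\<Sum>\<alpha>\<^sub>k = \<infinity>\<close> this forces \<open>a\<^sub>k \<rightarrow> 0\<close> (\<open>tendsto_zero_if_weighted_summable\<close>).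

All random quantities up to time \<open>k\<close> are functions of finitely many batches, each with finitely many
values. They are therefore simple functions, and the conditional expectation given the past reduces to
a finite sum over the possible histories (\<open>expectation_fresh_uniform\<close>).
\<close>

section \<open>Functions that are Lipschitz near a point\<close>

text \<open>Stating the bound through the product filter leaves the size of the neighbourhood implicit, so
several such bounds are combined without any bookkeeping of radii.\<close>

definition lipschitz_near :: "('a::metric_space \<Rightarrow> 'b::metric_space) \<Rightarrow> 'a \<Rightarrow> bool" where
  "lipschitz_near f z \<longleftrightarrow>
     (\<exists>L\<ge>0. \<forall>\<^sub>F (x, y) in nhds z \<times>\<^sub>F nhds z. dist (f x) (f y) \<le> L * dist x y)"

lemma lipschitz_nearI:
  assumes "0 < r" "\<And>x y. x \<in> ball z r \<Longrightarrow> y \<in> ball z r \<Longrightarrow> dist (f x) (f y) \<le> L * dist x y"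
  shows "lipschitz_near f z"
proof -
  have ev: "\<forall>\<^sub>F x in nhds z. x \<in> ball z r"
    using assms(1) by (intro eventually_nhds_in_open) auto
  have "\<forall>\<^sub>F (x, y) in nhds z \<times>\<^sub>F nhds z. dist (f x) (f y) \<le> max L 0 * dist x y"
    unfolding eventually_prod_filter
  proof (rule exI[of _ "\<lambda>x. x \<in> ball z r"], rule exI[of _ "\<lambda>x. x \<in> ball z r"],
      intro conjI ev allI impI)
    fix x y assume "x \<in> ball z r" "y \<in> ball z r"
    from assms(2)[OF this] have "dist (f x) (f y) \<le> L * dist x y" .
    also have "\<dots> \<le> max L 0 * dist x y" by (intro mult_right_mono) auto
    finally show "case (x, y) of (x, y) \<Rightarrow> dist (f x) (f y) \<le> max L 0 * dist x y" by simp
  qed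
  then show ?thesis unfolding lipschitz_near_def by (intro exI[of _ "max L 0"]) auto
qed

lemma lipschitz_nearE:
  assumes "lipschitz_near f z"
  obtains L where "0 \<le> L" "\<forall>\<^sub>F (x, y) in nhds z \<times>\<^sub>F nhds z. dist (f x) (f y) \<le> L * dist x y"
  using assms unfolding lipschitz_near_def by blast

lemma lipschitz_near_imp_tendsto:
  assumes "lipschitz_near f z" shows "(f \<longlongrightarrow> f z) (nhds z)"
proof -
  obtain L where L: "0 \<le> L" "\<forall>\<^sub>F (x, y) in nhds z \<times>\<^sub>F nhds z. dist (f x) (f y) \<le> L * dist x y"
    using assms by (rule lipschitz_nearE)
  then obtain P Q where PQ: "eventually P (nhds z)" "eventually Q (nhds z)"
    "\<And>x y. P x \<Longrightarrow> Q y \<Longrightarrow> dist (f x) (f y) \<le> L * dist x y"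
    unfolding eventually_prod_filter by auto
  have "Q z" using PQ(2) by (rule eventually_nhds_x_imp_x)
  then have "\<forall>\<^sub>F x in nhds z. dist (f x) (f z) \<le> L * dist x z"
    using PQ by (auto elim: eventually_mono)
  moreover have "((\<lambda>x. L * dist x z) \<longlongrightarrow> L * dist z z) (nhds z)"
    by (intro tendsto_intros filterlim_ident)
  ultimately have "((\<lambda>x. dist (f x) (f z)) \<longlongrightarrow> 0) (nhds z)"
    by (intro tendsto_sandwich[of "\<lambda>_. 0" "\<lambda>x. dist (f x) (f z)"]) auto
  then show ?thesis by (rule tendsto_dist_iff[THEN iffD2])
qed

lemma lipschitz_near_imp_bounded:
  fixes f :: "'a::metric_space \<Rightarrow> 'b::real_normed_vector"
  assumes "lipschitz_near f z" shows "\<forall>\<^sub>F x in nhds z. norm (f x) \<le> norm (f z) + 1"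
proof -
  have "((\<lambda>x. norm (f x)) \<longlongrightarrow> norm (f z)) (nhds z)"
    using lipschitz_near_imp_tendsto[OF assms] by (rule tendsto_norm)
  then have "\<forall>\<^sub>F x in nhds z. norm (f x) < norm (f z) + 1"
    by (rule order_tendstoD) simp
  then show ?thesis by (rule eventually_mono) simp
qed

lemma lipschitz_near_const [simp]: "lipschitz_near (\<lambda>_. c) z"
  by (rule lipschitz_nearI[of 1 _ _ 0]) auto

lemma lipschitz_near_add:
  fixes f h :: "'a::metric_space \<Rightarrow> 'b::real_normed_vector"
  assumes "lipschitz_near f z" "lipschitz_near h z"
  shows "lipschitz_near (\<lambda>x. f x + h x) z"
proof -
  from assms obtain L K where
    L: "0 \<le> L" "\<forall>\<^sub>F (x, y) in nhds z \<times>\<^sub>F nhds z. dist (f x) (f y) \<le> L * dist x y" and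
    K: "0 \<le> K" "\<forall>\<^sub>F (x, y) in nhds z \<times>\<^sub>F nhds z. dist (h x) (h y) \<le> K * dist x y"
    by (auto elim!: lipschitz_nearE)
  have "\<forall>\<^sub>F (x, y) in nhds z \<times>\<^sub>F nhds z. dist (f x + h x) (f y + h y) \<le> (L + K) * dist x y"
    using L(2) K(2)
  proof eventually_elim
    case (elim p)
    obtain x y where p: "p = (x, y)" by force
    have "dist (f x + h x) (f y + h y) \<le> dist (f x) (f y) + dist (h x) (h y)"
      by (rule dist_triangle_add)
    with elim show ?case by (simp add: p distrib_right)
  qed
  with L K show ?thesis unfolding lipschitz_near_def by (intro exI[of _ "L + K"]) auto
qed

lemma lipschitz_near_sum:
  fixes f :: "'i \<Rightarrow> 'a::metric_space \<Rightarrow> 'b::real_normed_vector"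
  assumes "\<And>i. i \<in> S \<Longrightarrow> lipschitz_near (f i) z"
  shows "lipschitz_near (\<lambda>x. \<Sum>i\<in>S. f i x) z"
  using assms by (induction S rule: infinite_finite_induct) (auto intro: lipschitz_near_add)

text \<open>Split \<open>P (f x) (h x) - P (f y) (h y)\<close> into \<open>P (f x) (h x - h y)\<close> and \<open>P (f x - f y) (h y)\<close>; the
undifferenced factors are bounded near \<open>z\<close>.\<close>

lemma lipschitz_near_bilinear:
  fixes f :: "'a::metric_space \<Rightarrow> 'b::real_normed_vector" and h :: "'a \<Rightarrow> 'c::real_normed_vector"
    and P :: "'b \<Rightarrow> 'c \<Rightarrow> 'd::real_normed_vector"
  assumes P: "bounded_bilinear P" and fh: "lipschitz_near f z" "lipschitz_near h z"
  shows "lipschitz_near (\<lambda>x. P (f x) (h x)) z"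
proof -
  interpret P: bounded_bilinear P by fact
  obtain B where B: "0 \<le> B" "\<And>a b. norm (P a b) \<le> norm a * norm b * B"
    using P.nonneg_bounded by blast
  from fh obtain L K where
    L: "0 \<le> L" "\<forall>\<^sub>F (x, y) in nhds z \<times>\<^sub>F nhds z. dist (f x) (f y) \<le> L * dist x y" and
    K: "0 \<le> K" "\<forall>\<^sub>F (x, y) in nhds z \<times>\<^sub>F nhds z. dist (h x) (h y) \<le> K * dist x y"
    by (auto elim!: lipschitz_nearE)
  define a where "a = norm (f z) + 1"
  define b where "b = norm (h z) + 1"
  have ab: "0 \<le> a" "0 \<le> b" unfolding a_def b_def by simp_all
  have fa: "\<forall>\<^sub>F (x, y) in nhds z \<times>\<^sub>F nhds z. norm (f x) \<le> a"
    using eventually_prod1[of "nhds z" "\<lambda>x. norm (f x) \<le> a" "nhds z"] lipschitz_near_imp_bounded[OF fh(1)]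
    by (simp add: a_def)
  have hb: "\<forall>\<^sub>F (x, y) in nhds z \<times>\<^sub>F nhds z. norm (h y) \<le> b"
    using eventually_prod2[of "nhds z" "\<lambda>x. norm (h x) \<le> b" "nhds z"] lipschitz_near_imp_bounded[OF fh(2)]
    by (simp add: b_def)
  have "\<forall>\<^sub>F (x, y) in nhds z \<times>\<^sub>F nhds z.
      dist (P (f x) (h x)) (P (f y) (h y)) \<le> (a * K * B + L * b * B) * dist x y"
    using L(2) K(2) fa hb
  proof eventually_elim
    case (elim p)
    obtain x y where p: "p = (x, y)" by force
    have "P (f x) (h x) - P (f y) (h y) = P (f x) (h x - h y) + P (f x - f y) (h y)"
      by (simp add: P.diff_left P.diff_right)
    then have "dist (P (f x) (h x)) (P (f y) (h y))
        \<le> norm (P (f x) (h x - h y)) + norm (P (f x - f y) (h y))"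
      by (simp add: dist_norm norm_triangle_ineq)
    also have "norm (P (f x) (h x - h y)) \<le> norm (f x) * norm (h x - h y) * B" by (rule B)
    also have "\<dots> \<le> a * (K * dist x y) * B"
      using elim ab B by (intro mult_right_mono mult_mono) (auto simp: p dist_norm)
    also have "norm (P (f x - f y) (h y)) \<le> norm (f x - f y) * norm (h y) * B" by (rule B)
    also have "\<dots> \<le> (L * dist x y) * b * B"
      using elim ab B L by (intro mult_right_mono mult_mono) (auto simp: p dist_norm)
    finally show ?case by (simp add: p algebra_simps)
  qed
  with L K B ab show ?thesis unfolding lipschitz_near_def
    by (intro exI[of _ "a * K * B + L * b * B"]) auto
qed

lemmas lipschitz_near_inner = lipschitz_near_bilinear[OF bounded_bilinear_inner]
lemmas lipschitz_near_scaleR = lipschitz_near_bilinear[OF bounded_bilinear_scaleR]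

lemma lipschitz_near_compose:
  assumes f: "lipschitz_near f z" and h: "lipschitz_near h (f z)"
  shows "lipschitz_near (\<lambda>x. h (f x)) z"
proof -
  from assms obtain L K where
    L: "0 \<le> L" "\<forall>\<^sub>F (x, y) in nhds z \<times>\<^sub>F nhds z. dist (f x) (f y) \<le> L * dist x y" and
    K: "0 \<le> K" "\<forall>\<^sub>F (x, y) in nhds (f z) \<times>\<^sub>F nhds (f z). dist (h x) (h y) \<le> K * dist x y"
    by (auto elim!: lipschitz_nearE)
  have "filterlim (\<lambda>p. (f (fst p), f (snd p))) (nhds (f z) \<times>\<^sub>F nhds (f z)) (nhds z \<times>\<^sub>F nhds z)"
    using lipschitz_near_imp_tendsto[OF f]
    by (intro filterlim_Pair filterlim_compose[OF _ filterlim_fst]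
          filterlim_compose[OF _ filterlim_snd])
  from filterlim_cong[THEN iffD1, OF refl refl _ this] K(2)
  have "\<forall>\<^sub>F p in nhds z \<times>\<^sub>F nhds z.
      dist (h (f (fst p))) (h (f (snd p))) \<le> K * dist (f (fst p)) (f (snd p))"
    using \<open>filterlim _ _ _\<close> unfolding filterlim_iff by (fastforce simp: case_prod_beta)
  then have "\<forall>\<^sub>F (x, y) in nhds z \<times>\<^sub>F nhds z. dist (h (f x)) (h (f y)) \<le> (K * L) * dist x y"
    using L(2)
  proof eventually_elim
    case (elim p)
    then have "K * dist (f (fst p)) (f (snd p)) \<le> K * (L * dist (fst p) (snd p))"
      using K(1) by (intro mult_left_mono) (auto simp: case_prod_beta)
    with elim show ?case by (simp add: case_prod_beta mult.assoc)
  qed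
  with L K show ?thesis unfolding lipschitz_near_def by (intro exI[of _ "K * L"]) auto
qed

lemma lipschitz_near_cong:
  assumes "\<forall>\<^sub>F x in nhds z. f x = h x" "lipschitz_near f z" shows "lipschitz_near h z"
proof -
  obtain L where L: "0 \<le> L" "\<forall>\<^sub>F (x, y) in nhds z \<times>\<^sub>F nhds z. dist (f x) (f y) \<le> L * dist x y"
    using assms(2) by (rule lipschitz_nearE)
  have "\<forall>\<^sub>F (x, y) in nhds z \<times>\<^sub>F nhds z. f x = h x"
    using eventually_prod1[of "nhds z" "\<lambda>x. f x = h x" "nhds z"] assms(1) by simp
  moreover have "\<forall>\<^sub>F (x, y) in nhds z \<times>\<^sub>F nhds z. f y = h y"
    using eventually_prod2[of "nhds z" "\<lambda>x. f x = h x" "nhds z"] assms(1) by simp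
  ultimately have "\<forall>\<^sub>F (x, y) in nhds z \<times>\<^sub>F nhds z. dist (h x) (h y) \<le> L * dist x y"
    using L(2) by eventually_elim (auto simp: case_prod_beta)
  with L(1) show ?thesis unfolding lipschitz_near_def by blast
qed

lemma eventually_prod_same_point:
  assumes "\<forall>\<^sub>F (x, y) in nhds z \<times>\<^sub>F nhds z. P x y"
  shows "\<forall>\<^sub>F x in nhds z. P x z"
proof -
  have "filterlim (\<lambda>x. (x, z)) (nhds z \<times>\<^sub>F nhds z) (nhds z)"
    by (intro filterlim_Pair filterlim_ident tendsto_const)
  then show ?thesis using assms unfolding filterlim_iff by fastforce
qed

text \<open>A linear map is determined by its values on the finite basis, so Lipschitz dependence of each single
value on the parameter is automatically uniform over all arguments of norm one. This is how
statements about fixed directions become statements about operators below.\<close>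

lemma lipschitz_near_linear_family:
  fixes \<L> :: "'z::metric_space \<Rightarrow> 'e::euclidean_space \<Rightarrow> 'b::real_normed_vector"
  assumes lin: "\<forall>\<^sub>F x in nhds z. linear (\<L> x)"
    and lip: "\<And>b. b \<in> Basis \<Longrightarrow> lipschitz_near (\<lambda>x. \<L> x b) z"
  shows "\<exists>L\<ge>0. \<forall>\<^sub>F (x, y) in nhds z \<times>\<^sub>F nhds z. \<forall>u. norm (\<L> x u - \<L> y u) \<le> L * dist x y * norm u"
proof -
  have "\<forall>b\<in>Basis. \<exists>L\<ge>0. \<forall>\<^sub>F (x, y) in nhds z \<times>\<^sub>F nhds z. dist (\<L> x b) (\<L> y b) \<le> L * dist x y"
    using lip unfolding lipschitz_near_def by blast
  from bchoice[OF this] obtain L where L: "\<And>b. b \<in> Basis \<Longrightarrow> 0 \<le> L b"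
    "\<And>b. b \<in> Basis \<Longrightarrow>
      \<forall>\<^sub>F (x, y) in nhds z \<times>\<^sub>F nhds z. dist (\<L> x b) (\<L> y b) \<le> L b * dist x y"
    by blast
  have all: "\<forall>\<^sub>F p in nhds z \<times>\<^sub>F nhds z. \<forall>b\<in>Basis.
      dist (\<L> (fst p) b) (\<L> (snd p) b) \<le> L b * dist (fst p) (snd p)"
    using L(2) unfolding case_prod_beta by (intro eventually_ball_finite ballI) auto
  have lin1: "\<forall>\<^sub>F (x, y) in nhds z \<times>\<^sub>F nhds z. linear (\<L> x)"
    using eventually_prod1[of "nhds z" "\<lambda>x. linear (\<L> x)" "nhds z"] lin by simp
  have lin2: "\<forall>\<^sub>F (x, y) in nhds z \<times>\<^sub>F nhds z. linear (\<L> y)"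
    using eventually_prod2[of "nhds z" "\<lambda>x. linear (\<L> x)" "nhds z"] lin by simp
  have "\<forall>\<^sub>F (x, y) in nhds z \<times>\<^sub>F nhds z. \<forall>u.
      norm (\<L> x u - \<L> y u) \<le> (\<Sum>b\<in>Basis. L b) * dist x y * norm u"
    using all lin1 lin2
  proof eventually_elim
    case (elim p)
    obtain x y where p: "p = (x, y)" by force
    have "norm (\<L> x u - \<L> y u) \<le> (\<Sum>b\<in>Basis. L b) * dist x y * norm u" for u
    proof -
      have rep: "\<L> a u = (\<Sum>b\<in>Basis. (u \<bullet> b) *\<^sub>R \<L> a b)" if "linear (\<L> a)" for a
        using that by (subst euclidean_representation[of u, symmetric])
          (simp add: linear_sum linear_scale)
      have "\<L> x u - \<L> y u = (\<Sum>b\<in>Basis. (u \<bullet> b) *\<^sub>R (\<L> x b - \<L> y b))"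
        using elim by (simp add: p rep[of x] rep[of y] sum_subtractf scaleR_diff_right)
      also have "norm \<dots> \<le> (\<Sum>b\<in>Basis. norm u * (L b * dist x y))"
      proof (rule sum_norm_le)
        fix b :: 'e assume b: "b \<in> Basis"
        have "\<bar>u \<bullet> b\<bar> * norm (\<L> x b - \<L> y b) \<le> norm u * (L b * dist x y)"
          using elim b by (intro mult_mono Basis_le_norm) (auto simp: p dist_norm)
        then show "norm ((u \<bullet> b) *\<^sub>R (\<L> x b - \<L> y b)) \<le> norm u * (L b * dist x y)" by simp
      qed
      also have "\<dots> = (\<Sum>b\<in>Basis. L b) * dist x y * norm u"
        by (simp add: sum_distrib_left sum_distrib_right mult_ac)
      finally show ?thesis .
    qed
    then show ?case by (simp add: p)
  qed
  moreover have "0 \<le> (\<Sum>b\<in>Basis. L b)" using L(1) by (intro sum_nonneg)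
  ultimately show ?thesis by blast
qed

lemma ck_on_SucD: "ck_on (Suc k) S f \<Longrightarrow> ck_on k S f"
proof (induction k arbitrary: f)
  case 0
  then show ?case
    by (auto intro!: continuous_at_imp_continuous_on differentiable_imp_continuous_within)
qed auto

lemma ck_on_mono: "ck_on k S f \<Longrightarrow> j \<le> k \<Longrightarrow> ck_on j S f"
proof (induction k)
  case (Suc k)
  show ?case
  proof (cases "j = Suc k")
    case False
    then show ?thesis using Suc.IH Suc.prems ck_on_SucD[OF Suc.prems(1)] by linarith
  qed (use Suc.prems in simp)
qed simp

lemma ck_on_differentiable: "ck_on (Suc k) S f \<Longrightarrow> x \<in> S \<Longrightarrow> f differentiable (at x)"
  by simp

lemma ck_on_has_derivative:
  "ck_on (Suc k) S f \<Longrightarrow> x \<in> S \<Longrightarrow> (f has_derivative frechet_derivative f (at x)) (at x)"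
  by (simp add: frechet_derivative_works)

text \<open>The partial derivatives are continuous, hence bounded on a small ball, which bounds the operator norm
of the derivative there; the mean value inequality on the ball does the rest.\<close>

lemma ck_on_Suc_0_imp_lipschitz_near:
  fixes f :: "'a::euclidean_space \<Rightarrow> 'b::real_normed_vector"
  assumes S: "open S" "z \<in> S" and f: "ck_on (Suc 0) S f"
  shows "lipschitz_near f z"
proof -
  let ?D = "\<lambda>x. frechet_derivative f (at x)"
  have "\<forall>\<^sub>F x in nhds z. \<forall>b\<in>Basis. norm (?D x b) < norm (?D z b) + 1"
  proof (intro eventually_ball_finite ballI)
    fix b :: 'a
    have "continuous_on S (\<lambda>x. ?D x b)" using f by simp
    then have "isCont (\<lambda>x. ?D x b) z" using S by (simp add: continuous_on_eq_continuous_at)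
    then have "((\<lambda>x. ?D x b) \<longlongrightarrow> ?D z b) (nhds z)"
      unfolding isCont_def by (rule tendsto_at_iff_tendsto_nhds[THEN iffD1])
    then have "((\<lambda>x. norm (?D x b)) \<longlongrightarrow> norm (?D z b)) (nhds z)"
      by (rule tendsto_norm)
    then show "\<forall>\<^sub>F x in nhds z. norm (?D x b) < norm (?D z b) + 1"
      by (rule order_tendstoD) simp
  qed simp
  then have "\<forall>\<^sub>F x in nhds z. x \<in> S \<and> (\<forall>b\<in>Basis. norm (?D x b) < norm (?D z b) + 1)"
    using eventually_nhds_in_open[OF S] by eventually_elim auto
  then obtain r where r: "0 < r"
    "\<And>x. dist x z < r \<Longrightarrow> x \<in> S \<and> (\<forall>b\<in>Basis. norm (?D x b) < norm (?D z b) + 1)"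
    unfolding eventually_nhds_metric by blast
  define C where "C = (\<Sum>b\<in>Basis. norm (?D z b) + 1)"
  have "dist (f x) (f y) \<le> C * dist x y" if xy: "x \<in> ball z r" "y \<in> ball z r" for x y
  proof -
    have "norm (f x - f y) \<le> C * norm (x - y)"
    proof (rule differentiable_bound[of "ball z r" f ?D])
      fix a assume a: "a \<in> ball z r"
      then have aS: "a \<in> S" using r(2)[of a] by (simp add: dist_commute)
      then have d: "(f has_derivative ?D a) (at a)" using f by (rule ck_on_has_derivative[rotated])
      then show "(f has_derivative ?D a) (at a within ball z r)" by (rule has_derivative_at_withinI)
      have lin: "linear (?D a)" using d by (rule has_derivative_linear)
      show "onorm (?D a) \<le> C"
      proof (rule onorm_le)
        fix u :: 'a
        have "?D a u = (\<Sum>b\<in>Basis. (u \<bullet> b) *\<^sub>R ?D a b)"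
          using lin by (subst euclidean_representation[of u, symmetric])
            (simp only: linear_sum linear_scale)
        also have "norm \<dots> \<le> (\<Sum>b\<in>Basis. norm u * (norm (?D z b) + 1))"
        proof (rule sum_norm_le)
          fix b :: 'a assume b: "b \<in> Basis"
          have "\<bar>u \<bullet> b\<bar> * norm (?D a b) \<le> norm u * (norm (?D z b) + 1)"
            using r(2)[of a] a b
            by (intro mult_mono Basis_le_norm) (auto simp: dist_commute intro: less_imp_le)
          then show "norm ((u \<bullet> b) *\<^sub>R ?D a b) \<le> norm u * (norm (?D z b) + 1)" by simp
        qed
        also have "\<dots> = C * norm u" by (simp add: C_def sum_distrib_left mult.commute)
        finally show "norm (?D a u) \<le> C * norm u" .
      qed
    qed (use xy in auto)
    then show ?thesis by (simp add: dist_norm)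
  qed
  with r(1) show ?thesis by (rule lipschitz_nearI)
qed

section \<open>Inner products depending on a parameter\<close>

text \<open>A family of bilinear forms like the coordinate expression of a Riemannian metric around a point.
Positivity is demanded only at the centre \<open>z\<close>; it spreads to a neighbourhood by
\<open>eventually_coercive\<close>.\<close>

locale local_metric =
  fixes \<gamma> :: "'e::euclidean_space \<Rightarrow> 'e \<Rightarrow> 'e \<Rightarrow> real" and z :: 'e
  assumes eventually_linear: "\<forall>\<^sub>F x in nhds z. \<forall>u. linear (\<gamma> x u)"
    and eventually_sym: "\<forall>\<^sub>F x in nhds z. \<forall>u v. \<gamma> x u v = \<gamma> x v u"
    and pos: "u \<noteq> 0 \<Longrightarrow> 0 < \<gamma> z u u"
    and lipschitz: "lipschitz_near (\<lambda>x. \<gamma> x u v) z"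
begin

text \<open>The operator that represents the form \<open>\<gamma> x\<close> with respect to the Euclidean inner product, that is,
lowering of indices. It is linear in the vector and so accessible to
\<open>lipschitz_near_linear_family\<close>.\<close>

definition flat :: "'e \<Rightarrow> 'e \<Rightarrow> 'e" where
  "flat x u = (\<Sum>b\<in>Basis. \<gamma> x u b *\<^sub>R b)"

lemma flat_inner: "linear (\<gamma> x u) \<Longrightarrow> flat x u \<bullet> v = \<gamma> x u v"
proof -
  assume lin: "linear (\<gamma> x u)"
  have "\<gamma> x u v = \<gamma> x u (\<Sum>b\<in>Basis. (v \<bullet> b) *\<^sub>R b)" by (simp add: euclidean_representation)
  also have "\<dots> = (\<Sum>b\<in>Basis. (v \<bullet> b) * \<gamma> x u b)"
    using lin by (simp only: linear_sum linear_scale real_scaleR_def)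
  also have "\<dots> = flat x u \<bullet> v"
    unfolding flat_def by (simp add: inner_sum_left inner_commute[of v] mult.commute)
  finally show ?thesis by simp
qed

lemma eventually_linear_flat: "\<forall>\<^sub>F x in nhds z. linear (flat x)"
  using eventually_linear eventually_sym
proof eventually_elim
  case (elim x)
  then have add: "\<gamma> x (u + v) b = \<gamma> x u b + \<gamma> x v b" and scale: "\<gamma> x (r *\<^sub>R u) b = r * \<gamma> x u b" for u v b r
    by (metis linear_add, metis linear_scale real_scaleR_def)
  show ?case
    by (rule linearI)
      (simp_all add: flat_def add scale scaleR_add_left sum.distrib scaleR_sum_right)
qed

lemma flat_lipschitz:
  "\<exists>L\<ge>0. \<forall>\<^sub>F (x, y) in nhds z \<times>\<^sub>F nhds z. \<forall>u. norm (flat x u - flat y u) \<le> L * dist x y * norm u"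
proof (rule lipschitz_near_linear_family[OF eventually_linear_flat])
  fix u :: 'e
  show "lipschitz_near (\<lambda>x. flat x u) z"
    unfolding flat_def
    by (intro lipschitz_near_sum lipschitz_near_scaleR lipschitz lipschitz_near_const)
qed

text \<open>At \<open>z\<close> the form attains a positive minimum on the unit sphere. The operators depend continuously on
\<open>x\<close>, so half of this minimum survives for all \<open>x\<close> near \<open>z\<close>.\<close>

lemma eventually_coercive: "\<exists>l>0. \<forall>\<^sub>F x in nhds z. \<forall>u. l * (norm u)\<^sup>2 \<le> \<gamma> x u u"
proof -
  have lin: "linear (\<gamma> z u)" for u using eventually_nhds_x_imp_x[OF eventually_linear] by blast
  have linf: "linear (flat z)" using eventually_nhds_x_imp_x[OF eventually_linear_flat] .
  have flatz: "flat z u \<bullet> v = \<gamma> z u v" for u v by (rule flat_inner[OF lin])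
  have cont: "continuous_on (sphere 0 1) (\<lambda>u. flat z u \<bullet> u)"
    using linear_continuous_on[OF linf[unfolded linear_conv_bounded_linear]]
    by (intro continuous_intros)
  obtain u0 :: 'e where u0: "u0 \<in> sphere 0 1"
    "\<And>u. u \<in> sphere 0 1 \<Longrightarrow> flat z u0 \<bullet> u0 \<le> flat z u \<bullet> u"
    using continuous_attains_inf[OF compact_sphere _ cont] by auto
  define l where "l = \<gamma> z u0 u0"
  have l: "0 < l" unfolding l_def using u0(1) by (intro pos) auto
  have low: "l * (norm u)\<^sup>2 \<le> \<gamma> z u u" for u
  proof (cases "u = 0")
    case False
    have "l \<le> flat z (u /\<^sub>R norm u) \<bullet> (u /\<^sub>R norm u)"
      using u0(2)[of "u /\<^sub>R norm u"] False by (simp add: l_def flatz)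
    also have "\<dots> = \<gamma> z u u / (norm u)\<^sup>2"
      using linear_scale[OF linf] by (simp add: flatz power2_eq_square field_simps)
    finally show ?thesis using False by (simp add: field_simps)
  next
    case True
    then show ?thesis using linear_0[OF lin[of 0]] by simp
  qed
  obtain L where L: "0 \<le> L"
    "\<forall>\<^sub>F (x, y) in nhds z \<times>\<^sub>F nhds z. \<forall>u. norm (flat x u - flat y u) \<le> L * dist x y * norm u"
    using flat_lipschitz by blast
  have "((\<lambda>x. L * dist x z) \<longlongrightarrow> L * dist z z) (nhds z)"
    by (intro tendsto_intros filterlim_ident)
  then have small: "\<forall>\<^sub>F x in nhds z. L * dist x z < l / 2"
    using l by (intro order_tendstoD[of _ 0]) auto
  have "\<forall>\<^sub>F x in nhds z. \<forall>u. (l / 2) * (norm u)\<^sup>2 \<le> \<gamma> x u u"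
    using eventually_prod_same_point[OF L(2)] small eventually_linear
  proof eventually_elim
    case (elim x)
    show ?case
    proof
      fix u
      have "\<gamma> z u u - \<gamma> x u u = - ((flat x u - flat z u) \<bullet> u)"
        using elim(3) by (simp add: inner_diff_left flat_inner lin)
      also have "\<dots> \<le> norm (flat x u - flat z u) * norm u"
        using Cauchy_Schwarz_ineq2[of "flat x u - flat z u" u] by linarith
      also have "\<dots> \<le> (L * dist x z * norm u) * norm u"
        using elim(1) by (intro mult_right_mono) auto
      also have "\<dots> = L * dist x z * (norm u)\<^sup>2" by (simp add: power2_eq_square)
      also have "\<dots> \<le> l / 2 * (norm u)\<^sup>2" using elim(2) by (intro mult_right_mono) auto
      finally show "l / 2 * (norm u)\<^sup>2 \<le> \<gamma> x u u" using low[of u] by simp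
    qed
  qed
  with l show ?thesis by (intro exI[of _ "l / 2"]) auto
qed

text \<open>This yields the regularity of gradient fields without inverting a matrix: subtracting the equations
\<open>flat x (s x) = r x\<close> and \<open>flat y (s y) = r y\<close> bounds \<open>flat x (s x - s y)\<close> by a multiple of
\<open>dist x y\<close>, and coercivity turns this into a bound for \<open>s x - s y\<close>.\<close>

lemma solution_lipschitz:
  assumes r: "lipschitz_near r z" and s: "\<forall>\<^sub>F x in nhds z. \<forall>v. \<gamma> x (s x) v = r x \<bullet> v"
  shows "lipschitz_near s z"
proof -
  obtain l where l: "0 < l" "\<forall>\<^sub>F x in nhds z. \<forall>u. l * (norm u)\<^sup>2 \<le> \<gamma> x u u"
    using eventually_coercive by blast
  have inv: "\<forall>\<^sub>F x in nhds z. linear (flat x) \<and> flat x (s x) = r x \<and> (\<forall>u. l * norm u \<le> norm (flat x u))"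
    using l(2) s eventually_linear eventually_linear_flat
  proof eventually_elim
    case (elim x)
    have "flat x (s x) \<bullet> v = r x \<bullet> v" for v using elim by (simp add: flat_inner)
    then have "flat x (s x) = r x" using vector_eq_rdot by blast
    moreover have "l * norm u \<le> norm (flat x u)" for u
    proof (cases "u = 0")
      case False
      have "l * (norm u)\<^sup>2 \<le> flat x u \<bullet> u" using elim by (simp add: flat_inner)
      also have "\<dots> \<le> norm (flat x u) * norm u" by (rule norm_cauchy_schwarz)
      finally show ?thesis using False by (simp add: power2_eq_square)
    qed simp
    ultimately show ?case using elim by blast
  qed
  obtain L where L: "0 \<le> L"
    "\<forall>\<^sub>F (x, y) in nhds z \<times>\<^sub>F nhds z. \<forall>u. norm (flat x u - flat y u) \<le> L * dist x y * norm u"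
    using flat_lipschitz by blast
  obtain K where K: "0 \<le> K" "\<forall>\<^sub>F (x, y) in nhds z \<times>\<^sub>F nhds z. dist (r x) (r y) \<le> K * dist x y"
    using r by (rule lipschitz_nearE)
  define C where "C = (norm (r z) + 1) / l"
  have "\<forall>\<^sub>F x in nhds z. norm (s x) \<le> C"
    using lipschitz_near_imp_bounded[OF r] inv
  proof eventually_elim
    case (elim x)
    then have "l * norm (s x) \<le> norm (r z) + 1" by (metis order_trans)
    then show ?case using l(1) by (simp add: C_def field_simps)
  qed
  with inv have inv': "\<forall>\<^sub>F x in nhds z. linear (flat x) \<and> flat x (s x) = r x
      \<and> (\<forall>u. l * norm u \<le> norm (flat x u)) \<and> norm (s x) \<le> C"
    by eventually_elim blast
  let ?Q = "\<lambda>x. linear (flat x) \<and> flat x (s x) = r x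
      \<and> (\<forall>u. l * norm u \<le> norm (flat x u)) \<and> norm (s x) \<le> C"
  have i1: "\<forall>\<^sub>F (x, y) in nhds z \<times>\<^sub>F nhds z. ?Q x"
    using eventually_prod1[of "nhds z" ?Q "nhds z"] inv' by simp
  have i2: "\<forall>\<^sub>F (x, y) in nhds z \<times>\<^sub>F nhds z. ?Q y"
    using eventually_prod2[of "nhds z" ?Q "nhds z"] inv' by simp
  have "\<forall>\<^sub>F (x, y) in nhds z \<times>\<^sub>F nhds z. dist (s x) (s y) \<le> ((K + L * C) / l) * dist x y"
    using L(2) K(2) i1 i2
  proof eventually_elim
    case (elim p)
    obtain x y where p: "p = (x, y)" by force
    note elim = elim[unfolded p prod.case]
    have "flat x (s x - s y) = (r x - r y) - (flat x (s y) - flat y (s y))"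
      using elim(3,4) by (simp add: linear_diff)
    then have "l * norm (s x - s y) \<le> norm (r x - r y) + norm (flat x (s y) - flat y (s y))"
      using elim(3) by (metis norm_triangle_ineq4 order_trans)
    also have "norm (r x - r y) \<le> K * dist x y" using elim(2) by (simp add: dist_norm)
    also have "norm (flat x (s y) - flat y (s y)) \<le> L * dist x y * norm (s y)" using elim(1) by blast
    also have "\<dots> \<le> L * dist x y * C" using elim(4) L by (intro mult_left_mono) auto
    finally show ?case using l(1) by (simp add: p dist_norm field_simps)
  qed
  moreover have "0 \<le> (K + L * C) / l" using K L l(1) unfolding C_def by simp
  ultimately show ?thesis unfolding lipschitz_near_def by blast
qed

end

text \<open>Riesz representation in finite dimension: the operator of a definite form is injective, hence
surjective. The form is viewed as a constant family, with an arbitrary point as its centre.\<close>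

lemma posdef_form_represents:
  fixes \<beta> :: "'e::euclidean_space \<Rightarrow> 'e \<Rightarrow> real"
  assumes lin: "\<And>u. linear (\<beta> u)" and sym: "\<And>u v. \<beta> u v = \<beta> v u"
    and pos: "\<And>u. u \<noteq> 0 \<Longrightarrow> 0 < \<beta> u u" and l: "linear l"
  shows "\<exists>u. \<forall>v. \<beta> u v = l v"
proof -
  interpret local_metric "\<lambda>_. \<beta>" 0
    by standard (auto simp: lin sym intro: pos)
  have lf: "linear (flat 0)" using eventually_nhds_x_imp_x[OF eventually_linear_flat] .
  have "inj (flat 0)"
  proof (rule linear_injective_0[OF lf, THEN iffD2], safe)
    fix u assume "flat 0 u = 0"
    then have "\<beta> u u = 0" using flat_inner[where x = 0 and u = u and v = u, OF lin] by simp
    then show "u = 0" using pos[of u] by force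
  qed
  then have "surj (flat 0)" by (rule linear_injective_imp_surjective[OF lf]) (rule refl)
  then obtain u where u: "flat 0 u = (\<Sum>b\<in>Basis. l b *\<^sub>R b)" by (metis surjD)
  have "\<beta> u v = l v" for v
  proof -
    have "\<beta> u v = (\<Sum>b\<in>Basis. l b *\<^sub>R b) \<bullet> v" using flat_inner[where x = 0 and u = u and v = v, OF lin] u by simp
    also have "\<dots> = (\<Sum>b\<in>Basis. (v \<bullet> b) *\<^sub>R l b)"
      by (simp add: inner_sum_left inner_commute[of v] mult.commute)
    also have "\<dots> = l v"
      using l by (subst (2) euclidean_representation[of v, symmetric])
        (simp only: linear_sum linear_scale)
    finally show ?thesis .
  qed
  then show ?thesis by blast
qed

section \<open>Estimates along a retraction in coordinates\<close>

definition euclidean_gradient :: "('e::euclidean_space \<Rightarrow> real) \<Rightarrow> 'e \<Rightarrow> 'e" where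
  "euclidean_gradient f x = (\<Sum>b\<in>Basis. frechet_derivative f (at x) b *\<^sub>R b)"

lemma euclidean_gradient_inner:
  assumes "f differentiable (at x)"
  shows "euclidean_gradient f x \<bullet> v = frechet_derivative f (at x) v"
proof -
  have "linear (frechet_derivative f (at x))" using assms by (rule linear_frechet_derivative)
  then have "frechet_derivative f (at x) v = (\<Sum>b\<in>Basis. (v \<bullet> b) *\<^sub>R frechet_derivative f (at x) b)"
    by (subst euclidean_representation[of v, symmetric]) (simp only: linear_sum linear_scale)
  then show ?thesis
    unfolding euclidean_gradient_def by (simp add: inner_sum_left inner_commute[of v] mult.commute)
qed

lemma euclidean_gradient_lipschitz_near:
  assumes "open X" "z \<in> X" "ck_on 2 X f"
  shows "lipschitz_near (euclidean_gradient f) z"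
proof -
  have "lipschitz_near (\<lambda>x. \<Sum>b\<in>Basis. frechet_derivative f (at x) b *\<^sub>R b) z"
    using assms
    by (intro lipschitz_near_sum lipschitz_near_scaleR lipschitz_near_const
          ck_on_Suc_0_imp_lipschitz_near[of X]) (auto simp: numeral_2_eq_2)
  then show ?thesis by (simp add: euclidean_gradient_def[abs_def])
qed

text \<open>Along \<open>t \<mapsto> \<Phi> (x, t u)\<close> the derivative of \<open>f\<close> is \<open>\<L> (x, t u) u\<close> with an operator \<open>\<L>\<close> that is
Lipschitz near \<open>(x0, 0)\<close>, because \<open>f\<close> and \<open>\<Phi>\<close> are of class \<open>C\<^sup>2\<close>. At \<open>t = 0\<close> the operator is
the derivative of \<open>f\<close> at \<open>x\<close>, as \<open>\<Phi> (x, \<cdot>)\<close> has the identity as its derivative at \<open>0\<close>. By the mean value theorem the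
error is the difference of these two operators, of size \<open>O(norm u)\<close>, applied to \<open>u\<close>.\<close>

lemma second_order_bound_along_retraction:
  fixes f :: "'e::euclidean_space \<Rightarrow> real" and \<Phi> :: "'e \<times> 'e \<Rightarrow> 'e"
  assumes X: "open X" "ck_on 2 X f" and S: "open S" "(x0, 0) \<in> S" "ck_on 2 S \<Phi>" "\<Phi> ` S \<subseteq> X"
    and retr: "\<forall>\<^sub>F x in nhds x0. \<Phi> (x, 0) = x \<and> ((\<lambda>u. \<Phi> (x, u)) has_derivative (\<lambda>u. u)) (at 0)"
  shows "\<exists>K\<ge>0. \<forall>\<^sub>F (x, u) in nhds x0 \<times>\<^sub>F nhds 0.
           \<bar>f (\<Phi> (x, u)) - f x - frechet_derivative f (at x) u\<bar> \<le> K * (norm u)\<^sup>2"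
proof -
  let ?z = "(x0, 0 :: 'e)"
  define D where "D = (\<lambda>z v. frechet_derivative \<Phi> (at z) (0 :: 'e, v :: 'e))"
  define \<L> where "\<L> = (\<lambda>z v. euclidean_gradient f (\<Phi> z) \<bullet> D z v)"
  have \<Phi>': "(\<Phi> has_derivative frechet_derivative \<Phi> (at z)) (at z)" if "z \<in> S" for z
    using S(3) that by (intro ck_on_has_derivative[of "Suc 0" S]) (simp_all add: numeral_2_eq_2)
  have f': "(f has_derivative frechet_derivative f (at y)) (at y)" if "y \<in> X" for y
    using X(2) that by (intro ck_on_has_derivative[of "Suc 0" X]) (simp_all add: numeral_2_eq_2)
  have \<L>_eq: "\<L> z v = frechet_derivative f (at (\<Phi> z)) (D z v)" if "z \<in> S" for z v
    unfolding \<L>_def using f'[of "\<Phi> z"] S(4) that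
    by (intro euclidean_gradient_inner) (auto simp: differentiable_def)
  have "\<forall>\<^sub>F z in nhds ?z. linear (\<L> z)"
    using eventually_nhds_in_open[OF S(1,2)]
  proof eventually_elim
    case (elim z)
    have "linear (frechet_derivative \<Phi> (at z))" using \<Phi>'[OF elim] by (rule has_derivative_linear)
    then have "linear (D z)"
      unfolding D_def
      by (intro linearI) (simp_all flip: linear_add linear_scale)
    then show ?case
      unfolding \<L>_def by (intro linearI) (simp_all add: linear_add linear_scale inner_add_right)
  qed
  moreover have "lipschitz_near (\<lambda>z. \<L> z v) ?z" for v
    unfolding \<L>_def D_def
  proof (intro lipschitz_near_inner lipschitz_near_compose[of \<Phi> _ "euclidean_gradient f"])
    show "lipschitz_near \<Phi> ?z"
      using S ck_on_mono[OF S(3), of "Suc 0"]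
      by (intro ck_on_Suc_0_imp_lipschitz_near[of S]) simp_all
    show "lipschitz_near (euclidean_gradient f) (\<Phi> ?z)"
      using X S by (intro euclidean_gradient_lipschitz_near[of X]) auto
    show "lipschitz_near (\<lambda>z. frechet_derivative \<Phi> (at z) (0, v)) ?z"
      using S(3) by (intro ck_on_Suc_0_imp_lipschitz_near[OF S(1,2)]) (simp add: numeral_2_eq_2)
  qed
  ultimately obtain L where L: "0 \<le> L" "\<forall>\<^sub>F (z, z') in nhds ?z \<times>\<^sub>F nhds ?z.
      \<forall>u. norm (\<L> z u - \<L> z' u) \<le> L * dist z z' * norm u"
    using lipschitz_near_linear_family[of \<L> ?z] by blast
  then obtain P Q where PQ: "eventually P (nhds ?z)" "eventually Q (nhds ?z)"
    "\<And>z z' u. P z \<Longrightarrow> Q z' \<Longrightarrow> norm (\<L> z u - \<L> z' u) \<le> L * dist z z' * norm u"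
    unfolding eventually_prod_filter by auto
  have "\<forall>\<^sub>F z in nhds ?z. P z \<and> Q z \<and> z \<in> S"
    using PQ(1,2) eventually_nhds_in_open[OF S(1,2)] by eventually_elim blast
  then obtain r where r: "0 < r" "\<And>z. dist z ?z < r \<Longrightarrow> P z \<and> Q z \<and> z \<in> S"
    unfolding eventually_nhds_metric by blast
  have evx: "\<forall>\<^sub>F x in nhds x0. dist x x0 < r / 2 \<and> \<Phi> (x, 0) = x \<and>
      ((\<lambda>u. \<Phi> (x, u)) has_derivative (\<lambda>u. u)) (at 0)"
    using retr eventually_nhds_in_open[of "ball x0 (r / 2)" x0] r(1)
    by (auto simp: dist_commute elim: eventually_elim2)
  have evu: "\<forall>\<^sub>F u :: 'e in nhds 0. norm u < r / 2"
    using eventually_nhds_in_open[of "ball 0 (r / 2)" "0 :: 'e"] r(1) by simp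
  \<comment> \<open>Half the radius for each component keeps the whole segment from \<open>(x, 0)\<close> to \<open>(x, u)\<close> in the ball.\<close>
  have bound: "\<bar>f (\<Phi> (x, u)) - f x - frechet_derivative f (at x) u\<bar> \<le> L * (norm u)\<^sup>2"
    if x: "dist x x0 < r / 2" "\<Phi> (x, 0) = x" "((\<lambda>u. \<Phi> (x, u)) has_derivative (\<lambda>u. u)) (at 0)"
      and u: "norm u < r / 2" for x u
  proof -
    have near: "P (x, t *\<^sub>R u) \<and> Q (x, t *\<^sub>R u) \<and> (x, t *\<^sub>R u) \<in> S" if "0 \<le> t" "t \<le> 1" for t
    proof (rule r(2))
      have "norm (t *\<^sub>R u) \<le> norm u" using that by (simp add: mult_left_le_one_le)
      moreover have "dist (x, t *\<^sub>R u) ?z \<le> dist x x0 + norm (t *\<^sub>R u)"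
        using sqrt_sum_squares_le_sum[of "dist x x0" "norm (t *\<^sub>R u)"] by (simp add: dist_Pair_Pair)
      ultimately show "dist (x, t *\<^sub>R u) ?z < r" using x(1) u by linarith
    qed
    let ?q = "\<lambda>t. f (\<Phi> (x, t *\<^sub>R u))"
    have "DERIV ?q t :> \<L> (x, t *\<^sub>R u) u" if t: "0 \<le> t" "t \<le> 1" for t
    proof -
      let ?p = "(x, t *\<^sub>R u)"
      have pS: "?p \<in> S" using near[OF t] by blast
      have 1: "((\<lambda>t. (x, t *\<^sub>R u)) has_derivative (\<lambda>h. (0, h *\<^sub>R u))) (at t)"
        by (auto intro!: derivative_eq_intros)
      have 2: "((\<lambda>t. \<Phi> (x, t *\<^sub>R u)) has_derivative (\<lambda>h. frechet_derivative \<Phi> (at ?p) (0, h *\<^sub>R u))) (at t)"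
        by (rule has_derivative_compose[OF 1 \<Phi>'[OF pS]])
      have "\<Phi> ?p \<in> X" using pS S(4) by blast
      then have 3: "(?q has_derivative
          (\<lambda>h. frechet_derivative f (at (\<Phi> ?p)) (frechet_derivative \<Phi> (at ?p) (0, h *\<^sub>R u)))) (at t)"
        by (intro has_derivative_compose[OF 2] f')
      have lin: "linear (frechet_derivative f (at (\<Phi> ?p)))" "linear (frechet_derivative \<Phi> (at ?p))"
        using f'[OF \<open>\<Phi> ?p \<in> X\<close>] \<Phi>'[OF pS] by (auto dest: has_derivative_linear)
      have "frechet_derivative f (at (\<Phi> ?p)) (frechet_derivative \<Phi> (at ?p) (0, h *\<^sub>R u)) = \<L> ?p u * h" for h
        using linear_scale[OF lin(2), of h "(0, u)"]
        by (simp add: \<L>_eq[OF pS] D_def linear_scale[OF lin(1)])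
      with 3 show ?thesis unfolding has_field_derivative_def by simp
    qed
    then obtain t where t: "0 < t" "t < 1" "?q 1 - ?q 0 = (1 - 0) * \<L> (x, t *\<^sub>R u) u"
      using MVT2[of 0 1 ?q "\<lambda>t. \<L> (x, t *\<^sub>R u) u"] by auto
    have xS: "(x, 0) \<in> S" using near[of 0] by simp
    have "((\<lambda>u. \<Phi> (x, u)) has_derivative D (x, 0)) (at 0)"
    proof -
      have "((\<lambda>u. (x, u)) has_derivative (\<lambda>h. (0, h))) (at (0 :: 'e))"
        by (auto intro!: derivative_eq_intros)
      from has_derivative_compose[OF this \<Phi>'[OF xS]] show ?thesis unfolding D_def .
    qed
    \<comment> \<open>This is where the derivative of the retraction at the zero vector enters.\<close>
    then have "D (x, 0) = (\<lambda>u. u)" using x(3) by (rule has_derivative_unique)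
    then have "\<L> (x, 0) u = frechet_derivative f (at x) u" by (simp add: \<L>_eq[OF xS] x(2))
    moreover have "norm (\<L> (x, t *\<^sub>R u) u - \<L> (x, 0) u) \<le> L * dist (x, t *\<^sub>R u) (x, 0) * norm u"
      using near[of t] near[of 0] t by (intro PQ(3)) auto
    moreover have "L * dist (x, t *\<^sub>R u) (x, 0) * norm u \<le> L * (norm u)\<^sup>2"
    proof -
      have "dist (x, t *\<^sub>R u) (x, 0) \<le> norm u" using t by (simp add: dist_Pair_Pair mult_left_le_one_le)
      then have "L * (dist (x, t *\<^sub>R u) (x, 0) * norm u) \<le> L * (norm u * norm u)"
        using L(1) by (intro mult_left_mono mult_right_mono) auto
      then show ?thesis by (simp add: power2_eq_square mult.assoc)
    qed
    ultimately show ?thesis using t(3) x(2) by simp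
  qed
  have "\<forall>\<^sub>F (x, u) in nhds x0 \<times>\<^sub>F nhds 0.
      \<bar>f (\<Phi> (x, u)) - f x - frechet_derivative f (at x) u\<bar> \<le> L * (norm u)\<^sup>2"
    unfolding eventually_prod_filter
    by (rule exI, rule exI, intro conjI, rule evx, rule evu) (auto intro: bound)
  with L(1) show ?thesis by blast
qed

text \<open>The Lipschitz bound for \<open>h \<circ> \<Phi>\<close> near \<open>(x0, 0)\<close>, read at the pair of points \<open>(x, u)\<close>, \<open>(x, 0)\<close>.\<close>

lemma lipschitz_along_retraction:
  fixes h :: "'e::euclidean_space \<Rightarrow> real" and \<Phi> :: "'e \<times> 'e \<Rightarrow> 'e"
  assumes h: "lipschitz_near h x0" and \<Phi>: "lipschitz_near \<Phi> (x0, 0)"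
    and retr: "\<forall>\<^sub>F x in nhds x0. \<Phi> (x, 0) = x"
  shows "\<exists>K\<ge>0. \<forall>\<^sub>F (x, u) in nhds x0 \<times>\<^sub>F nhds 0. \<bar>h (\<Phi> (x, u)) - h x\<bar> \<le> K * norm u"
proof -
  have "\<Phi> (x0, 0) = x0" using eventually_nhds_x_imp_x[OF retr] .
  then have "lipschitz_near (\<lambda>z. h (\<Phi> z)) (x0, 0)"
    using h by (intro lipschitz_near_compose[OF \<Phi>, of h]) simp
  then obtain L where L: "0 \<le> L" "\<forall>\<^sub>F (z, z') in nhds (x0, 0) \<times>\<^sub>F nhds (x0, 0).
      dist (h (\<Phi> z)) (h (\<Phi> z')) \<le> L * dist z z'"
    by (rule lipschitz_nearE)
  have "filterlim (\<lambda>p. (p, (fst p, 0))) (nhds (x0, 0) \<times>\<^sub>F nhds (x0, 0)) (nhds x0 \<times>\<^sub>F nhds (0::'e))"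
    unfolding nhds_prod by (intro filterlim_Pair filterlim_ident filterlim_fst tendsto_const)
  with L(2) have "\<forall>\<^sub>F p in nhds x0 \<times>\<^sub>F nhds 0.
      dist (h (\<Phi> p)) (h (\<Phi> (fst p, 0))) \<le> L * dist p (fst p, 0)"
    unfolding filterlim_iff by fastforce
  moreover have "\<forall>\<^sub>F (x, u) in nhds x0 \<times>\<^sub>F nhds (0::'e). \<Phi> (x, 0) = x"
    using eventually_prod1[of "nhds (0::'e)" "\<lambda>x. \<Phi> (x, 0) = x" "nhds x0"] retr by simp
  ultimately have "\<forall>\<^sub>F (x, u) in nhds x0 \<times>\<^sub>F nhds 0. \<bar>h (\<Phi> (x, u)) - h x\<bar> \<le> L * norm u"
    by eventually_elim (auto simp: dist_Pair_Pair dist_real_def)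
  with L(1) show ?thesis by blast
qed

section \<open>Charts, tangent spaces and the metric\<close>

locale riemannian_manifold =
  fixes A :: "('m::{t2_space,second_countable_topology}, 'e::euclidean_space) chart set"
    and g :: "('m, 'e) metric"
  assumes manifold: "smooth_manifold A" and metric: "riemannian_metric A g"
begin

lemma chart_homeomorphism:
  assumes "c \<in> A"
  shows "open (fst c)" "open (chart_img c)" "homeomorphism (fst c) (chart_img c) (snd c) (param c)"
  using manifold assms unfolding smooth_manifold_def by blast+

lemma chart_ex: "\<exists>c. c \<in> charts_at A p"
  using manifold unfolding smooth_manifold_def charts_at_def by blast

lemma charts_atD: "c \<in> charts_at A p \<Longrightarrow> c \<in> A" "c \<in> charts_at A p \<Longrightarrow> p \<in> fst c"
  by (simp_all add: charts_at_def)

lemma param_chart: "c \<in> A \<Longrightarrow> p \<in> fst c \<Longrightarrow> param c (snd c p) = p"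
  using chart_homeomorphism(3) unfolding homeomorphism_def by blast

lemma chart_param: "c \<in> A \<Longrightarrow> x \<in> chart_img c \<Longrightarrow> snd c (param c x) = x"
  using chart_homeomorphism(3) unfolding homeomorphism_def by blast

lemma chart_in_img: "p \<in> fst c \<Longrightarrow> snd c p \<in> chart_img c"
  by (simp add: chart_img_def)

lemma param_in: "c \<in> A \<Longrightarrow> x \<in> chart_img c \<Longrightarrow> param c x \<in> fst c"
  using chart_homeomorphism(3) unfolding homeomorphism_def by blast

lemma param_charts_at: "c \<in> A \<Longrightarrow> x \<in> chart_img c \<Longrightarrow> c \<in> charts_at A (param c x)"
  using param_in by (simp add: charts_at_def)

lemma open_chart_overlap:
  assumes "c \<in> A" "d \<in> A" shows "open (snd c ` (fst c \<inter> fst d))"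
proof -
  have "openin (top_of_set (fst c)) (fst c \<inter> fst d)"
    using chart_homeomorphism(1)[OF assms(2)] by (simp add: openin_open_Int)
  then have "openin (top_of_set (chart_img c)) (snd c ` (fst c \<inter> fst d))"
    by (rule homeomorphism_imp_open_map[OF chart_homeomorphism(3)[OF assms(1)]])
  then show ?thesis using chart_homeomorphism(2)[OF assms(1)] by (simp add: openin_open_eq)
qed

lemma tendsto_chart:
  assumes "c \<in> charts_at A p" shows "(snd c \<longlongrightarrow> snd c p) (nhds p)"
proof -
  have "continuous_on (fst c) (snd c)"
    using chart_homeomorphism(3)[OF charts_atD(1)[OF assms]] unfolding homeomorphism_def by blast
  then have "isCont (snd c) p"
    using chart_homeomorphism(1)[OF charts_atD(1)[OF assms]] charts_atD(2)[OF assms]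
    by (simp add: continuous_on_eq_continuous_at)
  then show ?thesis unfolding isCont_def by (rule tendsto_at_iff_tendsto_nhds[THEN iffD1])
qed

abbreviation transition :: "('m, 'e) chart \<Rightarrow> ('m, 'e) chart \<Rightarrow> 'm \<Rightarrow> 'e \<Rightarrow> 'e" where
  "transition c d p \<equiv> frechet_derivative (snd d \<circ> param c) (at (snd c p))"

lemma transition_has_derivative:
  assumes "c \<in> charts_at A p" "d \<in> charts_at A p"
  shows "((snd d \<circ> param c) has_derivative transition c d p) (at (snd c p))"
proof -
  have "smooth_on (snd c ` (fst c \<inter> fst d)) (snd d \<circ> param c)"
    using manifold assms unfolding smooth_manifold_def charts_at_def by blast
  then have "ck_on (Suc 0) (snd c ` (fst c \<inter> fst d)) (snd d \<circ> param c)"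
    unfolding smooth_on_def by blast
  then show ?thesis
    by (rule ck_on_has_derivative) (use assms in \<open>auto simp: charts_at_def\<close>)
qed

lemma linear_transition:
  "c \<in> charts_at A p \<Longrightarrow> d \<in> charts_at A p \<Longrightarrow> linear (transition c d p)"
  using transition_has_derivative by (rule has_derivative_linear)

lemma transition_self:
  assumes c: "c \<in> charts_at A p" shows "transition c c p = (\<lambda>u. u)"
proof -
  note c' = charts_atD[OF c]
  have "((\<lambda>x. x) has_derivative (\<lambda>u. u)) (at (snd c p))" by simp
  then have "((snd c \<circ> param c) has_derivative (\<lambda>u. u)) (at (snd c p))"
    by (rule has_derivative_transform_within_open[OF _ chart_homeomorphism(2)[OF c'(1)]])
      (use c' in \<open>simp_all add: chart_in_img chart_param\<close>)
  from frechet_derivative_at[OF this] show ?thesis by simp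
qed

text \<open>For real-valued \<open>h\<close> this makes differentials independent of the chart; for \<open>h\<close> the coordinate map of a
third chart it is the cocycle rule for transition maps.\<close>

lemma chain_rule_charts:
  fixes h :: "'m \<Rightarrow> 'b::real_normed_vector"
  assumes c: "c \<in> charts_at A p" and d: "d \<in> charts_at A p"
    and h: "(h \<circ> param d) differentiable (at (snd d p))"
  shows "frechet_derivative (h \<circ> param c) (at (snd c p)) u =
         frechet_derivative (h \<circ> param d) (at (snd d p)) (transition c d p u)"
proof -
  note c' = charts_atD[OF c] and d' = charts_atD[OF d]
  let ?D = "frechet_derivative (h \<circ> param d) (at (snd d p))"
  have "((h \<circ> param d) has_derivative ?D) (at (snd d p))"
    using h by (simp add: frechet_derivative_works)
  then have "((h \<circ> param d) has_derivative ?D) (at ((snd d \<circ> param c) (snd c p)))"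
    using c' by (simp add: param_chart)
  from has_derivative_compose[OF transition_has_derivative[OF c d] this]
  have "((\<lambda>x. (h \<circ> param d) ((snd d \<circ> param c) x)) has_derivative (\<lambda>u. ?D (transition c d p u)))
    (at (snd c p))" .
  then have "((h \<circ> param c) has_derivative (\<lambda>u. ?D (transition c d p u))) (at (snd c p))"
    by (rule has_derivative_transform_within_open[OF _ open_chart_overlap[OF c'(1) d'(1)]])
      (use c' d' in \<open>auto simp: param_chart\<close>)
  from frechet_derivative_at[OF this] show ?thesis by metis
qed

lemma tangent_spaceI:
  assumes "\<And>c d. c \<in> charts_at A p \<Longrightarrow> d \<in> charts_at A p \<Longrightarrow> v d = transition c d p (v c)"
    and "\<And>c. c \<notin> charts_at A p \<Longrightarrow> v c = 0"
  shows "v \<in> tangent_space A p"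
  unfolding tangent_space_def using assms by blast

lemma tangent_spaceD:
  assumes "v \<in> tangent_space A p"
  shows "c \<in> charts_at A p \<Longrightarrow> d \<in> charts_at A p \<Longrightarrow> transition c d p (v c) = v d"
    and "c \<notin> charts_at A p \<Longrightarrow> v c = 0"
  using assms unfolding tangent_space_def by (blast intro: sym)+

text \<open>By the cocycle rule, the coordinates in all charts that are computed from one chart are compatible
with each other.\<close>

lemma tvec_of_in:
  assumes c: "c \<in> charts_at A p" shows "tvec_of A c p u \<in> tangent_space A p"
proof (rule tangent_spaceI)
  fix d d' assume d: "d \<in> charts_at A p" "d' \<in> charts_at A p"
  have "(snd d' \<circ> param d) differentiable (at (snd d p))"
    using transition_has_derivative[OF d] unfolding differentiable_def by blast
  then show "tvec_of A c p u d' = transition d d' p (tvec_of A c p u d)"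
    using d by (simp add: tvec_of_def chain_rule_charts[OF c, of d])
qed (simp add: tvec_of_def)

lemma tvec_of_apply: "c \<in> charts_at A p \<Longrightarrow> tvec_of A c p u c = u"
  by (simp add: tvec_of_def transition_self)

lemma tvec_of_coord:
  assumes "c \<in> charts_at A p" "v \<in> tangent_space A p" shows "tvec_of A c p (v c) = v"
  using tangent_spaceD[OF assms(2)] assms(1) by (intro ext) (simp add: tvec_of_def)

lemma tvec_of_add: "c \<in> charts_at A p \<Longrightarrow> tvec_of A c p (u + v) = tvec_of A c p u + tvec_of A c p v"
  by (rule ext) (simp add: tvec_of_def linear_add[OF linear_transition])

lemma tvec_of_scaleR: "c \<in> charts_at A p \<Longrightarrow> tvec_of A c p (r *\<^sub>R u) = r *\<^sub>R tvec_of A c p u"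
  by (rule ext) (simp add: tvec_of_def scaleR_fun_def linear_scale[OF linear_transition])

lemma tvec_of_0: "c \<in> charts_at A p \<Longrightarrow> tvec_of A c p 0 = 0"
  using tvec_of_scaleR[of c p 0 0] by simp

lemma subspace_tangent_space: "subspace (tangent_space A p)"
proof (rule subspaceI)
  fix u v and r :: real
  assume u: "u \<in> tangent_space A p"
  show "r *\<^sub>R u \<in> tangent_space A p"
    by (rule tangent_spaceI)
      (simp_all add: scaleR_fun_def linear_scale[OF linear_transition] tangent_spaceD[OF u])
  assume v: "v \<in> tangent_space A p"
  show "u + v \<in> tangent_space A p"
    by (rule tangent_spaceI)
      (simp_all add: linear_add[OF linear_transition] tangent_spaceD[OF u] tangent_spaceD[OF v])
next
  show "0 \<in> tangent_space A p"
    by (rule tangent_spaceI) (simp_all add: zero_fun_def linear_0[OF linear_transition])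
qed

lemmas tangent_space_add = subspace_add[OF subspace_tangent_space]
lemmas tangent_space_diff = subspace_diff[OF subspace_tangent_space]
lemmas tangent_space_scale = subspace_scale[OF subspace_tangent_space]
lemmas tangent_space_sum = subspace_sum[OF subspace_tangent_space]
lemmas tangent_space_0 = subspace_0[OF subspace_tangent_space]
lemmas tangent_space_neg = subspace_neg[OF subspace_tangent_space]

lemma
  assumes "u \<in> tangent_space A p" "v \<in> tangent_space A p"
  shows metric_sym: "g p u v = g p v u"
    and metric_scale_left: "g p (r *\<^sub>R u) v = r * g p u v"
  using conjunct1[OF metric[unfolded riemannian_metric_def], rule_format, OF assms assms(2), of r]
  by simp_all

lemma metric_pos:
  assumes "u \<in> tangent_space A p" "u \<noteq> 0" shows "0 < g p u u"
  using conjunct1[OF metric[unfolded riemannian_metric_def], rule_format, OF assms(1,1,1)] assms(2)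
  by simp

lemma metric_add_left:
  assumes "u \<in> tangent_space A p" "v \<in> tangent_space A p" "w \<in> tangent_space A p"
  shows "g p (u + v) w = g p u w + g p v w"
  using conjunct1[OF metric[unfolded riemannian_metric_def], rule_format, OF assms] by simp

lemma metric_scale_right:
  assumes "u \<in> tangent_space A p" "v \<in> tangent_space A p"
  shows "g p u (r *\<^sub>R v) = r * g p u v"
  unfolding metric_sym[OF assms(1) tangent_space_scale[OF assms(2)]] metric_sym[OF assms]
  by (rule metric_scale_left[OF assms(2,1)])

lemma metric_add_right:
  assumes "u \<in> tangent_space A p" "v \<in> tangent_space A p" "w \<in> tangent_space A p"
  shows "g p w (u + v) = g p w u + g p w v"
  unfolding metric_sym[OF assms(3) tangent_space_add[OF assms(1,2)]]
    metric_sym[OF assms(3,1)] metric_sym[OF assms(3,2)]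
  by (rule metric_add_left[OF assms])

lemma metric_minus_right:
  assumes "u \<in> tangent_space A p" "v \<in> tangent_space A p"
  shows "g p u (- v) = - g p u v"
  using metric_scale_right[OF assms, of "- 1"] by simp

lemma metric_diff_right:
  assumes "u \<in> tangent_space A p" "v \<in> tangent_space A p" "w \<in> tangent_space A p"
  shows "g p w (u - v) = g p w u - g p w v"
  using assms metric_add_right[of u p "- v" w] metric_minus_right[of w p v]
  by (simp add: tangent_space_neg)

lemma metric_zero_right: "u \<in> tangent_space A p \<Longrightarrow> g p u 0 = 0"
  using metric_scale_right[of u p 0 0] by (simp add: tangent_space_0)

lemma metric_nonneg: "u \<in> tangent_space A p \<Longrightarrow> 0 \<le> g p u u"
  using metric_pos[of u p] metric_zero_right[of u p] by (cases "u = 0") auto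

lemma metric_sum_right:
  assumes "w \<in> tangent_space A p" "\<And>i. i \<in> S \<Longrightarrow> u i \<in> tangent_space A p"
  shows "g p w (\<Sum>i\<in>S. u i) = (\<Sum>i\<in>S. g p w (u i))"
  using assms
  by (induction S rule: infinite_finite_induct)
    (simp_all add: metric_zero_right metric_add_right tangent_space_sum)

lemma rnorm_sq: "u \<in> tangent_space A p \<Longrightarrow> (rnorm g p u)\<^sup>2 = g p u u"
  by (simp add: rnorm_def metric_nonneg)

lemma rnorm_nonneg: "u \<in> tangent_space A p \<Longrightarrow> 0 \<le> rnorm g p u"
  by (simp add: rnorm_def metric_nonneg)

text \<open>Nonnegativity of the metric at \<open>\<parallel>v\<parallel> u - \<parallel>u\<parallel> v\<close> reads
\<open>0 \<le> 2 \<parallel>u\<parallel> \<parallel>v\<parallel> (\<parallel>u\<parallel> \<parallel>v\<parallel> - \<langle>u, v\<rangle>)\<close>.\<close>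

lemma metric_Cauchy_Schwarz:
  assumes u: "u \<in> tangent_space A p" and v: "v \<in> tangent_space A p"
  shows "g p u v \<le> rnorm g p u * rnorm g p v"
proof -
  let ?a = "rnorm g p u" and ?b = "rnorm g p v"
  let ?w = "?b *\<^sub>R u - ?a *\<^sub>R v"
  have au: "?b *\<^sub>R u \<in> tangent_space A p" "?a *\<^sub>R v \<in> tangent_space A p"
    using u v by (simp_all add: tangent_space_scale)
  have "0 \<le> g p ?w ?w" using au by (intro metric_nonneg tangent_space_diff)
  also have "\<dots> = g p ?w (?b *\<^sub>R u) - g p ?w (?a *\<^sub>R v)"
    using au by (intro metric_diff_right tangent_space_diff)
  also have "\<dots> = g p (?b *\<^sub>R u) ?w - g p (?a *\<^sub>R v) ?w"
    using au by (simp add: metric_sym[of ?w] tangent_space_diff)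
  also have "\<dots> = ?b * (?b * g p u u) - ?b * (?a * g p u v) - (?a * (?b * g p u v) - ?a * (?a * g p v v))"
    using u v au
    by (simp add: metric_diff_right metric_scale_left metric_scale_right metric_sym[of v p u])
  also have "\<dots> = 2 * (?a * ?b) * (?a * ?b - g p u v)"
    unfolding rnorm_sq[OF u, symmetric] rnorm_sq[OF v, symmetric]
    by (simp add: power2_eq_square algebra_simps)
  finally have *: "0 \<le> (?a * ?b) * (?a * ?b - g p u v)" by (simp add: mult_ac)
  show ?thesis
  proof (cases "?a * ?b = 0")
    case True
    then have "u = 0 \<or> v = 0"
      using metric_pos[OF u] metric_pos[OF v] rnorm_sq[OF u] rnorm_sq[OF v] by auto
    then have "g p u v = 0"
      using metric_zero_right[OF u] metric_zero_right[OF v] metric_sym[OF u v] by auto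
    then show ?thesis unfolding True by simp
  next
    case False
    then have "0 < ?a * ?b" using u v by (simp add: rnorm_nonneg order.strict_iff_order)
    with * show ?thesis by (simp add: zero_le_mult_iff)
  qed
qed

lemma rnorm_triangle:
  assumes u: "u \<in> tangent_space A p" and v: "v \<in> tangent_space A p"
  shows "rnorm g p (u + v) \<le> rnorm g p u + rnorm g p v"
proof (rule power2_le_imp_le)
  have "(rnorm g p (u + v))\<^sup>2 = g p u u + 2 * g p u v + g p v v"
    using u v
    by (simp add: rnorm_sq tangent_space_add metric_add_left metric_add_right metric_sym[of v p u])
  also have "\<dots> \<le> (rnorm g p u + rnorm g p v)\<^sup>2"
    using metric_Cauchy_Schwarz[OF u v] by (simp add: power2_sum rnorm_sq u v)
  finally show "(rnorm g p (u + v))\<^sup>2 \<le> (rnorm g p u + rnorm g p v)\<^sup>2" .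
qed (simp add: rnorm_nonneg u v)

lemma rnorm_scale: "u \<in> tangent_space A p \<Longrightarrow> rnorm g p (r *\<^sub>R u) = \<bar>r\<bar> * rnorm g p u"
  by (simp add: rnorm_def metric_scale_left metric_scale_right tangent_space_scale
      real_sqrt_mult flip: mult.assoc)

lemma rnorm_minus: "u \<in> tangent_space A p \<Longrightarrow> rnorm g p (- u) = rnorm g p u"
  using rnorm_scale[of u p "- 1"] by simp

lemma rnorm_diff:
  assumes "u \<in> tangent_space A p" "v \<in> tangent_space A p"
  shows "rnorm g p (u - v) \<le> rnorm g p u + rnorm g p v"
  using rnorm_triangle[of u p "- v"] assms by (simp add: tangent_space_neg rnorm_minus)

lemma rnorm_0: "rnorm g p 0 = 0"
  unfolding rnorm_def metric_zero_right[OF tangent_space_0] by (rule real_sqrt_zero)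

lemma rnorm_sum_le:
  assumes "\<And>i. i \<in> S \<Longrightarrow> u i \<in> tangent_space A p" "\<And>i. i \<in> S \<Longrightarrow> rnorm g p (u i) \<le> C"
  shows "rnorm g p (\<Sum>i\<in>S. u i) \<le> real (card S) * C"
  using assms
proof (induction S rule: infinite_finite_induct)
  case (insert i S)
  have ui: "u i \<in> tangent_space A p" by (rule insert.prems(1)) (rule insertI1)
  have uj: "u j \<in> tangent_space A p" if "j \<in> S" for j
    by (rule insert.prems(1)) (rule insertI2[OF that])
  have "sum u S \<in> tangent_space A p"
    using uj by (rule tangent_space_sum)
  with ui have "rnorm g p (u i + sum u S) \<le> rnorm g p (u i) + rnorm g p (sum u S)"
    by (rule rnorm_triangle)
  also have "rnorm g p (u i) \<le> C" by (rule insert.prems(2)) (rule insertI1)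
  also have "rnorm g p (sum u S) \<le> real (card S) * C"
    by (rule insert.IH[OF uj insert.prems(2)[OF insertI2]])
  finally have "rnorm g p (u i + sum u S) \<le> C + real (card S) * C" by simp
  then show ?case
    unfolding sum.insert[OF insert.hyps] card_insert_disjoint[OF insert.hyps] of_nat_Suc
      distrib_right mult_1_left .
next
  case (infinite S)
  show ?case unfolding sum.infinite[OF infinite.hyps] card.infinite[OF infinite.hyps] rnorm_0 by simp
next
  case empty
  show ?case unfolding sum.empty card.empty rnorm_0 by simp
qed

section \<open>Riemannian gradients\<close>

abbreviation coord_metric :: "('m, 'e) chart \<Rightarrow> 'e \<Rightarrow> 'e \<Rightarrow> 'e \<Rightarrow> real" where
  "coord_metric c x u v \<equiv>
     g (param c x) (tvec_of A c (param c x) u) (tvec_of A c (param c x) v)"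

lemma linear_metric_tvec_of:
  assumes c: "c \<in> charts_at A p" and v: "v \<in> tangent_space A p"
  shows "linear (\<lambda>u. g p v (tvec_of A c p u))"
  using c v
  by (intro linearI)
    (simp_all add: tvec_of_add tvec_of_scaleR metric_add_right metric_scale_right tvec_of_in)

lemma tvec_of_neq_0: "c \<in> charts_at A p \<Longrightarrow> u \<noteq> 0 \<Longrightarrow> tvec_of A c p u \<noteq> 0"
  using tvec_of_apply[of c p u] by (auto simp: zero_fun_def)

lemma eventually_in_chart:
  assumes "c \<in> charts_at A p" shows "\<forall>\<^sub>F x in nhds (snd c p). x \<in> chart_img c"
  using chart_homeomorphism(2)[OF charts_atD(1)[OF assms]] charts_atD(2)[OF assms]
  by (intro eventually_nhds_in_open chart_in_img)

text \<open>Smoothness of the metric coefficients enters only through this: they are Lipschitz near every point.\<close>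

lemma local_metric_coord:
  assumes c: "c \<in> charts_at A p" shows "local_metric (coord_metric c) (snd c p)"
proof
  note c' = charts_atD[OF c]
  note ev = eventually_in_chart[OF c]
  show "\<forall>\<^sub>F x in nhds (snd c p). \<forall>u. linear (coord_metric c x u)"
    using ev by (rule eventually_mono)
      (intro allI linear_metric_tvec_of tvec_of_in param_charts_at c'(1), assumption+)
  show "\<forall>\<^sub>F x in nhds (snd c p). \<forall>u v. coord_metric c x u v = coord_metric c x v u"
    using ev by (rule eventually_mono)
      (intro allI metric_sym tvec_of_in param_charts_at c'(1), assumption+)
  show "u \<noteq> 0 \<Longrightarrow> 0 < coord_metric c (snd c p) u u" for u
    using c c' by (simp add: param_chart metric_pos tvec_of_in tvec_of_neq_0)
  show "lipschitz_near (\<lambda>x. coord_metric c x u v) (snd c p)" for u v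
  proof (rule ck_on_Suc_0_imp_lipschitz_near[OF chart_homeomorphism(2)[OF c'(1)]])
    show "ck_on (Suc 0) (chart_img c) (\<lambda>x. coord_metric c x u v)"
      using metric c'(1) unfolding riemannian_metric_def smooth_on_def by blast
  qed (use c'(2) in \<open>rule chart_in_img\<close>)
qed

lemma mfd_ck_chart: "mfd_ck k A f \<Longrightarrow> c \<in> A \<Longrightarrow> ck_on k (chart_img c) (f \<circ> param c)"
  by (simp add: mfd_ck_def)

lemma mfd_ck_has_derivative:
  assumes "mfd_ck (Suc k) A f" "c \<in> charts_at A p"
  shows "((f \<circ> param c) has_derivative frechet_derivative (f \<circ> param c) (at (snd c p)))
           (at (snd c p))"
  using mfd_ck_chart[OF assms(1) charts_atD(1)[OF assms(2)]] chart_in_img[OF charts_atD(2)[OF assms(2)]]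
  by (rule ck_on_has_derivative)

text \<open>It is enough to test the defining equation of the gradient in a single chart, since differentials do
not depend on the chart; definiteness of the metric makes the solution unique.\<close>

lemma grad_eqI:
  assumes f: "mfd_ck (Suc k) A f" and c: "c \<in> charts_at A p" and v: "v \<in> tangent_space A p"
    and repr: "\<And>w. w \<in> tangent_space A p \<Longrightarrow>
      g p v w = frechet_derivative (f \<circ> param c) (at (snd c p)) (w c)"
  shows "grad A g f p = v"
  unfolding grad_def
proof (rule the_equality, intro conjI v ballI)
  fix w d assume w: "w \<in> tangent_space A p" and d: "d \<in> charts_at A p"
  have "(f \<circ> param c) differentiable (at (snd c p))"
    using mfd_ck_has_derivative[OF f c] by (auto simp: differentiable_def)
  then have "frechet_derivative (f \<circ> param d) (at (snd d p)) (w d) =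
      frechet_derivative (f \<circ> param c) (at (snd c p)) (transition d c p (w d))"
    by (rule chain_rule_charts[OF d c])
  also have "transition d c p (w d) = w c" using tangent_spaceD(1)[OF w d c] .
  finally show "g p v w = frechet_derivative (f \<circ> param d) (at (snd d p)) (w d)"
    by (rule trans[OF repr[OF w] sym])
next
  fix v' assume v': "v' \<in> tangent_space A p \<and> (\<forall>w\<in>tangent_space A p. \<forall>c\<in>charts_at A p.
    g p v' w = frechet_derivative (f \<circ> param c) (at (snd c p)) (w c))"
  define w where "w = v' - v"
  have w: "w \<in> tangent_space A p" unfolding w_def using v v' by (intro tangent_space_diff) auto
  have "g p v' w = g p v w" using bspec[OF bspec[OF conjunct2[OF v'] w] c] repr[OF w] by simp
  then have "g p w w = 0"
    unfolding metric_diff_right[OF conjunct1[OF v'] v w, folded w_def]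
      metric_sym[OF w conjunct1[OF v']] metric_sym[OF w v] by simp
  then have "w = 0" using metric_pos[OF w] by (metis less_irrefl)
  then show "v' = v" by (simp add: w_def)
qed

text \<open>Existence of the gradient: represent the differential, written in one chart, by the coordinate
metric.\<close>

lemma
  assumes f: "mfd_ck (Suc k) A f"
  shows grad_in: "grad A g f p \<in> tangent_space A p"
    and grad_inner: "c \<in> charts_at A p \<Longrightarrow> w \<in> tangent_space A p \<Longrightarrow>
      g p (grad A g f p) w = frechet_derivative (f \<circ> param c) (at (snd c p)) (w c)"
proof -
  have *: "\<exists>v\<in>tangent_space A p. grad A g f p = v \<and> (\<forall>w\<in>tangent_space A p.
      g p v w = frechet_derivative (f \<circ> param c) (at (snd c p)) (w c))"
    if c: "c \<in> charts_at A p" for c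
  proof -
    let ?\<beta> = "\<lambda>u v. g p (tvec_of A c p u) (tvec_of A c p v)"
    have "\<exists>u. \<forall>v. ?\<beta> u v = frechet_derivative (f \<circ> param c) (at (snd c p)) v"
    proof (rule posdef_form_represents)
      show "linear (?\<beta> u)" for u by (intro linear_metric_tvec_of c tvec_of_in)
      show "?\<beta> u v = ?\<beta> v u" for u v by (intro metric_sym tvec_of_in c)
      show "u \<noteq> 0 \<Longrightarrow> 0 < ?\<beta> u u" for u by (intro metric_pos tvec_of_in c tvec_of_neq_0)
      show "linear (frechet_derivative (f \<circ> param c) (at (snd c p)))"
        using mfd_ck_has_derivative[OF f c] by (rule has_derivative_linear)
    qed
    then obtain u where u: "\<And>v. ?\<beta> u v = frechet_derivative (f \<circ> param c) (at (snd c p)) v"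
      by blast
    have repr: "g p (tvec_of A c p u) w = frechet_derivative (f \<circ> param c) (at (snd c p)) (w c)"
      if "w \<in> tangent_space A p" for w
      using u[of "w c"] tvec_of_coord[OF c that] by simp
    have "grad A g f p = tvec_of A c p u"
      by (rule grad_eqI[OF f c tvec_of_in[OF c] repr])
    then show ?thesis using tvec_of_in[OF c] repr by blast
  qed
  obtain c0 where "c0 \<in> charts_at A p" using chart_ex by blast
  from *[OF this] show "grad A g f p \<in> tangent_space A p" by blast
  show "g p (grad A g f p) w = frechet_derivative (f \<circ> param c) (at (snd c p)) (w c)"
    if "c \<in> charts_at A p" "w \<in> tangent_space A p"
    using *[OF that(1)] that(2) by blast
qed

lemma grad_avg_fun:
  assumes f: "mfd_ck (Suc k) A (avg_fun n F)" and F: "\<And>i. i \<in> {1..n} \<Longrightarrow> mfd_ck (Suc j) A (F i)"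
  shows "grad A g (avg_fun n F) p = (1 / real n) *\<^sub>R (\<Sum>i=1..n. grad A g (F i) p)"
proof -
  obtain c where c: "c \<in> charts_at A p" using chart_ex by blast
  let ?v = "\<Sum>i=1..n. grad A g (F i) p"
  have gr: "grad A g (F i) p \<in> tangent_space A p" if "i \<in> {1..n}" for i
    using F[OF that] by (rule grad_in)
  have v: "?v \<in> tangent_space A p" using gr by (rule tangent_space_sum)
  have "avg_fun n F \<circ> param c = (\<lambda>x. (1 / real n) * (\<Sum>i=1..n. (F i \<circ> param c) x))"
    by (simp add: avg_fun_def fun_eq_iff)
  moreover have "((\<lambda>x. (1 / real n) * (\<Sum>i=1..n. (F i \<circ> param c) x)) has_derivative
     (\<lambda>u. (1 / real n) * (\<Sum>i=1..n. frechet_derivative (F i \<circ> param c) (at (snd c p)) u))) (at (snd c p))"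
    using mfd_ck_has_derivative[OF F c] by (intro has_derivative_mult_right has_derivative_sum)
  ultimately have D: "frechet_derivative (avg_fun n F \<circ> param c) (at (snd c p)) =
     (\<lambda>u. (1 / real n) * (\<Sum>i=1..n. frechet_derivative (F i \<circ> param c) (at (snd c p)) u))"
    by (simp add: frechet_derivative_at[symmetric])
  show ?thesis
  proof (rule grad_eqI[OF f c])
    show "(1 / real n) *\<^sub>R ?v \<in> tangent_space A p" using v by (rule tangent_space_scale)
    fix w assume w: "w \<in> tangent_space A p"
    have "g p ((1 / real n) *\<^sub>R ?v) w = (1 / real n) * g p w ?v"
      using v w by (simp add: metric_scale_left metric_sym[of w])
    also have "g p w ?v = (\<Sum>i=1..n. g p w (grad A g (F i) p))"
      by (rule metric_sum_right[OF w gr])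
    also have "\<dots> = (\<Sum>i=1..n. g p (grad A g (F i) p) w)"
      by (intro sum.cong refl metric_sym w gr)
    also have "\<dots> = (\<Sum>i=1..n. frechet_derivative (F i \<circ> param c) (at (snd c p)) (w c))"
      using F w c by (intro sum.cong refl grad_inner)
    finally show "g p ((1 / real n) *\<^sub>R ?v) w =
        frechet_derivative (avg_fun n F \<circ> param c) (at (snd c p)) (w c)"
      by (simp add: D)
  qed
qed

end

section \<open>Estimates along the retraction, uniform on compact sets\<close>

text \<open>In the applications one parameter \<open>C\<close> serves as bound, as Lipschitz constant and, through \<open>1 / C\<close>, as radius
of validity, so passing to the largest value over a finite cover adjusts all of them at once.\<close>

lemma uniform_on_compact:
  fixes P :: "real \<Rightarrow> 'm::topological_space \<Rightarrow> bool"
  assumes K: "compact K" and mono: "\<And>C D q. P C q \<Longrightarrow> C \<le> D \<Longrightarrow> P D q"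
    and loc: "\<And>p. p \<in> K \<Longrightarrow> \<exists>C. \<forall>\<^sub>F q in nhds p. P C q"
  shows "\<exists>C. \<forall>q\<in>K. P C q"
proof -
  have "\<forall>p\<in>K. \<exists>CU. open (snd CU) \<and> p \<in> snd CU \<and> (\<forall>q\<in>snd CU. P (fst CU) q)"
  proof
    fix p assume "p \<in> K"
    then obtain C U where "open U" "p \<in> U" "\<forall>q\<in>U. P C q"
      using loc unfolding eventually_nhds by blast
    then show "\<exists>CU. open (snd CU) \<and> p \<in> snd CU \<and> (\<forall>q\<in>snd CU. P (fst CU) q)"
      by (intro exI[of _ "(C, U)"]) simp
  qed
  from bchoice[OF this] obtain CU where CU: "\<And>p. p \<in> K \<Longrightarrow> open (snd (CU p))"
    "\<And>p. p \<in> K \<Longrightarrow> p \<in> snd (CU p)" "\<And>p q. p \<in> K \<Longrightarrow> q \<in> snd (CU p) \<Longrightarrow> P (fst (CU p)) q"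
    by blast
  obtain F where F: "F \<subseteq> K" "finite F" "K \<subseteq> (\<Union>p\<in>F. snd (CU p))"
    using compactE_image[OF K, of K "\<lambda>p. snd (CU p)"] CU(1,2) by blast
  have "P (\<Sum>p\<in>F. \<bar>fst (CU p)\<bar>) q" if q: "q \<in> K" for q
  proof -
    obtain p where p: "p \<in> F" "q \<in> snd (CU p)" using F(3) q by blast
    have "\<bar>fst (CU p)\<bar> \<le> (\<Sum>p\<in>F. \<bar>fst (CU p)\<bar>)" using F(2) p(1) by (intro member_le_sum) auto
    then have "fst (CU p) \<le> (\<Sum>p\<in>F. \<bar>fst (CU p)\<bar>)" by linarith
    with CU(3)[OF subsetD[OF F(1) p(1)] p(2)] show ?thesis by (rule mono)
  qed
  then show ?thesis by blast
qed

context riemannian_manifold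
begin

abbreviation grad_sq :: "('m \<Rightarrow> real) \<Rightarrow> 'm \<Rightarrow> real" where
  "grad_sq f p \<equiv> (rnorm g p (grad A g f p))\<^sup>2"

text \<open>In the chart, the coordinates \<open>s x\<close> of the gradient solve \<open>\<gamma> x (s x) v = r x \<bullet> v\<close> with \<open>r\<close> the Euclidean gradient
of the coordinate expression of \<open>f\<close>. Both \<open>r\<close> and \<open>s\<close> are Lipschitz near the point, and the squared
norm of the gradient is \<open>r x \<bullet> s x\<close>.\<close>

lemma grad_sq_lipschitz_near:
  assumes f: "mfd_ck 2 A f" and c: "c \<in> charts_at A p"
  shows "lipschitz_near (\<lambda>x. grad_sq f (param c x)) (snd c p)"
proof -
  note c' = charts_atD[OF c]
  interpret local_metric "coord_metric c" "snd c p" by (rule local_metric_coord[OF c])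
  define s where "s = (\<lambda>x. grad A g f (param c x) c)"
  define r where "r = euclidean_gradient (f \<circ> param c)"
  have f1: "mfd_ck (Suc (Suc 0)) A f" using f by (simp add: numeral_2_eq_2)
  have r: "lipschitz_near r (snd c p)"
    unfolding r_def
    by (rule euclidean_gradient_lipschitz_near[OF chart_homeomorphism(2)[OF c'(1)]])
      (use c' f in \<open>simp_all add: chart_in_img mfd_ck_chart\<close>)
  have pair: "g (param c x) (grad A g f (param c x)) w = r x \<bullet> w c"
    if x: "x \<in> chart_img c" and w: "w \<in> tangent_space A (param c x)" for x w
  proof -
    note cx = param_charts_at[OF c'(1) x]
    have "g (param c x) (grad A g f (param c x)) w =
        frechet_derivative (f \<circ> param c) (at (snd c (param c x))) (w c)"
      by (rule grad_inner[OF f1 cx w])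
    also have "\<dots> = r x \<bullet> w c"
      unfolding r_def chart_param[OF c'(1) x]
      by (rule euclidean_gradient_inner[symmetric])
        (rule ck_on_differentiable[OF mfd_ck_chart[OF f1 c'(1)] x])
    finally show ?thesis .
  qed
  have s_eq: "tvec_of A c (param c x) (s x) = grad A g f (param c x)" if "x \<in> chart_img c" for x
    unfolding s_def by (rule tvec_of_coord[OF param_charts_at[OF c'(1) that] grad_in[OF f1]])
  have "\<forall>\<^sub>F x in nhds (snd c p). \<forall>v. coord_metric c x (s x) v = r x \<bullet> v"
    using eventually_in_chart[OF c]
  proof eventually_elim
    case (elim x)
    show ?case
    proof
      fix v
      note cx = param_charts_at[OF c'(1) elim]
      show "coord_metric c x (s x) v = r x \<bullet> v"
        unfolding s_eq[OF elim] pair[OF elim tvec_of_in[OF cx]] tvec_of_apply[OF cx] ..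
    qed
  qed
  with r have "lipschitz_near s (snd c p)" by (rule solution_lipschitz)
  with r have rs: "lipschitz_near (\<lambda>x. r x \<bullet> s x) (snd c p)" by (rule lipschitz_near_inner)
  have "\<forall>\<^sub>F x in nhds (snd c p). r x \<bullet> s x = grad_sq f (param c x)"
    using eventually_in_chart[OF c]
  proof eventually_elim
    case (elim x)
    show ?case
      unfolding rnorm_sq[OF grad_in[OF f1]] pair[OF elim grad_in[OF f1]] s_def ..
  qed
  from this rs show ?thesis by (rule lipschitz_near_cong)
qed

lemma eventually_chart:
  assumes c: "c \<in> charts_at A p" and ev: "\<forall>\<^sub>F x in nhds (snd c p). P x"
  shows "\<forall>\<^sub>F q in nhds p. c \<in> charts_at A q \<and> P (snd c q)"
proof -
  have "\<forall>\<^sub>F q in nhds p. q \<in> fst c"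
    using chart_homeomorphism(1)[OF charts_atD(1)[OF c]] charts_atD(2)[OF c]
    by (rule eventually_nhds_in_open)
  moreover have "\<forall>\<^sub>F q in nhds p. P (snd c q)"
    using tendsto_chart[OF c] ev unfolding filterlim_iff by blast
  ultimately show ?thesis
    by eventually_elim (simp add: charts_at_def charts_atD(1)[OF c])
qed

lemma grad_bounded_on_compact:
  assumes f: "mfd_ck 2 A f" and K: "compact K"
  shows "\<exists>C. \<forall>p\<in>K. rnorm g p (grad A g f p) \<le> C"
proof -
  have "\<exists>C. \<forall>p\<in>K. grad_sq f p \<le> C"
  proof (rule uniform_on_compact[OF K])
    fix p assume "p \<in> K"
    obtain c where c: "c \<in> charts_at A p" using chart_ex by blast
    let ?C = "norm (grad_sq f (param c (snd c p))) + 1"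
    have "\<forall>\<^sub>F x in nhds (snd c p). norm (grad_sq f (param c x)) \<le> ?C"
      by (rule lipschitz_near_imp_bounded[OF grad_sq_lipschitz_near[OF f c]])
    from eventually_chart[OF c this] have "\<forall>\<^sub>F q in nhds p. grad_sq f q \<le> ?C"
      by (rule eventually_mono) (auto simp: charts_at_def param_chart)
    then show "\<exists>C. \<forall>\<^sub>F q in nhds p. grad_sq f q \<le> C" ..
  qed simp
  then obtain C where "\<And>p. p \<in> K \<Longrightarrow> grad_sq f p \<le> C" by blast
  then have "\<forall>p\<in>K. rnorm g p (grad A g f p) \<le> sqrt C" using real_le_rsqrt by blast
  then show ?thesis ..
qed

text \<open>In one chart around \<open>p0\<close> the retraction is a map \<open>\<Phi> (x, u)\<close> near \<open>(x0, 0)\<close>, to which the two coordinate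
estimates apply. Coercivity of the coordinate metric translates between the Euclidean norm of \<open>u\<close> and
the Riemannian norm of the tangent vector.\<close>

lemma retraction_bounds_near:
  assumes f: "mfd_ck 2 A f" and R: "smooth_retraction A R"
  shows "\<exists>C. 0 < C \<and> (\<forall>\<^sub>F p in nhds p0. \<forall>\<eta>\<in>tangent_space A p. rnorm g p \<eta> < 1 / C \<longrightarrow>
      f (R p \<eta>) \<le> f p + g p (grad A g f p) \<eta> + C * (rnorm g p \<eta>)\<^sup>2 \<and>
      \<bar>grad_sq f (R p \<eta>) - grad_sq f p\<bar> \<le> C * rnorm g p \<eta>)"
proof -
  obtain c where c: "c \<in> charts_at A p0" using chart_ex by blast
  note c' = charts_atD[OF c]
  define x0 where "x0 = snd c p0"
  define S where "S = bundle_dom A R c c"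
  define \<Phi> where "\<Phi> = (\<lambda>(x, u). snd c (R (param c x) (tvec_of A c (param c x) u)))"
  have R0: "R p 0 = p" for p using R unfolding smooth_retraction_def by blast
  have openS: "open S" and ckS: "ck_on k S \<Phi>" for k
    using R c'(1) unfolding smooth_retraction_def S_def \<Phi>_def smooth_on_def by blast+
  have zS: "(x0, 0) \<in> S"
    using c' by (simp add: S_def bundle_dom_def x0_def chart_in_img param_chart tvec_of_0[OF c] R0)
  have SX: "\<Phi> ` S \<subseteq> chart_img c"
    unfolding S_def \<Phi>_def bundle_dom_def by (auto intro: chart_in_img)
  have evX: "\<forall>\<^sub>F x in nhds x0. x \<in> chart_img c" unfolding x0_def by (rule eventually_in_chart[OF c])
  have retr: "\<forall>\<^sub>F x in nhds x0. \<Phi> (x, 0) = x \<and> ((\<lambda>u. \<Phi> (x, u)) has_derivative (\<lambda>u. u)) (at 0)"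
    using evX
  proof eventually_elim
    case (elim x)
    note cx = param_charts_at[OF c'(1) elim]
    have "\<Phi> (x, 0) = x" by (simp add: \<Phi>_def tvec_of_0[OF cx] R0 chart_param[OF c'(1) elim])
    moreover have "((\<lambda>u. \<Phi> (x, u)) has_derivative (\<lambda>u. u)) (at 0)"
      using R cx unfolding smooth_retraction_def \<Phi>_def by simp
    ultimately show ?case ..
  qed
  have ckf: "ck_on 2 (chart_img c) (f \<circ> param c)" by (rule mfd_ck_chart[OF f c'(1)])
  obtain K1 where K1: "0 \<le> K1" "\<forall>\<^sub>F (x, u) in nhds x0 \<times>\<^sub>F nhds 0.
      \<bar>(f \<circ> param c) (\<Phi> (x, u)) - (f \<circ> param c) x - frechet_derivative (f \<circ> param c) (at x) u\<bar>
      \<le> K1 * (norm u)\<^sup>2"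
    using second_order_bound_along_retraction[OF chart_homeomorphism(2)[OF c'(1)] ckf openS zS ckS SX retr]
    by blast
  have "\<exists>K\<ge>0. \<forall>\<^sub>F (x, u) in nhds x0 \<times>\<^sub>F nhds 0.
      \<bar>grad_sq f (param c (\<Phi> (x, u))) - grad_sq f (param c x)\<bar> \<le> K * norm u"
  proof (rule lipschitz_along_retraction)
    show "lipschitz_near (\<lambda>x. grad_sq f (param c x)) x0"
      unfolding x0_def by (rule grad_sq_lipschitz_near[OF f c])
    show "lipschitz_near \<Phi> (x0, 0)" by (rule ck_on_Suc_0_imp_lipschitz_near[OF openS zS ckS])
    show "\<forall>\<^sub>F x in nhds x0. \<Phi> (x, 0) = x" using retr by (rule eventually_mono) blast
  qed
  then obtain K2 where K2: "0 \<le> K2" "\<forall>\<^sub>F (x, u) in nhds x0 \<times>\<^sub>F nhds 0.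
      \<bar>grad_sq f (param c (\<Phi> (x, u))) - grad_sq f (param c x)\<bar> \<le> K2 * norm u"
    by blast
  have evS: "\<forall>\<^sub>F (x, u) in nhds x0 \<times>\<^sub>F nhds 0. (x, u) \<in> S"
    using eventually_nhds_in_open[OF openS zS] unfolding nhds_prod by (rule eventually_mono) auto
  have "\<forall>\<^sub>F (x, u) in nhds x0 \<times>\<^sub>F nhds 0. (x, u) \<in> S \<and>
      \<bar>(f \<circ> param c) (\<Phi> (x, u)) - (f \<circ> param c) x - frechet_derivative (f \<circ> param c) (at x) u\<bar>
        \<le> K1 * (norm u)\<^sup>2 \<and>
      \<bar>grad_sq f (param c (\<Phi> (x, u))) - grad_sq f (param c x)\<bar> \<le> K2 * norm u"
    using evS K1(2) K2(2) by eventually_elim (simp add: case_prod_beta)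
  then obtain P Q where P: "eventually P (nhds x0)" and Q: "eventually Q (nhds (0::'e))" and
    PQ: "\<And>x u. P x \<Longrightarrow> Q u \<Longrightarrow> (x, u) \<in> S \<and>
      \<bar>(f \<circ> param c) (\<Phi> (x, u)) - (f \<circ> param c) x - frechet_derivative (f \<circ> param c) (at x) u\<bar>
        \<le> K1 * (norm u)\<^sup>2 \<and>
      \<bar>grad_sq f (param c (\<Phi> (x, u))) - grad_sq f (param c x)\<bar> \<le> K2 * norm u"
    unfolding eventually_prod_filter prod.case by blast
  obtain \<delta> where \<delta>: "0 < \<delta>" "\<And>u. norm u < \<delta> \<Longrightarrow> Q u"
    using Q unfolding eventually_nhds_metric by auto
  obtain l where l: "0 < l" "\<forall>\<^sub>F x in nhds x0. \<forall>u. l * (norm u)\<^sup>2 \<le> coord_metric c x u u"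
    using local_metric.eventually_coercive[OF local_metric_coord[OF c]] unfolding x0_def by blast
  \<comment> \<open>The first summand makes vectors of norm below \<open>1 / C\<close> shorter than \<open>\<delta>\<close> in the chart; the others convert the two constants.\<close>
  define C where "C = 1 / (\<delta> * sqrt l) + K1 / l + K2 / sqrt l"
  have Cparts: "0 < C" "1 / (\<delta> * sqrt l) \<le> C" "K1 / l \<le> C" "K2 / sqrt l \<le> C"
    using \<delta>(1) l(1) K1(1) K2(1) unfolding C_def by (simp_all add: add_pos_nonneg)
  have "\<forall>\<^sub>F x in nhds x0. P x \<and> (\<forall>u. l * (norm u)\<^sup>2 \<le> coord_metric c x u u)"
    using P l(2) by eventually_elim blast
  then have "\<forall>\<^sub>F p in nhds p0. c \<in> charts_at A p \<and> P (snd c p) \<and>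
      (\<forall>u. l * (norm u)\<^sup>2 \<le> coord_metric c (snd c p) u u)"
    unfolding x0_def by (rule eventually_chart[OF c])
  then have "\<forall>\<^sub>F p in nhds p0. \<forall>\<eta>\<in>tangent_space A p. rnorm g p \<eta> < 1 / C \<longrightarrow>
      f (R p \<eta>) \<le> f p + g p (grad A g f p) \<eta> + C * (rnorm g p \<eta>)\<^sup>2 \<and>
      \<bar>grad_sq f (R p \<eta>) - grad_sq f p\<bar> \<le> C * rnorm g p \<eta>"
  proof (rule eventually_mono, intro ballI impI)
    fix p \<eta> assume p: "c \<in> charts_at A p \<and> P (snd c p) \<and>
        (\<forall>u. l * (norm u)\<^sup>2 \<le> coord_metric c (snd c p) u u)"
      and \<eta>: "\<eta> \<in> tangent_space A p" and small: "rnorm g p \<eta> < 1 / C"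
    have cp: "c \<in> charts_at A p" using p by blast
    note cp' = charts_atD[OF cp]
    define u where "u = \<eta> c"
    have pc: "param c (snd c p) = p" by (rule param_chart[OF cp'])
    have tu: "tvec_of A c p u = \<eta>" unfolding u_def by (rule tvec_of_coord[OF cp \<eta>])
    have "l * (norm u)\<^sup>2 \<le> coord_metric c (snd c p) u u" using p by blast
    then have low: "l * (norm u)\<^sup>2 \<le> (rnorm g p \<eta>)\<^sup>2" by (simp add: pc tu rnorm_sq[OF \<eta>])
    have rn: "0 \<le> rnorm g p \<eta>" by (rule rnorm_nonneg[OF \<eta>])
    have "sqrt l * norm u \<le> rnorm g p \<eta>"
      by (rule power2_le_imp_le) (use low l(1) rn in \<open>simp_all add: power_mult_distrib\<close>)
    then have nu: "norm u \<le> rnorm g p \<eta> / sqrt l" using l(1) by (simp add: field_simps)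
    have "rnorm g p \<eta> / sqrt l < (1 / C) / sqrt l" 
      by (rule divide_strict_right_mono[OF small]) (use l(1) in simp)
    also have "\<dots> \<le> \<delta>"
      using Cparts(1,2) \<delta>(1) l(1) by (simp add: field_simps)
    finally have "Q u" using nu by (intro \<delta>(2)) linarith
    note bd = PQ[OF conjunct1[OF conjunct2[OF p]] this]
    have Rin: "R p \<eta> \<in> fst c" using bd by (auto simp: S_def bundle_dom_def pc tu)
    have \<Phi>u: "param c (\<Phi> (snd c p, u)) = R p \<eta>"
      using param_chart[OF c'(1) Rin] by (simp add: \<Phi>_def pc tu)
    have f1: "mfd_ck (Suc (Suc 0)) A f" using f by (simp add: numeral_2_eq_2)
    have df: "frechet_derivative (f \<circ> param c) (at (snd c p)) u = g p (grad A g f p) \<eta>"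
      unfolding u_def by (rule grad_inner[OF f1 cp \<eta>, symmetric])
    have "f (R p \<eta>) - f p - g p (grad A g f p) \<eta> \<le> K1 * (norm u)\<^sup>2"
      using bd unfolding df o_apply \<Phi>u pc by linarith
    also have "\<dots> \<le> K1 * ((rnorm g p \<eta>)\<^sup>2 / l)"
      using low l(1) K1(1) by (intro mult_left_mono) (simp_all add: field_simps)
    also have "\<dots> = (K1 / l) * (rnorm g p \<eta>)\<^sup>2" by simp
    also have "\<dots> \<le> C * (rnorm g p \<eta>)\<^sup>2" using Cparts(3) by (rule mult_right_mono) simp
    finally have 1: "f (R p \<eta>) \<le> f p + g p (grad A g f p) \<eta> + C * (rnorm g p \<eta>)\<^sup>2" by linarith
    have "\<bar>grad_sq f (R p \<eta>) - grad_sq f p\<bar> \<le> K2 * norm u"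
      using bd unfolding \<Phi>u pc by blast
    also have "\<dots> \<le> K2 * (rnorm g p \<eta> / sqrt l)" using nu K2(1) by (rule mult_left_mono)
    also have "\<dots> = (K2 / sqrt l) * rnorm g p \<eta>" by simp
    also have "\<dots> \<le> C * rnorm g p \<eta>" using Cparts(4) rn by (rule mult_right_mono)
    finally show "f (R p \<eta>) \<le> f p + g p (grad A g f p) \<eta> + C * (rnorm g p \<eta>)\<^sup>2 \<and>
      \<bar>grad_sq f (R p \<eta>) - grad_sq f p\<bar> \<le> C * rnorm g p \<eta>" using 1 by blast
  qed
  with Cparts(1) show ?thesis by blast
qed

lemma retraction_bounds_on_compact:
  assumes f: "mfd_ck 2 A f" and R: "smooth_retraction A R" and K: "compact K"
  obtains C where "0 < C"
    "\<And>p \<eta>. p \<in> K \<Longrightarrow> \<eta> \<in> tangent_space A p \<Longrightarrow> rnorm g p \<eta> < 1 / C \<Longrightarrow>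
      f (R p \<eta>) \<le> f p + g p (grad A g f p) \<eta> + C * (rnorm g p \<eta>)\<^sup>2"
    "\<And>p \<eta>. p \<in> K \<Longrightarrow> \<eta> \<in> tangent_space A p \<Longrightarrow> rnorm g p \<eta> < 1 / C \<Longrightarrow>
      \<bar>grad_sq f (R p \<eta>) - grad_sq f p\<bar> \<le> C * rnorm g p \<eta>"
proof -
  let ?B = "\<lambda>C p. \<forall>\<eta>\<in>tangent_space A p. rnorm g p \<eta> < 1 / C \<longrightarrow>
      f (R p \<eta>) \<le> f p + g p (grad A g f p) \<eta> + C * (rnorm g p \<eta>)\<^sup>2 \<and>
      \<bar>grad_sq f (R p \<eta>) - grad_sq f p\<bar> \<le> C * rnorm g p \<eta>"
  have "\<exists>C. \<forall>p\<in>K. 0 < C \<and> ?B C p"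
  proof (rule uniform_on_compact[OF K])
    fix C D p assume C: "0 < C \<and> ?B C p" and CD: "C \<le> D"
    have "?B D p"
    proof (intro ballI impI)
      fix \<eta> assume \<eta>: "\<eta> \<in> tangent_space A p" and small: "rnorm g p \<eta> < 1 / D"
      have "1 / D \<le> 1 / C" using C CD by (simp add: frac_le)
      then have b: "f (R p \<eta>) \<le> f p + g p (grad A g f p) \<eta> + C * (rnorm g p \<eta>)\<^sup>2 \<and>
          \<bar>grad_sq f (R p \<eta>) - grad_sq f p\<bar> \<le> C * rnorm g p \<eta>"
        using C \<eta> small by (meson less_le_trans)
      have "C * (rnorm g p \<eta>)\<^sup>2 \<le> D * (rnorm g p \<eta>)\<^sup>2" "C * rnorm g p \<eta> \<le> D * rnorm g p \<eta>"
        using CD rnorm_nonneg[OF \<eta>] by (auto intro: mult_right_mono)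
      with b show "f (R p \<eta>) \<le> f p + g p (grad A g f p) \<eta> + D * (rnorm g p \<eta>)\<^sup>2 \<and>
          \<bar>grad_sq f (R p \<eta>) - grad_sq f p\<bar> \<le> D * rnorm g p \<eta>" by linarith
    qed
    with C CD show "0 < D \<and> ?B D p" by linarith
  next
    fix p
    obtain C where C: "0 < C" "\<forall>\<^sub>F q in nhds p. ?B C q"
      using retraction_bounds_near[OF f R, of p] by blast
    from C(2) have "\<forall>\<^sub>F q in nhds p. 0 < C \<and> ?B C q"
      by (rule eventually_mono) (rule conjI[OF C(1)])
    then show "\<exists>C. \<forall>\<^sub>F q in nhds p. 0 < C \<and> ?B C q" by (rule exI[of _ C])
  qed
  then obtain C where C: "\<forall>p\<in>K. 0 < C \<and> ?B C p" by (rule exE)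
  show thesis
  proof (cases "K = {}")
    case True
    then show thesis using that[of 1] by simp
  next
    case False
    then have "0 < C" using C by blast
    then show thesis
    proof (rule that)
      fix p \<eta> assume p: "p \<in> K" and \<eta>: "\<eta> \<in> tangent_space A p" "rnorm g p \<eta> < 1 / C"
      note b = bspec[OF conjunct2[OF bspec[OF C p]] \<eta>(1), THEN mp, OF \<eta>(2)]
      show "f (R p \<eta>) \<le> f p + g p (grad A g f p) \<eta> + C * (rnorm g p \<eta>)\<^sup>2"
        by (rule conjunct1[OF b])
      show "\<bar>grad_sq f (R p \<eta>) - grad_sq f p\<bar> \<le> C * rnorm g p \<eta>"
        by (rule conjunct2[OF b])
    qed
  qed
qed

end

section \<open>Two lemmas on real sequences\<close>

text \<open>Suppose \<open>a\<^sub>k \<ge> \<epsilon>\<close> for some late \<open>k\<close>. Since the weights have infinite sum but the weighted series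
converges, a later value is below \<open>\<epsilon>/2\<close>; let \<open>j\<close> be the first such index. Descending from \<open>\<epsilon>\<close> to
\<open>\<epsilon>/2\<close> takes total weight at least \<open>\<epsilon>/(2D)\<close>, all of it at values of at least \<open>\<epsilon>/2\<close>, which contributes
\<open>\<epsilon>\<^sup>2/(4D)\<close> to the tail of the convergent series.\<close>

lemma tendsto_zero_if_weighted_summable:
  fixes a \<alpha> :: "nat \<Rightarrow> real"
  assumes \<alpha>: "\<And>k. 0 < \<alpha> k" and a: "\<And>k. 0 \<le> a k"
    and div: "filterlim (\<lambda>n. \<Sum>k<n. \<alpha> k) at_top sequentially"
    and summ: "summable (\<lambda>k. \<alpha> k * a k)"
    and lip: "\<forall>\<^sub>F k in sequentially. \<bar>a (Suc k) - a k\<bar> \<le> C * \<alpha> k"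
  shows "a \<longlonglongrightarrow> 0"
proof (rule LIMSEQ_I)
  fix \<epsilon> :: real assume \<epsilon>: "0 < \<epsilon>"
  \<comment> \<open>\<open>C\<close> may vanish or be negative, and \<open>D\<close> is a divisor below.\<close>
  define D where "D = max C 1"
  have D: "0 < D" "C \<le> D" unfolding D_def by simp_all
  obtain N1 where N1: "\<And>k. N1 \<le> k \<Longrightarrow> \<bar>a (Suc k) - a k\<bar> \<le> C * \<alpha> k"
    using lip unfolding eventually_sequentially by blast
  have "0 < \<epsilon>\<^sup>2 / (4 * D)" using \<epsilon> D by simp
  then obtain N2 where N2: "\<And>k n. N2 \<le> k \<Longrightarrow> norm (\<Sum>i=k..<n. \<alpha> i * a i) < \<epsilon>\<^sup>2 / (4 * D)"
    using summ unfolding summable_Cauchy by metis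
  have "a k < \<epsilon>" if k: "max N1 N2 \<le> k" for k
  proof (rule ccontr)
    assume "\<not> a k < \<epsilon>"
    then have big: "\<epsilon> \<le> a k" by simp
    have low: "(\<Sum>i=k..<n. \<alpha> i) * (\<epsilon> / 2) < \<epsilon>\<^sup>2 / (4 * D)"
      if ge: "\<And>i. k \<le> i \<Longrightarrow> i < n \<Longrightarrow> \<epsilon> / 2 \<le> a i" for n
    proof -
      have "(\<Sum>i=k..<n. \<alpha> i) * (\<epsilon> / 2) \<le> (\<Sum>i=k..<n. \<alpha> i * a i)"
        unfolding sum_distrib_right using ge \<alpha> by (intro sum_mono mult_left_mono) (auto intro: less_imp_le)
      also have "\<dots> \<le> norm (\<Sum>i=k..<n. \<alpha> i * a i)" by simp
      also have "\<dots> < \<epsilon>\<^sup>2 / (4 * D)" using N2 k by simp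
      finally show ?thesis .
    qed
    have "\<exists>j. k \<le> j \<and> a j < \<epsilon> / 2"
    proof (rule ccontr)
      assume "\<nexists>j. k \<le> j \<and> a j < \<epsilon> / 2"
      then have ge: "\<epsilon> / 2 \<le> a j" if "k \<le> j" for j using that by force
      define Z where "Z = (\<Sum>i<k. \<alpha> i) + \<epsilon>\<^sup>2 / (4 * D) * (2 / \<epsilon>)"
      have "\<forall>\<^sub>F n in sequentially. Z \<le> (\<Sum>i<n. \<alpha> i)" using div unfolding filterlim_at_top by blast
      then obtain n where n: "k \<le> n" "Z \<le> (\<Sum>i<n. \<alpha> i)"
        unfolding eventually_sequentially by (metis nle_le)
      have "(\<Sum>i<n. \<alpha> i) = (\<Sum>i<k. \<alpha> i) + (\<Sum>i=k..<n. \<alpha> i)"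
        using sum.atLeastLessThan_concat[of 0 k n \<alpha>] n(1) by (simp add: lessThan_atLeast0)
      with n(2) have "\<epsilon>\<^sup>2 / (4 * D) * (2 / \<epsilon>) \<le> (\<Sum>i=k..<n. \<alpha> i)" unfolding Z_def by linarith
      then have "\<epsilon>\<^sup>2 / (4 * D) * (2 / \<epsilon>) * (\<epsilon> / 2) \<le> (\<Sum>i=k..<n. \<alpha> i) * (\<epsilon> / 2)"
        using \<epsilon> by (intro mult_right_mono) auto
      moreover have "\<epsilon>\<^sup>2 / (4 * D) * (2 / \<epsilon>) * (\<epsilon> / 2) = \<epsilon>\<^sup>2 / (4 * D)" using \<epsilon> by simp
      ultimately show False using low[of n] ge by fastforce
    qed
    define j where "j = (LEAST j. k \<le> j \<and> a j < \<epsilon> / 2)"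
    have j: "k \<le> j" "a j < \<epsilon> / 2" unfolding j_def using LeastI_ex[OF \<open>\<exists>j. k \<le> j \<and> a j < \<epsilon> / 2\<close>] by auto
    have ge: "\<epsilon> / 2 \<le> a i" if "k \<le> i" "i < j" for i
      using not_less_Least[of i "\<lambda>j. k \<le> j \<and> a j < \<epsilon> / 2"] that unfolding j_def by auto
    have "\<epsilon> / 2 \<le> a k - a j" using big j(2) by linarith
    also have "\<dots> = (\<Sum>i=k..<j. a i - a (Suc i))" using sum_Suc_diff'[of k j "\<lambda>i. - a i"] j(1) by simp
    also have "\<dots> \<le> (\<Sum>i=k..<j. D * \<alpha> i)"
    proof (rule sum_mono)
      fix i assume "i \<in> {k..<j}"
      then have "a i - a (Suc i) \<le> C * \<alpha> i" using N1[of i] k by auto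
      also have "\<dots> \<le> D * \<alpha> i" using D(2) \<alpha>[of i] by (intro mult_right_mono) auto
      finally show "a i - a (Suc i) \<le> D * \<alpha> i" .
    qed
    also have "\<dots> = D * (\<Sum>i=k..<j. \<alpha> i)" by (simp add: sum_distrib_left)
    finally have "\<epsilon> / 2 / D \<le> (\<Sum>i=k..<j. \<alpha> i)" using D(1) by (simp add: field_simps)
    then have "\<epsilon> / 2 / D * (\<epsilon> / 2) \<le> (\<Sum>i=k..<j. \<alpha> i) * (\<epsilon> / 2)" using \<epsilon> by (intro mult_right_mono) auto
    moreover have "\<epsilon> / 2 / D * (\<epsilon> / 2) = \<epsilon>\<^sup>2 / (4 * D)" by (simp add: power2_eq_square)
    ultimately show False using low[of j] ge by fastforce
  qed
  then show "\<exists>N. \<forall>k\<ge>N. norm (a k - 0) < \<epsilon>" using a by (intro exI[of _ "max N1 N2"]) simp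
qed

text \<open>Telescoping the descent inequality bounds the partial sums.\<close>

lemma summable_if_descent:
  fixes F a \<alpha> :: "nat \<Rightarrow> real"
  assumes \<alpha>: "\<And>k. 0 < \<alpha> k" and a: "\<And>k. 0 \<le> a k" and F: "\<And>k. B \<le> F k"
    and sq: "summable (\<lambda>k. (\<alpha> k)\<^sup>2)" and K: "0 \<le> K" and c: "0 < c"
    and desc: "\<forall>\<^sub>F k in sequentially. F (Suc k) \<le> F k - c * (\<alpha> k * a k) + K * (\<alpha> k)\<^sup>2"
  shows "summable (\<lambda>k. \<alpha> k * a k)"
proof -
  obtain N where N: "\<And>k. N \<le> k \<Longrightarrow> F (Suc k) \<le> F k - c * (\<alpha> k * a k) + K * (\<alpha> k)\<^sup>2"
    using desc unfolding eventually_sequentially by blast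
  have sqN: "summable (\<lambda>k. (\<alpha> (k + N))\<^sup>2)" using sq by (subst summable_iff_shift)
  let ?Q = "\<Sum>k. (\<alpha> (k + N))\<^sup>2"
  have tele: "c * (\<Sum>k<n. \<alpha> (k + N) * a (k + N)) \<le> F N - F (n + N) + K * (\<Sum>k<n. (\<alpha> (k + N))\<^sup>2)" for n
  proof (induction n)
    case (Suc n)
    show ?case using Suc.IH N[of "n + N"] by (simp add: algebra_simps)
  qed simp
  have "(\<Sum>k<n. \<alpha> (k + N) * a (k + N)) \<le> (F N - B + K * ?Q) / c" for n
  proof -
    have "(\<Sum>k<n. (\<alpha> (k + N))\<^sup>2) \<le> ?Q" using sqN by (intro sum_le_suminf) auto
    then have "K * (\<Sum>k<n. (\<alpha> (k + N))\<^sup>2) \<le> K * ?Q" using K by (rule mult_left_mono)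
    then have "c * (\<Sum>k<n. \<alpha> (k + N) * a (k + N)) \<le> F N - B + K * ?Q"
      using tele[of n] F[of "n + N"] by linarith
    then show ?thesis using c by (simp add: field_simps)
  qed
  then have "summable (\<lambda>k. \<alpha> (k + N) * a (k + N))"
    using \<alpha> a
    by (intro summableI_nonneg_bounded) (auto intro!: mult_nonneg_nonneg simp: less_imp_le)
  then show ?thesis by (subst (asm) summable_iff_shift)
qed

section \<open>Averaging over a fresh uniform choice\<close>

text \<open>\<open>Y\<close> is a function of the variables \<open>X j\<close>, \<open>j \<in> J\<close>. This replaces measurability with respect to the
generated sigma algebra; the values of \<open>Y\<close> may lie in any type, such as points and tangent vectors.\<close>

definition determined_by :: "'a set \<Rightarrow> ('i \<Rightarrow> 'a \<Rightarrow> 'c) \<Rightarrow> 'i set \<Rightarrow> ('a \<Rightarrow> 'b) \<Rightarrow> bool" where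
  "determined_by U X J Y \<longleftrightarrow> (\<forall>x\<in>U. \<forall>y\<in>U. (\<forall>j\<in>J. X j x = X j y) \<longrightarrow> Y x = Y y)"

lemma determined_by_mono: "determined_by U X J Y \<Longrightarrow> J \<subseteq> J' \<Longrightarrow> determined_by U X J' Y"
  unfolding determined_by_def by blast

lemma determined_by_comp: "determined_by U X J Y \<Longrightarrow> determined_by U X J (\<lambda>x. h (Y x))"
  unfolding determined_by_def by (intro ballI impI arg_cong[where f = h]) blast

lemma determined_by_Pair:
  "determined_by U X J Y \<Longrightarrow> determined_by U X J Z \<Longrightarrow> determined_by U X J (\<lambda>x. (Y x, Z x))"
  unfolding determined_by_def by blast

context prob_space
begin

lemma indep_sets_reindex:
  assumes h: "inj_on h K" and F: "indep_sets F (h ` K)"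
  shows "indep_sets (\<lambda>k. F (h k)) K"
  unfolding indep_sets_def
proof (intro conjI ballI allI impI)
  fix k assume "k \<in> K"
  then show "F (h k) \<subseteq> events" using F unfolding indep_sets_def by blast
next
  fix J B assume J: "J \<subseteq> K" "J \<noteq> {}" "finite J" and B: "B \<in> (\<Pi> j\<in>J. F (h j))"
  have hJ: "inj_on h J" using h J(1) by (rule inj_on_subset)
  define B' where "B' = (\<lambda>i. B (the_inv_into J h i))"
  have B': "B' (h j) = B j" if "j \<in> J" for j unfolding B'_def using hJ that by (simp add: the_inv_into_f_f)
  have "B' \<in> Pi (h ` J) F" using B B' by auto
  then have "prob (\<Inter>i\<in>h ` J. B' i) = (\<Prod>i\<in>h ` J. prob (B' i))"
    using J by (intro indep_setsD[OF F]) auto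
  then show "prob (\<Inter>j\<in>J. B j) = (\<Prod>j\<in>J. prob (B j))"
    using B' by (simp add: prod.reindex[OF hJ])
qed

lemma indep_vars_reindex:
  assumes h: "inj_on h K" and X: "indep_vars N X (h ` K)"
  shows "indep_vars (\<lambda>k. N (h k)) (\<lambda>k. X (h k)) K"
  using X indep_sets_reindex[OF h] unfolding indep_vars_def2 by auto

definition cylinder :: "('i \<Rightarrow> 'a \<Rightarrow> 'c) \<Rightarrow> 'i set \<Rightarrow> ('i \<Rightarrow> 'c) \<Rightarrow> 'a set" where
  "cylinder X J h = {x \<in> space M. \<forall>j\<in>J. X j x = h j}"

lemma cylinder_event:
  assumes X: "\<And>j. j \<in> J \<Longrightarrow> random_variable (count_space UNIV) (X j)" and J: "finite J"
  shows "cylinder X J h \<in> events"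
proof -
  have "X j -` {h j} \<inter> space M \<in> events" if "j \<in> J" for j
    using X[OF that] by (rule measurable_sets) simp
  then have "(\<Inter>j\<in>J. X j -` {h j} \<inter> space M) \<in> events" if "J \<noteq> {}"
    using J that by (intro sets.finite_INT) auto
  moreover have "cylinder X J h = (if J = {} then space M else (\<Inter>j\<in>J. X j -` {h j} \<inter> space M))"
    by (auto simp: cylinder_def)
  ultimately show ?thesis by simp
qed

lemma prob_cylinder:
  assumes indep: "indep_vars (\<lambda>_. count_space UNIV) X K" and J: "J \<subseteq> K" "finite J"
  shows "prob (cylinder X J h) = (\<Prod>j\<in>J. prob (X j -` {h j} \<inter> space M))"
proof (cases "J = {}")
  case True
  then show ?thesis by (simp add: cylinder_def prob_space)
next
  case False
  have "cylinder X J h = (\<Inter>j\<in>J. X j -` {h j} \<inter> space M)" using False by (auto simp: cylinder_def)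
  then show ?thesis using indep_varsD[OF indep False J(2,1), of "\<lambda>j. {h j}"] by simp
qed

text \<open>Finitely many variables with finitely many values split the space into finitely many cylinders, one
for each history \<open>h\<close>, and \<open>Y\<close> is constant on each of them.\<close>

lemma determined_by_as_sum:
  fixes Y :: "'a \<Rightarrow> real"
  assumes det: "determined_by (space M) X J Y" and J: "finite J" and S: "finite S"
    and range: "\<And>j x. j \<in> J \<Longrightarrow> x \<in> space M \<Longrightarrow> X j x \<in> S"
  obtains y where "\<And>x. x \<in> space M \<Longrightarrow>
    Y x = (\<Sum>h\<in>PiE J (\<lambda>_. S). y h * indicator (cylinder X J h) x)"
proof
  fix x assume x: "x \<in> space M"
  \<comment> \<open>On an empty cylinder the chosen point is arbitrary, but there the indicator vanishes.\<close>
  define y where "y = (\<lambda>h. Y (SOME x. x \<in> cylinder X J h))"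
  let ?P = "PiE J (\<lambda>_. S)"
  define h0 where "h0 = restrict (\<lambda>j. X j x) J"
  have h0: "h0 \<in> ?P" unfolding h0_def using range x by auto
  have fin: "finite ?P" using J S by (intro finite_PiE) auto
  have ind: "indicator (cylinder X J h) x = (if h = h0 then 1 else 0 :: real)" if "h \<in> ?P" for h
  proof -
    have "x \<in> cylinder X J h \<longleftrightarrow> h = h0"
      using that x unfolding cylinder_def h0_def
      by (auto simp: fun_eq_iff restrict_def PiE_iff extensional_def)
    then show ?thesis by (simp add: indicator_def)
  qed
  have "x \<in> cylinder X J h0" using x by (simp add: cylinder_def h0_def)
  define z where "z = (SOME x. x \<in> cylinder X J h0)"
  have "z \<in> cylinder X J h0"
    unfolding z_def using \<open>x \<in> cylinder X J h0\<close> by (rule someI)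
  then have "z \<in> space M" "\<forall>j\<in>J. X j x = X j z" by (simp_all add: cylinder_def h0_def)
  then have "Y x = Y z" using det x unfolding determined_by_def by blast
  then have "Y x = y h0" by (simp add: y_def z_def)
  also have "\<dots> = (\<Sum>h\<in>?P. if h = h0 then y h else 0)" using h0 fin by simp
  also have "\<dots> = (\<Sum>h\<in>?P. y h * indicator (cylinder X J h) x)"
    using ind by (intro sum.cong) auto
  finally show "Y x = (\<Sum>h\<in>?P. Y (SOME x. x \<in> cylinder X J h) * indicator (cylinder X J h) x)"
    by (simp add: y_def)
qed

lemma integrable_determined_by:
  fixes Y :: "'a \<Rightarrow> real"
  assumes det: "determined_by (space M) X J Y" and J: "finite J" and S: "finite S"
    and range: "\<And>j x. j \<in> J \<Longrightarrow> x \<in> space M \<Longrightarrow> X j x \<in> S"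
    and X: "\<And>j. j \<in> J \<Longrightarrow> random_variable (count_space UNIV) (X j)"
  shows "integrable M Y"
proof -
  obtain y where y: "\<And>x. x \<in> space M \<Longrightarrow>
      Y x = (\<Sum>h\<in>PiE J (\<lambda>_. S). y h * indicator (cylinder X J h) x)"
    using determined_by_as_sum[OF det J S range] by blast
  have "integrable M (\<lambda>x. \<Sum>h\<in>PiE J (\<lambda>_. S). y h * indicator (cylinder X J h) x)"
    using cylinder_event[OF X J]
    by (intro Bochner_Integration.integrable_sum integrable_mult_right integrable_real_indicator)
      (auto simp: less_top[symmetric])
  then show ?thesis using y by (subst Bochner_Integration.integrable_cong[OF refl y]) auto
qed

text \<open>On a cylinder the claim is the product formula for the independent variables \<open>X j\<close>, \<open>j \<in> J\<close>, and \<open>X k\<close>;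
\<open>Y\<close> is a linear combination of indicators of cylinders.\<close>

lemma expectation_fresh_event:
  fixes Y :: "'a \<Rightarrow> real"
  assumes indep: "indep_vars (\<lambda>_. count_space UNIV) X K"
    and J: "J \<subseteq> K" "finite J" and k: "k \<in> K" "k \<notin> J" and S: "finite S"
    and range: "\<And>j x. j \<in> J \<Longrightarrow> x \<in> space M \<Longrightarrow> X j x \<in> S"
    and det: "determined_by (space M) X J Y"
  shows "expectation (\<lambda>x. indicator (X k -` {B}) x * Y x) =
    prob (X k -` {B} \<inter> space M) * expectation Y"
proof -
  have X: "random_variable (count_space UNIV) (X j)" if "j \<in> K" for j
    using indep that unfolding indep_vars_def by blast
  have XJ: "random_variable (count_space UNIV) (X j)" if "j \<in> J" for j using X J(1) that by blast
  have XkJ: "random_variable (count_space UNIV) (X j)" if "j \<in> insert k J" for j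
    using X J(1) k that by blast
  obtain y where y: "\<And>x. x \<in> space M \<Longrightarrow>
      Y x = (\<Sum>h\<in>PiE J (\<lambda>_. S). y h * indicator (cylinder X J h) x)"
    using determined_by_as_sum[OF det J(2) S range] by blast
  let ?P = "PiE J (\<lambda>_. S)"
  define C where "C = (\<lambda>h. cylinder X (insert k J) (h(k := B)))"
  have split: "indicator (X k -` {B}) x * indicator (cylinder X J h) x = (indicator (C h) x :: real)"
    if "x \<in> space M" for x h
    using that k(2) unfolding C_def cylinder_def by (auto simp: indicator_def)
  have probC: "prob (C h) = prob (X k -` {B} \<inter> space M) * prob (cylinder X J h)" for h
  proof -
    have "prob (C h) = (\<Prod>j\<in>insert k J. prob (X j -` {(h(k := B)) j} \<inter> space M))"
      unfolding C_def using J k by (intro prob_cylinder[OF indep]) auto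
    also have "\<dots> = prob (X k -` {B} \<inter> space M) * (\<Prod>j\<in>J. prob (X j -` {(h(k := B)) j} \<inter> space M))"
      unfolding prod.insert[OF J(2) k(2)] by simp
    also have "(\<Prod>j\<in>J. prob (X j -` {(h(k := B)) j} \<inter> space M)) = (\<Prod>j\<in>J. prob (X j -` {h j} \<inter> space M))"
      using k(2) by (intro prod.cong refl) auto
    also have "(\<Prod>j\<in>J. prob (X j -` {h j} \<inter> space M)) = prob (cylinder X J h)"
      by (rule prob_cylinder[OF indep J, symmetric])
    finally show ?thesis .
  qed
  have evC: "C h \<in> events" for h unfolding C_def using J(2) by (intro cylinder_event XkJ) auto
  have evJ: "cylinder X J h \<in> events" for h by (rule cylinder_event[OF XJ J(2)])
  have int: "expectation (\<lambda>x. \<Sum>h\<in>?P. y h * indicator (E h) x) = (\<Sum>h\<in>?P. y h * prob (E h))"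
    if "\<And>h. E h \<in> events" for E :: "('b \<Rightarrow> 'c) \<Rightarrow> 'a set"
  proof -
    have i: "integrable M (indicator (E h) :: 'a \<Rightarrow> real)" for h
      using that by (intro integrable_real_indicator) (auto simp: less_top[symmetric])
    show ?thesis
      using that i by (simp add: Bochner_Integration.integral_sum sets.sets_into_space Int_absorb2)
  qed
  have "expectation (\<lambda>x. indicator (X k -` {B}) x * Y x) =
      expectation (\<lambda>x. \<Sum>h\<in>?P. y h * indicator (C h) x)"
  proof (rule Bochner_Integration.integral_cong[OF refl])
    fix x assume x: "x \<in> space M"
    show "indicator (X k -` {B}) x * Y x = (\<Sum>h\<in>?P. y h * indicator (C h) x)"
      unfolding y[OF x] sum_distrib_left using split[OF x]
      by (intro sum.cong refl) (simp add: mult.left_commute)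
  qed
  also have "\<dots> = (\<Sum>h\<in>?P. y h * prob (C h))" by (rule int[OF evC])
  also have "\<dots> = prob (X k -` {B} \<inter> space M) * (\<Sum>h\<in>?P. y h * prob (cylinder X J h))"
    by (simp add: probC sum_distrib_left mult.left_commute)
  also have "(\<Sum>h\<in>?P. y h * prob (cylinder X J h)) = expectation Y"
    unfolding int[OF evJ, symmetric] by (rule Bochner_Integration.integral_cong[OF refl, symmetric, OF y])
  finally show ?thesis .
qed

text \<open>The elementary form of conditioning on the past: \<open>\<Phi> B\<close> depends on the variables in \<open>J\<close> only, so the
choice \<open>X k\<close> may be averaged out with the past held fixed.\<close>

lemma expectation_fresh_uniform:
  fixes \<Phi> :: "'c \<Rightarrow> 'a \<Rightarrow> real"
  assumes indep: "indep_vars (\<lambda>_. count_space UNIV) X K"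
    and J: "J \<subseteq> K" "finite J" and k: "k \<in> K" "k \<notin> J" and S: "finite S"
    and range: "\<And>j x. j \<in> K \<Longrightarrow> x \<in> space M \<Longrightarrow> X j x \<in> S"
    and uniform: "\<And>B. B \<in> S \<Longrightarrow> prob (X k -` {B} \<inter> space M) = 1 / real (card S)"
    and det: "\<And>B. B \<in> S \<Longrightarrow> determined_by (space M) X J (\<Phi> B)"
  shows "expectation (\<lambda>x. \<Phi> (X k x) x) = (1 / real (card S)) * expectation (\<lambda>x. \<Sum>B\<in>S. \<Phi> B x)"
proof -
  have X: "random_variable (count_space UNIV) (X j)" if "j \<in> K" for j
    using indep that unfolding indep_vars_def by blast
  have int: "integrable M (\<Phi> B)" if "B \<in> S" for B
    by (rule integrable_determined_by[OF det[OF that] J(2) S])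
      (auto intro!: range X subsetD[OF J(1)])
  have int': "integrable M (\<lambda>x. indicator (X k -` {B}) x * \<Phi> B x)" if "B \<in> S" for B
  proof (rule integrable_determined_by[where J = "insert k J" and S = S and X = X])
    show "determined_by (space M) X (insert k J) (\<lambda>x. indicator (X k -` {B}) x * \<Phi> B x)"
      unfolding determined_by_def
    proof (intro ballI impI)
      fix x y assume xy: "x \<in> space M" "y \<in> space M" "\<forall>j\<in>insert k J. X j x = X j y"
      then have "\<Phi> B x = \<Phi> B y" using det[OF that] unfolding determined_by_def by blast
      moreover have "X k x = X k y" using xy(3) by blast
      ultimately show "indicator (X k -` {B}) x * \<Phi> B x = indicator (X k -` {B}) y * \<Phi> B y"
        by (simp add: indicator_def)
    qed
    show "X j x \<in> S" if "j \<in> insert k J" "x \<in> space M" for j x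
      using that J(1) k(1) by (intro range) blast+
    show "random_variable (count_space UNIV) (X j)" if "j \<in> insert k J" for j
      using that J(1) k(1) by (intro X) blast
  qed (use J(2) S in simp_all)
  have "expectation (\<lambda>x. \<Phi> (X k x) x) =
      expectation (\<lambda>x. \<Sum>B\<in>S. indicator (X k -` {B}) x * \<Phi> B x)"
  proof (rule Bochner_Integration.integral_cong[OF refl])
    fix x assume x: "x \<in> space M"
    have "(\<Sum>B\<in>S. indicator (X k -` {B}) x * \<Phi> B x) = (\<Sum>B\<in>S. if B = X k x then \<Phi> B x else 0)"
      by (intro sum.cong) (auto simp: indicator_def)
    also have "\<dots> = \<Phi> (X k x) x" using S range[OF k(1) x] by simp
    finally show "\<Phi> (X k x) x = (\<Sum>B\<in>S. indicator (X k -` {B}) x * \<Phi> B x)" by simp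
  qed
  also have "\<dots> = (\<Sum>B\<in>S. expectation (\<lambda>x. indicator (X k -` {B}) x * \<Phi> B x))"
    by (rule Bochner_Integration.integral_sum[OF int'])
  also have "\<dots> = (\<Sum>B\<in>S. (1 / real (card S)) * expectation (\<Phi> B))"
  proof (rule sum.cong[OF refl])
    fix B assume B: "B \<in> S"
    have "expectation (\<lambda>x. indicator (X k -` {B}) x * \<Phi> B x) =
        prob (X k -` {B} \<inter> space M) * expectation (\<Phi> B)"
      by (rule expectation_fresh_event[OF indep J k S _ det[OF B]])
        (auto intro!: range subsetD[OF J(1)])
    then show "expectation (\<lambda>x. indicator (X k -` {B}) x * \<Phi> B x) = (1 / real (card S)) * expectation (\<Phi> B)"
      by (simp add: uniform[OF B])
  qed
  also have "\<dots> = (1 / real (card S)) * (\<Sum>B\<in>S. expectation (\<Phi> B))"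
    by (simp add: sum_distrib_left)
  also have "(\<Sum>B\<in>S. expectation (\<Phi> B)) = expectation (\<lambda>x. \<Sum>B\<in>S. \<Phi> B x)"
    by (rule Bochner_Integration.integral_sum[OF int, symmetric])
  finally show ?thesis .
qed

end

section \<open>The search direction\<close>

definition batches :: "nat \<Rightarrow> nat \<Rightarrow> nat set set" where
  "batches n b = {B. B \<subseteq> {1..n} \<and> card B = b}"

lemma finite_batches [simp]: "finite (batches n b)"
  unfolding batches_def by (rule finite_subset[of _ "Pow {1..n}"]) auto

lemma card_batches: "card (batches n b) = n choose b"
  unfolding batches_def using n_subsets[of "{1..n}" b] by simp

lemma card_batches_containing:
  assumes "i \<in> {1..n}" "1 \<le> b"
  shows "card {B \<in> batches n b. i \<in> B} = (n - 1) choose (b - 1)"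
proof -
  let ?T = "{B. B \<subseteq> {1..n} - {i} \<and> card B = b - 1}"
  have "bij_betw (insert i) ?T {B \<in> batches n b. i \<in> B}"
  proof (rule bij_betw_byWitness[where f' = "\<lambda>B. B - {i}"])
    show "insert i ` ?T \<subseteq> {B \<in> batches n b. i \<in> B}"
    proof
      fix C assume "C \<in> insert i ` ?T"
      then obtain B where B: "B \<subseteq> {1..n} - {i}" "card B = b - 1" "C = insert i B" by blast
      have "finite B" using B(1) by (rule finite_subset) simp
      moreover have "i \<notin> B" using B(1) by blast
      ultimately have "card C = b" using B assms(2) by simp
      with B assms(1) show "C \<in> {B \<in> batches n b. i \<in> B}" unfolding batches_def by auto
    qed
    show "(\<lambda>B. B - {i}) ` {B \<in> batches n b. i \<in> B} \<subseteq> ?T"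
      unfolding batches_def by auto
  qed auto
  then have "card {B \<in> batches n b. i \<in> B} = card ?T" by (simp add: bij_betw_same_card)
  also have "\<dots> = card ({1..n} - {i}) choose (b - 1)" by (rule n_subsets) simp
  finally show ?thesis using assms(1) by simp
qed

text \<open>Each index lies in equally many batches, so the batch mean is an unbiased estimate of the mean.\<close>

lemma sum_batch_means:
  fixes u :: "nat \<Rightarrow> 'v::real_vector"
  assumes b: "1 \<le> b" "b \<le> n"
  shows "(\<Sum>B\<in>batches n b. (1 / real (card B)) *\<^sub>R (\<Sum>i\<in>B. u i)) =
    real (card (batches n b)) *\<^sub>R ((1 / real n) *\<^sub>R (\<Sum>i=1..n. u i))"
proof -
  have "(\<Sum>B\<in>batches n b. (1 / real (card B)) *\<^sub>R (\<Sum>i\<in>B. u i)) =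
      (\<Sum>B\<in>batches n b. (1 / real b) *\<^sub>R (\<Sum>i\<in>{i\<in>{1..n}. i \<in> B}. u i))"
  proof (rule sum.cong[OF refl])
    fix B assume "B \<in> batches n b"
    then have "card B = b" "{i\<in>{1..n}. i \<in> B} = B" unfolding batches_def by auto
    then show "(1 / real (card B)) *\<^sub>R (\<Sum>i\<in>B. u i) = (1 / real b) *\<^sub>R (\<Sum>i\<in>{i\<in>{1..n}. i \<in> B}. u i)"
      by simp
  qed
  also have "\<dots> = (1 / real b) *\<^sub>R (\<Sum>B\<in>batches n b. \<Sum>i\<in>{i\<in>{1..n}. i \<in> B}. u i)"
    by (simp add: scaleR_sum_right)
  also have "(\<Sum>B\<in>batches n b. \<Sum>i\<in>{i\<in>{1..n}. i \<in> B}. u i) =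
      (\<Sum>i\<in>{1..n}. \<Sum>B\<in>{B\<in>batches n b. i \<in> B}. u i)"
    by (rule sum.swap_restrict) simp_all
  also have "\<dots> = (\<Sum>i\<in>{1..n}. real ((n - 1) choose (b - 1)) *\<^sub>R u i)"
    using b by (intro sum.cong refl) (simp add: card_batches_containing sum_constant_scaleR)
  also have "\<dots> = real ((n - 1) choose (b - 1)) *\<^sub>R (\<Sum>i=1..n. u i)"
    by (simp add: scaleR_sum_right)
  also have "(1 / real b) *\<^sub>R \<dots> = real (card (batches n b)) *\<^sub>R ((1 / real n) *\<^sub>R (\<Sum>i=1..n. u i))"
  proof -
    have "b * (n choose b) = n * ((n - 1) choose (b - 1))"
      using b by (intro times_binomial_minus1_eq) simp
    then have "real b * real (n choose b) = real n * real ((n - 1) choose (b - 1))"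
      by (metis of_nat_mult)
    then have "1 / real b * real ((n - 1) choose (b - 1)) = real (n choose b) * (1 / real n)"
      using b by (simp add: field_simps)
    then show ?thesis by (simp add: card_batches)
  qed
  finally show ?thesis .
qed

text \<open>The new search direction as a function of the batch \<open>B\<close>, the point \<open>p0\<close> at the start of the epoch, the
previous and current points \<open>p1\<close>, \<open>p\<close> and the previous direction \<open>v\<close>. Separating the batch from the
data that the past determines is what allows averaging over the batch.\<close>

definition shg_direction ::
  "('m, 'e::euclidean_space) chart set \<Rightarrow> ('m, 'e) metric \<Rightarrow> ('m, 'e) retr \<Rightarrow> ('m, 'e) transp \<Rightarrow>
     real \<Rightarrow> nat \<Rightarrow> (nat \<Rightarrow> 'm \<Rightarrow> real) \<Rightarrow> real \<Rightarrow> real \<Rightarrow> real \<Rightarrow> nat set \<Rightarrow>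
     'm \<Rightarrow> 'm \<Rightarrow> 'm \<Rightarrow> ('m, 'e) tvec \<Rightarrow> ('m, 'e) tvec" where
  "shg_direction A g R T \<rho> n F \<mu> \<phi> \<psi> B p0 p1 p v =
     (let G = grad A g (avg_fun n F); tr = transport_to A g R T \<rho>;
          b = batch_grad A g F B;
          D = g p (tr p1 p (v - G p1)) (G p);
          \<psi>' = (if D \<noteq> 0 then min \<psi> (\<mu> * (rnorm g p (G p))\<^sup>2 / \<bar>D\<bar>) else \<psi>)
      in \<phi> *\<^sub>R (b p - tr p0 p (b p0 - G p0)) + \<psi>' *\<^sub>R (b p - tr p1 p (b p1 - v)) +
         (1 - \<phi> - \<psi>') *\<^sub>R b p)"

locale hybrid_gradient = riemannian_manifold A g
  for A :: "('m::{t2_space,second_countable_topology}, 'e::euclidean_space) chart set"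
    and g :: "('m, 'e) metric" +
  fixes R :: "('m, 'e) retr" and T :: "('m, 'e) transp" and \<rho> :: real and \<Omega> :: "'m set"
    and n b :: nat and F :: "nat \<Rightarrow> 'm \<Rightarrow> real" and \<mu> :: real
  assumes transport: "vector_transport A R T" and isometric: "isometric_transport A g R T"
    and diffeo: "\<And>p. p \<in> \<Omega> \<Longrightarrow> tangent_diffeo A p (tangent_ball A g p \<rho>) (R p)"
    and cover: "\<And>p. p \<in> \<Omega> \<Longrightarrow> \<Omega> \<subseteq> R p ` tangent_ball A g p \<rho>"
    and f_C2: "mfd_ck 2 A (avg_fun n F)"
    and F_C2: "\<And>i. i \<in> {1..n} \<Longrightarrow> mfd_ck 2 A (F i)"
    and batch_size: "1 \<le> b" "b \<le> n" and \<mu>: "0 < \<mu>" "\<mu> < 1"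
begin

abbreviation f :: "'m \<Rightarrow> real" where "f \<equiv> avg_fun n F"
abbreviation G :: "'m \<Rightarrow> ('m, 'e) tvec" where "G \<equiv> grad A g f"
abbreviation tr :: "'m \<Rightarrow> 'm \<Rightarrow> ('m, 'e) tvec \<Rightarrow> ('m, 'e) tvec" where
  "tr \<equiv> transport_to A g R T \<rho>"
abbreviation direction where "direction \<equiv> shg_direction A g R T \<rho> n F \<mu>"

lemma mfd_ck_Suc: "mfd_ck 2 A h \<Longrightarrow> mfd_ck (Suc (Suc 0)) A h"
  by (simp add: numeral_2_eq_2)

lemma G_in: "G p \<in> tangent_space A p"
  by (rule grad_in[OF mfd_ck_Suc[OF f_C2]])

lemma grad_F_in: "i \<in> {1..n} \<Longrightarrow> grad A g (F i) p \<in> tangent_space A p"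
  by (rule grad_in[OF mfd_ck_Suc[OF F_C2]])

lemma batch_grad_in: "B \<subseteq> {1..n} \<Longrightarrow> batch_grad A g F B p \<in> tangent_space A p"
  unfolding batch_grad_def by (intro tangent_space_scale tangent_space_sum grad_F_in) blast

lemma batches_subset: "B \<in> batches n b \<Longrightarrow> B \<subseteq> {1..n}"
  by (simp add: batches_def)

lemma sum_batch_grad:
  "(\<Sum>B\<in>batches n b. batch_grad A g F B p) = real (card (batches n b)) *\<^sub>R G p"
proof -
  have "G p = (1 / real n) *\<^sub>R (\<Sum>i=1..n. grad A g (F i) p)"
    by (rule grad_avg_fun[OF mfd_ck_Suc[OF f_C2]]) (rule mfd_ck_Suc[OF F_C2])
  then show ?thesis
    unfolding batch_grad_def by (simp only: sum_batch_means[OF batch_size])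
qed

lemma rnorm_batch_grad_le:
  assumes B: "B \<in> batches n b" and C: "\<And>i. i \<in> {1..n} \<Longrightarrow> rnorm g p (grad A g (F i) p) \<le> C"
  shows "rnorm g p (batch_grad A g F B p) \<le> C"
proof -
  have B': "B \<subseteq> {1..n}" "card B = b" using B by (auto simp: batches_def)
  have gr: "grad A g (F i) p \<in> tangent_space A p" if "i \<in> B" for i
    using that B'(1) by (intro grad_F_in) blast
  have bd: "rnorm g p (grad A g (F i) p) \<le> C" if "i \<in> B" for i
    using that B'(1) by (intro C) blast
  have "rnorm g p (\<Sum>i\<in>B. grad A g (F i) p) \<le> real (card B) * C"
    using gr bd by (rule rnorm_sum_le)
  then have "1 / real b * rnorm g p (\<Sum>i\<in>B. grad A g (F i) p) \<le> 1 / real b * (real b * C)"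
    unfolding B'(2) by (rule mult_left_mono) simp
  moreover have "(\<Sum>i\<in>B. grad A g (F i) p) \<in> tangent_space A p" using gr by (rule tangent_space_sum)
  ultimately show ?thesis
    unfolding batch_grad_def B'(2) using batch_size(1) by (simp add: rnorm_scale)
qed

text \<open>Inside \<open>\<Omega>\<close> the transport between two points is the transport along an actual tangent vector, so the
vector transport axioms and the isometry apply to it.\<close>

lemma transport_ray:
  assumes "p \<in> \<Omega>" "q \<in> \<Omega>"
  obtains \<eta> where "\<eta> \<in> tangent_space A p" "R p \<eta> = q" "tr p q = T p \<eta>"
proof
  let ?B = "tangent_ball A g p \<rho>"
  have inj: "inj_on (R p) ?B" using diffeo[OF assms(1)] by (simp add: tangent_diffeo_def)
  have q: "q \<in> R p ` ?B" using cover[OF assms(1)] assms(2) by blast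
  have "the_inv_into ?B (R p) q \<in> ?B" by (rule the_inv_into_into[OF inj q order_refl])
  then show "the_inv_into ?B (R p) q \<in> tangent_space A p" by (simp add: tangent_ball_def)
  show "R p (the_inv_into ?B (R p) q) = q" by (rule f_the_inv_into_f[OF inj q])
  show "tr p q = T p (the_inv_into ?B (R p) q)" by (rule ext) (simp add: transport_to_def)
qed

lemma
  assumes pq: "p \<in> \<Omega>" "q \<in> \<Omega>" and u: "u \<in> tangent_space A p" and v: "v \<in> tangent_space A p"
  shows tr_add: "tr p q (u + v) = tr p q u + tr p q v"
    and tr_isometry: "g q (tr p q u) (tr p q v) = g p u v"
proof -
  obtain \<eta> where \<eta>: "\<eta> \<in> tangent_space A p" "R p \<eta> = q" "tr p q = T p \<eta>"
    by (rule transport_ray[OF pq])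
  note V = conjunct1[OF transport[unfolded vector_transport_def], rule_format, OF \<eta>(1) u v]
  show "tr p q (u + v) = tr p q u + tr p q v" unfolding \<eta>(3) using V by blast
  show "g q (tr p q u) (tr p q v) = g p u v"
    unfolding \<eta>(3)
    using isometric[unfolded isometric_transport_def, rule_format, OF \<eta>(1) u v] unfolding \<eta>(2) .
qed

lemma
  assumes pq: "p \<in> \<Omega>" "q \<in> \<Omega>" and u: "u \<in> tangent_space A p"
  shows tr_in: "tr p q u \<in> tangent_space A q"
    and tr_scale: "tr p q (r *\<^sub>R u) = r *\<^sub>R tr p q u"
proof -
  obtain \<eta> where \<eta>: "\<eta> \<in> tangent_space A p" "R p \<eta> = q" "tr p q = T p \<eta>"
    by (rule transport_ray[OF pq])
  note V = conjunct1[OF transport[unfolded vector_transport_def], rule_format, OF \<eta>(1) u u]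
  show "tr p q u \<in> tangent_space A q" unfolding \<eta>(3) using V \<eta>(2) by blast
  show "tr p q (r *\<^sub>R u) = r *\<^sub>R tr p q u" unfolding \<eta>(3) using V by blast
qed

lemma tr_diff:
  assumes pq: "p \<in> \<Omega>" "q \<in> \<Omega>" and u: "u \<in> tangent_space A p" and v: "v \<in> tangent_space A p"
  shows "tr p q (u - v) = tr p q u - tr p q v"
  using tr_add[OF pq u tangent_space_neg[OF v]] tr_scale[OF pq v, of "- 1"] by simp

lemma tr_0: "p \<in> \<Omega> \<Longrightarrow> q \<in> \<Omega> \<Longrightarrow> tr p q 0 = 0"
  using tr_scale[of p q 0 0] tangent_space_0 by simp

lemma tr_sum:
  assumes pq: "p \<in> \<Omega>" "q \<in> \<Omega>" and u: "\<And>i. i \<in> S \<Longrightarrow> u i \<in> tangent_space A p"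
  shows "tr p q (\<Sum>i\<in>S. u i) = (\<Sum>i\<in>S. tr p q (u i))"
  using u
proof (induction S rule: infinite_finite_induct)
  case (insert i S)
  have ui: "u i \<in> tangent_space A p" by (rule insert.prems) (rule insertI1)
  have uj: "u j \<in> tangent_space A p" if "j \<in> S" for j by (rule insert.prems) (rule insertI2[OF that])
  have "tr p q (u i + sum u S) = tr p q (u i) + tr p q (sum u S)"
    by (rule tr_add[OF pq ui tangent_space_sum[OF uj]])
  also have "tr p q (sum u S) = (\<Sum>j\<in>S. tr p q (u j))" by (rule insert.IH[OF uj])
  finally show ?case unfolding sum.insert[OF insert.hyps] .
qed (simp_all add: tr_0 pq)

lemma rnorm_tr: "p \<in> \<Omega> \<Longrightarrow> q \<in> \<Omega> \<Longrightarrow> u \<in> tangent_space A p \<Longrightarrow> rnorm g q (tr p q u) = rnorm g p u"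
  unfolding rnorm_def by (simp add: tr_isometry)

definition damping :: "real \<Rightarrow> 'm \<Rightarrow> 'm \<Rightarrow> ('m, 'e) tvec \<Rightarrow> real" where
  "damping \<psi> p1 p v =
     (let D = g p (tr p1 p (v - G p1)) (G p)
      in if D \<noteq> 0 then min \<psi> (\<mu> * (rnorm g p (G p))\<^sup>2 / \<bar>D\<bar>) else \<psi>)"

lemma direction_eq:
  "direction \<phi> \<psi> B p0 p1 p v =
     \<phi> *\<^sub>R (batch_grad A g F B p - tr p0 p (batch_grad A g F B p0 - G p0)) +
     damping \<psi> p1 p v *\<^sub>R (batch_grad A g F B p - tr p1 p (batch_grad A g F B p1 - v)) +
     (1 - \<phi> - damping \<psi> p1 p v) *\<^sub>R batch_grad A g F B p"
  unfolding shg_direction_def damping_def Let_def ..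

lemma damping_bounds:
  assumes "0 \<le> \<psi>"
  shows "0 \<le> damping \<psi> p1 p v" "damping \<psi> p1 p v \<le> \<psi>"
    and "- (\<mu> * (rnorm g p (G p))\<^sup>2) \<le> damping \<psi> p1 p v * g p (tr p1 p (v - G p1)) (G p)"
proof -
  define D where "D = g p (tr p1 p (v - G p1)) (G p)"
  define a where "a = \<mu> * (rnorm g p (G p))\<^sup>2"
  have a: "0 \<le> a" unfolding a_def using \<mu> by simp
  have d: "damping \<psi> p1 p v = (if D \<noteq> 0 then min \<psi> (a / \<bar>D\<bar>) else \<psi>)"
    unfolding damping_def D_def a_def Let_def ..
  show nonneg: "0 \<le> damping \<psi> p1 p v" and "damping \<psi> p1 p v \<le> \<psi>"
    unfolding d using assms a by auto
  have "damping \<psi> p1 p v * \<bar>D\<bar> \<le> a"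
  proof (cases "D = 0")
    case False
    then have "damping \<psi> p1 p v * \<bar>D\<bar> \<le> a / \<bar>D\<bar> * \<bar>D\<bar>" unfolding d by (intro mult_right_mono) auto
    then show ?thesis using False by simp
  qed (simp add: a)
  moreover have "- (damping \<psi> p1 p v * \<bar>D\<bar>) \<le> damping \<psi> p1 p v * D"
    using mult_left_mono[OF _ nonneg, of "- \<bar>D\<bar>" D] by simp
  ultimately show "- (\<mu> * (rnorm g p (G p))\<^sup>2) \<le> damping \<psi> p1 p v * g p (tr p1 p (v - G p1)) (G p)"
    unfolding D_def a_def by linarith
qed

context
  fixes p0 p1 p :: 'm and v :: "('m, 'e) tvec"
  assumes pts: "p0 \<in> \<Omega>" "p1 \<in> \<Omega>" "p \<in> \<Omega>" and v: "v \<in> tangent_space A p1"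
begin

lemma correction_in:
  assumes "B \<in> batches n b"
  shows "batch_grad A g F B p - tr p0 p (batch_grad A g F B p0 - G p0) \<in> tangent_space A p"
    "batch_grad A g F B p - tr p1 p (batch_grad A g F B p1 - v) \<in> tangent_space A p"
  by (intro tangent_space_diff tr_in pts batch_grad_in batches_subset[OF assms] G_in v)+

lemma direction_in:
  assumes "B \<in> batches n b" shows "direction \<phi> \<psi> B p0 p1 p v \<in> tangent_space A p"
  unfolding direction_eq
  by (intro tangent_space_add tangent_space_scale correction_in[OF assms]
      batch_grad_in[OF batches_subset[OF assms]])

text \<open>The direction is a convex combination of three vectors. Transports preserve norms, so the first and
the third have norm at most \<open>3 C\<close>; only the second one involves the previous direction, whose norm
enters once.\<close>

lemma rnorm_direction_le:
  assumes B: "B \<in> batches n b" and \<phi>\<psi>: "0 \<le> \<phi>" "0 \<le> \<psi>" "\<phi> + \<psi> \<le> 1"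
    and C: "\<And>i q. i \<in> {1..n} \<Longrightarrow> q \<in> \<Omega> \<Longrightarrow> rnorm g q (grad A g (F i) q) \<le> C"
    and CG: "\<And>q. q \<in> \<Omega> \<Longrightarrow> rnorm g q (G q) \<le> C"
  shows "rnorm g p (direction \<phi> \<psi> B p0 p1 p v) \<le> 3 * C + rnorm g p1 v"
proof -
  let ?b = "batch_grad A g F B"
  have b_in: "?b q \<in> tangent_space A q" for q by (rule batch_grad_in[OF batches_subset[OF B]])
  have b_le: "rnorm g q (?b q) \<le> C" if "q \<in> \<Omega>" for q
    using B C[OF _ that] by (rule rnorm_batch_grad_le)
  have C0: "0 \<le> C" using CG[OF pts(3)] rnorm_nonneg[OF G_in[of p]] by linarith
  have v0: "0 \<le> rnorm g p1 v" by (rule rnorm_nonneg[OF v])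
  define d where "d = damping \<psi> p1 p v"
  have d: "0 \<le> d" "\<phi> + d \<le> 1" unfolding d_def using damping_bounds[OF \<phi>\<psi>(2), of p1 p v] \<phi>\<psi>(3) by linarith+
  let ?x = "?b p - tr p0 p (?b p0 - G p0)" and ?y = "?b p - tr p1 p (?b p1 - v)"
  note xy = correction_in[OF B]
  have x: "rnorm g p ?x \<le> 3 * C"
  proof -
    have "rnorm g p ?x \<le> rnorm g p (?b p) + rnorm g p (tr p0 p (?b p0 - G p0))"
      by (intro rnorm_diff tr_in pts tangent_space_diff b_in G_in)
    also have "rnorm g p (tr p0 p (?b p0 - G p0)) = rnorm g p0 (?b p0 - G p0)"
      by (intro rnorm_tr pts tangent_space_diff b_in G_in)
    also have "\<dots> \<le> rnorm g p0 (?b p0) + rnorm g p0 (G p0)" by (intro rnorm_diff b_in G_in)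
    finally show ?thesis using b_le[OF pts(3)] b_le[OF pts(1)] CG[OF pts(1)] by linarith
  qed
  have y: "rnorm g p ?y \<le> 3 * C + rnorm g p1 v"
  proof -
    have "rnorm g p ?y \<le> rnorm g p (?b p) + rnorm g p (tr p1 p (?b p1 - v))"
      by (intro rnorm_diff tr_in pts tangent_space_diff b_in v)
    also have "rnorm g p (tr p1 p (?b p1 - v)) = rnorm g p1 (?b p1 - v)"
      by (intro rnorm_tr pts tangent_space_diff b_in v)
    also have "\<dots> \<le> rnorm g p1 (?b p1) + rnorm g p1 v" by (intro rnorm_diff b_in v)
    finally show ?thesis using b_le[OF pts(3)] b_le[OF pts(2)] C0 by linarith
  qed
  have tri: "rnorm g p (direction \<phi> \<psi> B p0 p1 p v) \<le>
      rnorm g p (\<phi> *\<^sub>R ?x + d *\<^sub>R ?y) + rnorm g p ((1 - \<phi> - d) *\<^sub>R ?b p)"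
    unfolding direction_eq d_def
    by (intro rnorm_triangle tangent_space_add tangent_space_scale xy b_in)
  have tri': "rnorm g p (\<phi> *\<^sub>R ?x + d *\<^sub>R ?y) \<le> rnorm g p (\<phi> *\<^sub>R ?x) + rnorm g p (d *\<^sub>R ?y)"
    by (intro rnorm_triangle tangent_space_scale xy)
  have "\<bar>\<phi>\<bar> = \<phi>" "\<bar>d\<bar> = d" "\<bar>1 - \<phi> - d\<bar> = 1 - \<phi> - d" using \<phi>\<psi>(1) d by simp_all
  then have "rnorm g p (direction \<phi> \<psi> B p0 p1 p v)
      \<le> \<phi> * rnorm g p ?x + d * rnorm g p ?y + (1 - \<phi> - d) * rnorm g p (?b p)"
    using tri tri' unfolding rnorm_scale[OF xy(1)] rnorm_scale[OF xy(2)] rnorm_scale[OF b_in]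
    by linarith
  also have "\<dots> \<le> \<phi> * (3 * C + rnorm g p1 v) + d * (3 * C + rnorm g p1 v)
      + (1 - \<phi> - d) * (3 * C + rnorm g p1 v)"
    using x y b_le[OF pts(3)] C0 v0 \<phi>\<psi>(1) d
    by (intro add_mono mult_left_mono) linarith+
  also have "\<dots> = 3 * C + rnorm g p1 v" by (simp add: algebra_simps)
  finally show ?thesis .
qed

lemma sum_metric_transported_batch_grad:
  assumes q: "q \<in> \<Omega>" and w: "w \<in> tangent_space A p"
  shows "(\<Sum>B\<in>batches n b. g p w (tr q p (batch_grad A g F B q))) =
    real (card (batches n b)) * g p w (tr q p (G q))"
proof -
  have bq: "batch_grad A g F B q \<in> tangent_space A q" if "B \<in> batches n b" for B
    by (rule batch_grad_in[OF batches_subset[OF that]])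
  have "(\<Sum>B\<in>batches n b. g p w (tr q p (batch_grad A g F B q))) =
      g p w (\<Sum>B\<in>batches n b. tr q p (batch_grad A g F B q))"
    by (rule metric_sum_right[OF w, symmetric]) (rule tr_in[OF q pts(3) bq])
  also have "(\<Sum>B\<in>batches n b. tr q p (batch_grad A g F B q)) =
      tr q p (\<Sum>B\<in>batches n b. batch_grad A g F B q)"
    by (rule tr_sum[OF q pts(3) bq, symmetric])
  also have "\<dots> = real (card (batches n b)) *\<^sub>R tr q p (G q)"
    unfolding sum_batch_grad by (rule tr_scale[OF q pts(3) G_in])
  also have "g p w \<dots> = real (card (batches n b)) * g p w (tr q p (G q))"
    by (rule metric_scale_right[OF w tr_in[OF q pts(3) G_in]])
  finally show ?thesis .
qed

text \<open>Averaged over all batches, the vector corrected at \<open>p0\<close> is \<open>G p\<close>, and the one corrected at \<open>p1\<close> is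
\<open>G p + tr p1 p (v - G p1)\<close>. The mean direction is thus \<open>G p\<close> plus the damped transported term, whose
inner product with \<open>G p\<close> is at least \<open>- \<mu> \<parallel>G p\<parallel>\<^sup>2\<close> by the choice of the damping factor, which depends on the past but not on the
batch.\<close>

lemma sum_metric_direction_ge:
  assumes \<psi>: "0 \<le> \<psi>"
  shows "real (card (batches n b)) * ((1 - \<mu>) * (rnorm g p (G p))\<^sup>2) \<le>
    (\<Sum>B\<in>batches n b. g p (G p) (direction \<phi> \<psi> B p0 p1 p v))"
proof -
  let ?N = "real (card (batches n b))"
  define d where "d = damping \<psi> p1 p v"
  define \<beta> where "\<beta> = (\<lambda>B. g p (G p) (batch_grad A g F B p))"
  define \<beta>0 where "\<beta>0 = (\<lambda>B. g p (G p) (tr p0 p (batch_grad A g F B p0)))"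
  define \<beta>1 where "\<beta>1 = (\<lambda>B. g p (G p) (tr p1 p (batch_grad A g F B p1)))"
  define \<kappa>0 where "\<kappa>0 = g p (G p) (tr p0 p (G p0))"
  define \<kappa>1 where "\<kappa>1 = g p (G p) (tr p1 p (G p1))"
  define \<nu> where "\<nu> = g p (G p) (tr p1 p v)"
  define X where "X = (rnorm g p (G p))\<^sup>2"
  note Gp = G_in[of p]
  have eq: "g p (G p) (direction \<phi> \<psi> B p0 p1 p v) =
      \<beta> B - \<phi> * (\<beta>0 B - \<kappa>0) - d * (\<beta>1 B - \<nu>)" if B: "B \<in> batches n b" for B
  proof -
    have bq: "batch_grad A g F B q \<in> tangent_space A q" for q
      by (rule batch_grad_in[OF batches_subset[OF B]])
    note xy = correction_in[OF B]
    let ?x = "batch_grad A g F B p - tr p0 p (batch_grad A g F B p0 - G p0)"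
      and ?y = "batch_grad A g F B p - tr p1 p (batch_grad A g F B p1 - v)"
    have "g p (G p) (direction \<phi> \<psi> B p0 p1 p v) =
        g p (G p) (\<phi> *\<^sub>R ?x + d *\<^sub>R ?y) + g p (G p) ((1 - \<phi> - d) *\<^sub>R batch_grad A g F B p)"
      unfolding direction_eq d_def
      by (intro metric_add_right tangent_space_add tangent_space_scale xy bq Gp)
    also have "g p (G p) (\<phi> *\<^sub>R ?x + d *\<^sub>R ?y) = g p (G p) (\<phi> *\<^sub>R ?x) + g p (G p) (d *\<^sub>R ?y)"
      by (intro metric_add_right tangent_space_scale xy Gp)
    also have "g p (G p) (\<phi> *\<^sub>R ?x) = \<phi> * g p (G p) ?x" by (rule metric_scale_right[OF Gp xy(1)])
    also have "g p (G p) (d *\<^sub>R ?y) = d * g p (G p) ?y" by (rule metric_scale_right[OF Gp xy(2)])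
    also have "g p (G p) ((1 - \<phi> - d) *\<^sub>R batch_grad A g F B p) = (1 - \<phi> - d) * \<beta> B"
      unfolding \<beta>_def by (rule metric_scale_right[OF Gp bq])
    also have "g p (G p) ?x = \<beta> B - g p (G p) (tr p0 p (batch_grad A g F B p0 - G p0))"
      unfolding \<beta>_def by (intro metric_diff_right tr_in pts tangent_space_diff bq G_in)
    also have "g p (G p) (tr p0 p (batch_grad A g F B p0 - G p0)) = \<beta>0 B - \<kappa>0"
      unfolding \<beta>0_def \<kappa>0_def tr_diff[OF pts(1,3) bq G_in]
      by (intro metric_diff_right tr_in pts bq G_in)
    also have "g p (G p) ?y = \<beta> B - g p (G p) (tr p1 p (batch_grad A g F B p1 - v))"
      unfolding \<beta>_def by (intro metric_diff_right tr_in pts tangent_space_diff bq G_in v)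
    also have "g p (G p) (tr p1 p (batch_grad A g F B p1 - v)) = \<beta>1 B - \<nu>"
      unfolding \<beta>1_def \<nu>_def tr_diff[OF pts(2,3) bq v]
      by (intro metric_diff_right tr_in pts bq G_in v)
    finally show ?thesis by (simp add: algebra_simps)
  qed
  have bp: "batch_grad A g F B p \<in> tangent_space A p" if "B \<in> batches n b" for B
    by (rule batch_grad_in[OF batches_subset[OF that]])
  have "(\<Sum>B\<in>batches n b. \<beta> B) = g p (G p) (?N *\<^sub>R G p)"
    unfolding \<beta>_def sum_batch_grad[symmetric] by (rule metric_sum_right[OF Gp bp, symmetric])
  also have "\<dots> = ?N * X" unfolding metric_scale_right[OF Gp Gp] X_def rnorm_sq[OF Gp] ..
  finally have s: "(\<Sum>B\<in>batches n b. \<beta> B) = ?N * X" .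
  have s0: "(\<Sum>B\<in>batches n b. \<beta>0 B) = ?N * \<kappa>0"
    unfolding \<beta>0_def \<kappa>0_def by (rule sum_metric_transported_batch_grad[OF pts(1) Gp])
  have s1: "(\<Sum>B\<in>batches n b. \<beta>1 B) = ?N * \<kappa>1"
    unfolding \<beta>1_def \<kappa>1_def by (rule sum_metric_transported_batch_grad[OF pts(2) Gp])
  have "(\<Sum>B\<in>batches n b. g p (G p) (direction \<phi> \<psi> B p0 p1 p v)) =
      (\<Sum>B\<in>batches n b. \<beta> B - \<phi> * (\<beta>0 B - \<kappa>0) - d * (\<beta>1 B - \<nu>))"
    by (rule sum.cong[OF refl eq])
  also have "\<dots> = (\<Sum>B\<in>batches n b. \<beta> B) - \<phi> * ((\<Sum>B\<in>batches n b. \<beta>0 B) - ?N * \<kappa>0)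
      - d * ((\<Sum>B\<in>batches n b. \<beta>1 B) - ?N * \<nu>)"
    by (simp add: sum_subtractf flip: sum_distrib_left)
  also have "\<dots> = ?N * (X + d * (\<nu> - \<kappa>1))" unfolding s s0 s1 by (simp add: algebra_simps)
  finally have sum_eq: "(\<Sum>B\<in>batches n b. g p (G p) (direction \<phi> \<psi> B p0 p1 p v)) =
      ?N * (X + d * (\<nu> - \<kappa>1))" .
  have "g p (tr p1 p (v - G p1)) (G p) = g p (G p) (tr p1 p v - tr p1 p (G p1))"
    unfolding tr_diff[OF pts(2,3) v G_in]
    by (intro metric_sym tangent_space_diff tr_in pts v G_in)
  also have "\<dots> = \<nu> - \<kappa>1"
    unfolding \<nu>_def \<kappa>1_def by (intro metric_diff_right tr_in pts v G_in)
  finally have "- (\<mu> * X) \<le> d * (\<nu> - \<kappa>1)"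
    using damping_bounds(3)[OF \<psi>, of p p1 v] unfolding d_def X_def by simp
  then have "?N * ((1 - \<mu>) * X) \<le> ?N * (X + d * (\<nu> - \<kappa>1))"
    by (intro mult_left_mono) (simp_all add: algebra_simps)
  then show ?thesis unfolding sum_eq X_def .
qed

end

end

section \<open>Convergence of the algorithm\<close>

lemma sum_nested_as_flat:
  fixes h :: "nat \<Rightarrow> nat \<Rightarrow> real"
  assumes m: "1 \<le> m"
  shows "(\<Sum>k<N * m. h (k div m + 1) (k mod m)) = (\<Sum>s=1..N. \<Sum>t<m. h s t)"
proof (induction N)
  case (Suc N)
  let ?h = "\<lambda>k. h (k div m + 1) (k mod m)"
  have "(\<Sum>k<Suc N * m. ?h k) = (\<Sum>k<N * m. ?h k) + (\<Sum>k=0 + N * m..<m + N * m. ?h k)"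
    using sum.atLeastLessThan_concat[of 0 "N * m" "m + N * m" ?h] by (simp add: lessThan_atLeast0)
  also have "(\<Sum>k=0 + N * m..<m + N * m. ?h k) = (\<Sum>t<m. ?h (t + N * m))"
    unfolding sum.shift_bounds_nat_ivl by (simp add: lessThan_atLeast0)
  also have "\<dots> = (\<Sum>t<m. h (Suc N) t)" using m by (intro sum.cong) auto
  finally show ?case using Suc.IH by simp
qed simp

context hybrid_gradient
begin

text \<open>A run with iterates numbered consecutively through all epochs, which turns nested inductions into plain
ones. Step \<open>k\<close> belongs to the epoch that starts at \<open>k - k mod m\<close>, and the multiples of \<open>m\<close> are the
restarts, where the direction is the full gradient.\<close>

definition flat_run ::
  "nat \<Rightarrow> (nat \<Rightarrow> real) \<Rightarrow> (nat \<Rightarrow> real) \<Rightarrow> (nat \<Rightarrow> real) \<Rightarrow> 'm \<Rightarrow> (nat \<Rightarrow> nat set) \<Rightarrow>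
     (nat \<Rightarrow> 'm) \<Rightarrow> (nat \<Rightarrow> ('m, 'e) tvec) \<Rightarrow> bool" where
  "flat_run m \<alpha> \<phi> \<psi> start I W V \<longleftrightarrow>
     W 0 = start \<and>
     (\<forall>k. W (Suc k) = R (W k) (- (\<alpha> k *\<^sub>R V k)) \<and>
        V k = (if m dvd k then G (W k)
               else direction (\<phi> k) (\<psi> k) (I k) (W (k - k mod m)) (W (k - 1)) (W k) (V (k - 1))))"

lemma flat_run_of_rshg_run:
  assumes run: "rshg_run A g R T \<rho> n F m \<mu> \<alpha> \<phi> \<psi> start I w V" and m: "1 \<le> m"
  shows "flat_run m (\<lambda>k. \<alpha> (k div m + 1) (k mod m)) (\<lambda>k. \<phi> (k div m + 1) (k mod m))
    (\<lambda>k. \<psi> (k div m + 1) (k mod m)) start (\<lambda>k. I (k div m + 1) (k mod m))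
    (\<lambda>k. w (k div m + 1) (k mod m)) (\<lambda>k. V (k div m + 1) (k mod m))"
proof -
  have init: "w 1 0 = start" using run unfolding rshg_run_def Let_def by blast
  have restart: "w (Suc s) 0 = w s m" and V0: "V s 0 = G (w s 0)" if "1 \<le> s" for s
    using run that unfolding rshg_run_def Let_def by blast+
  have step: "w s (Suc t) = R (w s t) (- (\<alpha> s t *\<^sub>R V s t))" if "1 \<le> s" "t < m" for s t
    using run that unfolding rshg_run_def Let_def by blast
  have Vt: "V s t = direction (\<phi> s t) (\<psi> s t) (I s t) (w s 0) (w s (t - 1)) (w s t) (V s (t - 1))"
    if "1 \<le> s" "t \<in> {1..<m}" for s t
    unfolding shg_direction_def
    using run that unfolding rshg_run_def Let_def by blast
  show ?thesis
    unfolding flat_run_def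
  proof (intro conjI allI)
    fix k
    let ?s = "k div m + 1" and ?t = "k mod m"
    have t: "?t < m" using m by simp
    show "w (Suc k div m + 1) (Suc k mod m) = R (w ?s ?t) (- (\<alpha> ?s ?t *\<^sub>R V ?s ?t))"
    proof (cases "Suc ?t = m")
      case True
      \<comment> \<open>The last point of an epoch is the first point of the next one.\<close>
      then have "Suc k div m = ?s" "Suc k mod m = 0" by (simp_all add: div_Suc mod_Suc)
      then show ?thesis using restart[of ?s] step[of ?s ?t] True t by simp
    next
      case False
      then have "Suc k div m = k div m" "Suc k mod m = Suc ?t" by (simp_all add: div_Suc mod_Suc)
      then show ?thesis using step[of ?s ?t] t by simp
    qed
    show "V ?s ?t = (if m dvd k then G (w ?s ?t) else
        direction (\<phi> ?s ?t) (\<psi> ?s ?t) (I ?s ?t)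
          (w ((k - ?t) div m + 1) ((k - ?t) mod m)) (w ((k - 1) div m + 1) ((k - 1) mod m))
          (w ?s ?t) (V ((k - 1) div m + 1) ((k - 1) mod m)))"
    proof (cases "m dvd k")
      case True
      then have "?t = 0" by simp
      then show ?thesis using V0[of ?s] True by simp
    next
      case False
      then have t1: "1 \<le> ?t" by (simp add: dvd_eq_mod_eq_0)
      have k: "k = m * (k div m) + ?t" by simp
      have anchor: "(k - ?t) div m = k div m" "(k - ?t) mod m = 0"
        using m by (simp_all add: minus_mod_eq_mult_div)
      have "k - 1 = m * (k div m) + (?t - 1)" using k t1 by linarith
      moreover have "?t - 1 < m" using t by linarith
      ultimately have prev: "(k - 1) div m = k div m" "(k - 1) mod m = ?t - 1"
        by (metis div_mult_self4 div_less add.right_neutral not_one_le_zero m,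
            metis mod_mult_self4 mod_less add.commute)
      show ?thesis using False Vt[of ?s ?t] t t1 unfolding anchor prev by simp
    qed
  qed (use init in simp)
qed

text \<open>Strong induction, since \<open>V k\<close> refers back to the start of the epoch. A batch drawn at time \<open>k\<close> influences
the direction at once but the points only from \<open>k + 1\<close> on, so it is fresh relative to \<open>W k\<close>.\<close>

lemma flat_run_determined:
  assumes run: "\<And>x. x \<in> U \<Longrightarrow>
    flat_run m \<alpha> \<phi> \<psi> start (\<lambda>k. I k x) (\<lambda>k. W k x) (\<lambda>k. V k x)"
  shows "determined_by U I {j. j < k \<and> \<not> m dvd j} (W k)"
    and "determined_by U I {j. j < Suc k \<and> \<not> m dvd j} (V k)"
proof -
  have "\<forall>x\<in>U. \<forall>y\<in>U.
      ((\<forall>j. j < k \<longrightarrow> \<not> m dvd j \<longrightarrow> I j x = I j y) \<longrightarrow> W k x = W k y) \<and>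
      ((\<forall>j. j < Suc k \<longrightarrow> \<not> m dvd j \<longrightarrow> I j x = I j y) \<longrightarrow> V k x = V k y)"
  proof (induction k rule: less_induct)
    case (less k)
    show ?case
    proof (intro ballI)
      fix x y assume x: "x \<in> U" and y: "y \<in> U"
      note rx = run[OF x, unfolded flat_run_def] and ry = run[OF y, unfolded flat_run_def]
      have IH: "W i x = W i y" "V i x = V i y"
        if i: "i < k" and eq: "\<And>j. j < k \<Longrightarrow> \<not> m dvd j \<Longrightarrow> I j x = I j y" for i
      proof -
        note c = bspec[OF bspec[OF less.IH[OF i] x] y]
        show "W i x = W i y" by (rule mp[OF conjunct1[OF c]]) (use i in \<open>simp add: eq\<close>)
        show "V i x = V i y" by (rule mp[OF conjunct2[OF c]]) (use i in \<open>simp add: eq\<close>)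
      qed
      have Wk: "W k x = W k y" if "\<forall>j. j < k \<longrightarrow> \<not> m dvd j \<longrightarrow> I j x = I j y"
      proof (cases k)
        case 0
        then show ?thesis using rx ry by simp
      next
        case (Suc i)
        then have "W i x = W i y" "V i x = V i y" using IH[of i] that by simp_all
        moreover have "W k x = R (W i x) (- (\<alpha> i *\<^sub>R V i x))" "W k y = R (W i y) (- (\<alpha> i *\<^sub>R V i y))"
          using rx ry unfolding Suc by blast+
        ultimately show ?thesis by simp
      qed
      have Vk: "V k x = V k y" if eq: "\<forall>j. j < Suc k \<longrightarrow> \<not> m dvd j \<longrightarrow> I j x = I j y"
      proof -
        have wk: "W k x = W k y" using eq by (intro Wk) simp
        show ?thesis
        proof (cases "m dvd k")
          case True
          then have "V k x = G (W k x)" "V k y = G (W k y)" using rx ry by simp_all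
          then show ?thesis using wk by simp
        next
          case False
          then have k: "0 < k" and km: "0 < k mod m" by (auto intro: gr0I simp: dvd_eq_mod_eq_0)
          have "W i x = W i y" "V i x = V i y" if "i < k" for i
            using IH[OF that] eq by simp_all
          then have "W (k - k mod m) x = W (k - k mod m) y" "W (k - 1) x = W (k - 1) y"
            "V (k - 1) x = V (k - 1) y" using k km by simp_all
          moreover have "I k x = I k y" using eq False by blast
          moreover have "V k z = direction (\<phi> k) (\<psi> k) (I k z) (W (k - k mod m) z) (W (k - 1) z)
              (W k z) (V (k - 1) z)" if "z \<in> U" for z
            using run[OF that] False unfolding flat_run_def by simp
          ultimately show ?thesis using wk x y by simp
        qed
      qed
      show "((\<forall>j. j < k \<longrightarrow> \<not> m dvd j \<longrightarrow> I j x = I j y) \<longrightarrow> W k x = W k y) \<and>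
        ((\<forall>j. j < Suc k \<longrightarrow> \<not> m dvd j \<longrightarrow> I j x = I j y) \<longrightarrow> V k x = V k y)"
        using Wk Vk by blast
    qed
  qed
  then show "determined_by U I {j. j < k \<and> \<not> m dvd j} (W k)"
    and "determined_by U I {j. j < Suc k \<and> \<not> m dvd j} (V k)"
    unfolding determined_by_def by blast+
qed

text \<open>Each update adds at most \<open>3 C\<close> to the norm, and the restarts reset it to at most \<open>C\<close>.\<close>

lemma flat_run_bounded:
  assumes run: "flat_run m \<alpha> \<phi> \<psi> start I W V" and m: "1 \<le> m" and W: "\<And>k. W k \<in> \<Omega>"
    and I: "\<And>k. \<not> m dvd k \<Longrightarrow> I k \<in> batches n b"
    and \<phi>\<psi>: "\<And>k. \<not> m dvd k \<Longrightarrow> 0 \<le> \<phi> k \<and> 0 \<le> \<psi> k \<and> \<phi> k + \<psi> k \<le> 1"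
    and C: "\<And>i q. i \<in> {1..n} \<Longrightarrow> q \<in> \<Omega> \<Longrightarrow> rnorm g q (grad A g (F i) q) \<le> C"
    and CG: "\<And>q. q \<in> \<Omega> \<Longrightarrow> rnorm g q (G q) \<le> C"
  shows "V k \<in> tangent_space A (W k)" "rnorm g (W k) (V k) \<le> C + 3 * C * real m"
proof -
  have C0: "0 \<le> C" using CG[OF W[of 0]] rnorm_nonneg[OF G_in[of "W 0"]] by linarith
  have *: "V k \<in> tangent_space A (W k) \<and> rnorm g (W k) (V k) \<le> C + 3 * C * real (k mod m)"
  proof (induction k)
    case 0
    have "V 0 = G (W 0)" using run unfolding flat_run_def by simp
    then show ?case using G_in CG[OF W[of 0]] by simp
  next
    case (Suc k)
    let ?k = "Suc k"
    show ?case
    proof (cases "m dvd ?k")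
      case True
      then have "V ?k = G (W ?k)" using run unfolding flat_run_def by simp
      then show ?thesis using G_in CG[OF W[of ?k]] True by simp
    next
      case False
      have V: "V ?k = direction (\<phi> ?k) (\<psi> ?k) (I ?k) (W (?k - ?k mod m)) (W k) (W ?k) (V k)"
        using run False unfolding flat_run_def by simp
      have mod: "?k mod m = Suc (k mod m)" using False by (auto simp: mod_Suc dvd_eq_mod_eq_0 split: if_splits)
      have 1: "V ?k \<in> tangent_space A (W ?k)"
        unfolding V using Suc.IH by (intro direction_in W I[OF False]) blast
      have "rnorm g (W ?k) (V ?k) \<le> 3 * C + rnorm g (W k) (V k)"
        unfolding V using Suc.IH \<phi>\<psi>[OF False]
        by (intro rnorm_direction_le W I[OF False] C CG) auto
      also have "\<dots> \<le> 3 * C + (C + 3 * C * real (k mod m))" using Suc.IH by simp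
      also have "\<dots> = C + 3 * C * real (?k mod m)" unfolding mod by (simp add: algebra_simps)
      finally show ?thesis using 1 by blast
    qed
  qed
  then show "V k \<in> tangent_space A (W k)" by blast
  have "3 * C * real (k mod m) \<le> 3 * C * real m"
    using C0 m by (intro mult_left_mono) (auto intro: less_imp_le)
  with * show "rnorm g (W k) (V k) \<le> C + 3 * C * real m" by linarith
qed

text \<open>The descent inequality and the Lipschitz bound hold along almost every path once the steps are short.
Taking expectations, with the mean descent \<open>inn_ge\<close> from averaging over the current batch, reduces the
claim to the two lemmas on real sequences.\<close>

theorem flat_run_expected_grad_sq_tendsto_0:
  fixes M :: "'a measure" and I :: "nat \<Rightarrow> 'a \<Rightarrow> nat set"
    and W :: "nat \<Rightarrow> 'a \<Rightarrow> 'm" and V :: "nat \<Rightarrow> 'a \<Rightarrow> ('m, 'e) tvec"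
  assumes M: "prob_space M" and m: "1 \<le> m" and \<alpha>: "\<And>k. 0 < \<alpha> k"
    and \<phi>\<psi>: "\<And>k. \<not> m dvd k \<Longrightarrow> 0 \<le> \<phi> k \<and> 0 \<le> \<psi> k \<and> \<phi> k + \<psi> k \<le> 1"
    and run: "\<And>x. x \<in> space M \<Longrightarrow>
      flat_run m \<alpha> \<phi> \<psi> start (\<lambda>k. I k x) (\<lambda>k. W k x) (\<lambda>k. V k x)"
    and I: "\<And>k x. \<not> m dvd k \<Longrightarrow> x \<in> space M \<Longrightarrow> I k x \<in> batches n b"
    and indep: "prob_space.indep_vars M (\<lambda>_. count_space UNIV) I {k. \<not> m dvd k}"
    and uniform: "\<And>k B. \<not> m dvd k \<Longrightarrow> B \<in> batches n b \<Longrightarrow>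
      measure M (I k -` {B} \<inter> space M) = 1 / real (card (batches n b))"
    and bounded_below: "\<And>p. fmin \<le> f p"
    and R: "smooth_retraction A R" and \<Omega>: "compact \<Omega>"
    and iterates: "AE x in M. \<forall>k. W k x \<in> \<Omega>"
    and diverge: "filterlim (\<lambda>N. \<Sum>k<N. \<alpha> k) at_top sequentially"
    and square: "summable (\<lambda>k. (\<alpha> k)\<^sup>2)"
  shows "(\<lambda>k. prob_space.expectation M (\<lambda>x. grad_sq f (W k x))) \<longlonglongrightarrow> 0"
proof -
  interpret M: prob_space M by (rule M)
  let ?S = "batches n b" and ?J = "\<lambda>k. {j. j < k \<and> \<not> m dvd j}"
  let ?N = "real (card (batches n b))"
  have N: "0 < ?N" using batch_size by (simp add: card_batches zero_less_binomial)
  have rv: "M.random_variable (count_space UNIV) (I j)" if "\<not> m dvd j" for j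
    using indep that unfolding M.indep_vars_def by blast
  have detW: "determined_by (space M) I (?J k) (W k)" for k by (rule flat_run_determined(1)[OF run])
  have detV: "determined_by (space M) I (?J (Suc k)) (V k)" for k
    by (rule flat_run_determined(2)[OF run])
  have detW': "determined_by (space M) I (?J k) (W j)" if "j \<le> k" for j k
    using detW[of j] by (rule determined_by_mono) (use that in auto)
  have detV': "determined_by (space M) I (?J k) (V j)" if "j < k" for j k
    using detV[of j] by (rule determined_by_mono) (use that in auto)
  have int: "integrable M Y" if "determined_by (space M) I (?J k) Y" for k and Y :: "'a \<Rightarrow> real"
    by (rule M.integrable_determined_by[OF that, of ?S]) (simp_all add: I rv)
  have intW: "integrable M (\<lambda>x. h (W k x))" for h :: "'m \<Rightarrow> real" and k
    by (rule int[OF determined_by_comp[OF detW]])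
  define inn where "inn = (\<lambda>k x. g (W k x) (G (W k x)) (V k x))"
  have int_inn: "integrable M (inn k)" for k
  proof -
    have "determined_by (space M) I (?J (Suc k)) (\<lambda>x. (W k x, V k x))"
      by (intro determined_by_Pair detW' detV) simp
    from determined_by_comp[OF this, of "\<lambda>(p, v). g p (G p) v"]
    show ?thesis unfolding inn_def by (intro int[of "Suc k"]) simp
  qed
  \<comment> \<open>One bound for the gradients of \<open>f\<close> and of all its summands.\<close>
  obtain CF where CF: "\<And>i q. i \<in> {1..n} \<Longrightarrow> q \<in> \<Omega> \<Longrightarrow> rnorm g q (grad A g (F i) q) \<le> CF i"
    using grad_bounded_on_compact[OF F_C2 \<Omega>] by metis
  obtain C0 where C0: "\<And>q. q \<in> \<Omega> \<Longrightarrow> rnorm g q (G q) \<le> C0"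
    using grad_bounded_on_compact[OF f_C2 \<Omega>] by blast
  define C where "C = \<bar>C0\<bar> + (\<Sum>i=1..n. \<bar>CF i\<bar>)"
  have CG: "rnorm g q (G q) \<le> C" if "q \<in> \<Omega>" for q
  proof -
    have "0 \<le> (\<Sum>i=1..n. \<bar>CF i\<bar>)" by (intro sum_nonneg) simp
    then show ?thesis using C0[OF that] unfolding C_def by linarith
  qed
  have CFC: "rnorm g q (grad A g (F i) q) \<le> C" if "i \<in> {1..n}" "q \<in> \<Omega>" for i q
  proof -
    have "\<bar>CF i\<bar> \<le> (\<Sum>i=1..n. \<bar>CF i\<bar>)" using that(1) by (intro member_le_sum) auto
    then show ?thesis using CF[OF that] unfolding C_def by linarith
  qed
  \<comment> \<open>The maximum with 1 keeps \<open>v\<close> positive, so that \<open>1 / (L * v)\<close> is a meaningful threshold for the step size.\<close>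
  define v where "v = max 1 (C + 3 * C * real m)"
  have v: "0 < v" unfolding v_def by simp
  have good: "V k x \<in> tangent_space A (W k x)" "rnorm g (W k x) (V k x) \<le> v"
    if x: "x \<in> space M" "\<forall>k. W k x \<in> \<Omega>" for x k
  proof -
    note bd = flat_run_bounded[OF run[OF x(1)] m x(2)[rule_format] I[OF _ x(1)] \<phi>\<psi> CFC CG]
    show "V k x \<in> tangent_space A (W k x)" by (rule bd(1))
    have "rnorm g (W k x) (V k x) \<le> C + 3 * C * real m" by (rule bd(2))
    then show "rnorm g (W k x) (V k x) \<le> v" unfolding v_def by linarith
  qed
  have AE_good: "AE x in M. x \<in> space M \<and> (\<forall>k. W k x \<in> \<Omega>)"
    using AE_space iterates by eventually_elim blast
  define a where "a = (\<lambda>k. M.expectation (\<lambda>x. grad_sq f (W k x)))"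
  have a: "0 \<le> a k" for k unfolding a_def by (intro Bochner_Integration.integral_nonneg) simp
  have inn_ge: "(1 - \<mu>) * a k \<le> M.expectation (inn k)" for k
  proof (cases "m dvd k")
    case True
    have "M.expectation (inn k) = a k"
      unfolding a_def
    proof (rule Bochner_Integration.integral_cong[OF refl])
      fix x assume "x \<in> space M"
      then have "V k x = G (W k x)" using run True unfolding flat_run_def by simp
      then show "inn k x = grad_sq f (W k x)" unfolding inn_def by (simp add: rnorm_sq G_in)
    qed
    moreover have "(1 - \<mu>) * a k \<le> 1 * a k" using a \<mu> by (intro mult_right_mono) auto
    ultimately show ?thesis by simp
  next
    case False
    \<comment> \<open>The inner product as it would be if the current batch were \<open>B\<close>.\<close>
    define \<Phi> where "\<Phi> = (\<lambda>B x. g (W k x) (G (W k x))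
      (direction (\<phi> k) (\<psi> k) B (W (k - k mod m) x) (W (k - 1) x) (W k x) (V (k - 1) x)))"
    have k: "0 < k" using False by (auto intro: gr0I)
    have det: "determined_by (space M) I (?J k) (\<Phi> B)" for B
    proof -
      have "determined_by (space M) I (?J k)
          (\<lambda>x. (W k x, W (k - k mod m) x, W (k - 1) x, V (k - 1) x))"
        using k by (intro determined_by_Pair detW' detV') simp_all
      from determined_by_comp[OF this, of "\<lambda>(p, p0, p1, v).
          g p (G p) (direction (\<phi> k) (\<psi> k) B p0 p1 p v)"]
      show ?thesis unfolding \<Phi>_def by simp
    qed
    have "M.expectation (inn k) = M.expectation (\<lambda>x. \<Phi> (I k x) x)"
    proof (rule Bochner_Integration.integral_cong[OF refl])
      fix x assume "x \<in> space M"
      then have "V k x = direction (\<phi> k) (\<psi> k) (I k x) (W (k - k mod m) x) (W (k - 1) x) (W k x) (V (k - 1) x)"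
        using run False unfolding flat_run_def by simp
      then show "inn k x = \<Phi> (I k x) x" unfolding inn_def \<Phi>_def by simp
    qed
    also have "\<dots> = (1 / ?N) * M.expectation (\<lambda>x. \<Sum>B\<in>?S. \<Phi> B x)"
      by (rule M.expectation_fresh_uniform[OF indep, where J = "?J k"])
        (use False I uniform det in auto)
    finally have E: "M.expectation (inn k) = (1 / ?N) * M.expectation (\<lambda>x. \<Sum>B\<in>?S. \<Phi> B x)" .
    have "?N * (1 - \<mu>) * a k = M.expectation (\<lambda>x. ?N * (1 - \<mu>) * grad_sq f (W k x))"
      unfolding a_def by simp
    also have "\<dots> \<le> M.expectation (\<lambda>x. \<Sum>B\<in>?S. \<Phi> B x)"
    proof (rule integral_mono_AE)
      show "integrable M (\<lambda>x. ?N * (1 - \<mu>) * grad_sq f (W k x))" by (rule intW)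
      show "integrable M (\<lambda>x. \<Sum>B\<in>?S. \<Phi> B x)"
        by (intro Bochner_Integration.integrable_sum int[OF det])
      show "AE x in M. ?N * (1 - \<mu>) * grad_sq f (W k x) \<le> (\<Sum>B\<in>?S. \<Phi> B x)"
        using AE_good
      proof eventually_elim
        case (elim x)
        have "?N * ((1 - \<mu>) * grad_sq f (W k x)) \<le> (\<Sum>B\<in>?S. \<Phi> B x)"
          unfolding \<Phi>_def using elim \<phi>\<psi>[OF False]
          by (intro sum_metric_direction_ge good) auto
        then show ?case by (simp add: mult.assoc)
      qed
    qed
    finally have "?N * ((1 - \<mu>) * a k) \<le> ?N * M.expectation (inn k)"
      unfolding E using N by (simp add: mult.assoc)
    then show ?thesis using N by (simp add: mult_le_cancel_left_pos)
  qed
  obtain L where L: "0 < L"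
    "\<And>p \<eta>. p \<in> \<Omega> \<Longrightarrow> \<eta> \<in> tangent_space A p \<Longrightarrow> rnorm g p \<eta> < 1 / L \<Longrightarrow>
      f (R p \<eta>) \<le> f p + g p (G p) \<eta> + L * (rnorm g p \<eta>)\<^sup>2"
    "\<And>p \<eta>. p \<in> \<Omega> \<Longrightarrow> \<eta> \<in> tangent_space A p \<Longrightarrow> rnorm g p \<eta> < 1 / L \<Longrightarrow>
      \<bar>grad_sq f (R p \<eta>) - grad_sq f p\<bar> \<le> L * rnorm g p \<eta>"
    using retraction_bounds_on_compact[OF f_C2 R \<Omega>] by blast
  \<comment> \<open>Square summable step sizes tend to zero, so all but finitely many steps are short.\<close>
  have "(\<lambda>k. sqrt ((\<alpha> k)\<^sup>2)) \<longlonglongrightarrow> sqrt 0"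
    by (intro tendsto_real_sqrt summable_LIMSEQ_zero square)
  then have "\<alpha> \<longlonglongrightarrow> 0" using \<alpha> by (simp add: abs_of_pos)
  then have small: "\<forall>\<^sub>F k in sequentially. \<alpha> k < 1 / (L * v)"
    using L(1) v by (intro order_tendstoD) auto
  have pathwise:
    "f (W (Suc k) x) \<le> f (W k x) - \<alpha> k * inn k x + L * v\<^sup>2 * (\<alpha> k)\<^sup>2"
    "\<bar>grad_sq f (W (Suc k) x) - grad_sq f (W k x)\<bar> \<le> L * v * \<alpha> k"
    if k: "\<alpha> k < 1 / (L * v)" and x: "x \<in> space M \<and> (\<forall>k. W k x \<in> \<Omega>)" for k x
  proof -
    have \<Omega>k: "W k x \<in> \<Omega>" using x by blast
    have Vin: "V k x \<in> tangent_space A (W k x)" and Vle: "rnorm g (W k x) (V k x) \<le> v"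
      using good[of x k] x by blast+
    define \<eta> where "\<eta> = - (\<alpha> k *\<^sub>R V k x)"
    have W': "W (Suc k) x = R (W k x) \<eta>" using run x unfolding flat_run_def \<eta>_def by blast
    have sV: "\<alpha> k *\<^sub>R V k x \<in> tangent_space A (W k x)" by (rule tangent_space_scale[OF Vin])
    have \<eta>: "\<eta> \<in> tangent_space A (W k x)" unfolding \<eta>_def by (rule tangent_space_neg[OF sV])
    have "rnorm g (W k x) \<eta> = \<alpha> k * rnorm g (W k x) (V k x)"
      unfolding \<eta>_def rnorm_minus[OF sV] rnorm_scale[OF Vin] using \<alpha>[of k] by simp
    also have "\<dots> \<le> \<alpha> k * v" using Vle \<alpha>[of k] by (intro mult_left_mono) auto
    finally have \<eta>_le: "rnorm g (W k x) \<eta> \<le> \<alpha> k * v" .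
    also have "\<alpha> k * v < 1 / L" using k L(1) v by (simp add: field_simps)
    finally have \<eta>_small: "rnorm g (W k x) \<eta> < 1 / L" .
    have "(rnorm g (W k x) \<eta>)\<^sup>2 \<le> (\<alpha> k * v)\<^sup>2"
      using \<eta>_le rnorm_nonneg[OF \<eta>] by (rule power_mono)
    then have sq: "L * (rnorm g (W k x) \<eta>)\<^sup>2 \<le> L * v\<^sup>2 * (\<alpha> k)\<^sup>2"
      using L(1) by (simp add: power_mult_distrib mult_ac)
    have "g (W k x) (G (W k x)) \<eta> = - (\<alpha> k * inn k x)"
      unfolding \<eta>_def inn_def metric_minus_right[OF G_in sV] metric_scale_right[OF G_in Vin] ..
    then show "f (W (Suc k) x) \<le> f (W k x) - \<alpha> k * inn k x + L * v\<^sup>2 * (\<alpha> k)\<^sup>2"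
      using L(2)[OF \<Omega>k \<eta> \<eta>_small] sq unfolding W' by linarith
    have "L * rnorm g (W k x) \<eta> \<le> L * v * \<alpha> k" using \<eta>_le L(1) by (simp add: mult_ac)
    then show "\<bar>grad_sq f (W (Suc k) x) - grad_sq f (W k x)\<bar> \<le> L * v * \<alpha> k"
      using L(3)[OF \<Omega>k \<eta> \<eta>_small] unfolding W' by linarith
  qed
  define E where "E = (\<lambda>k. M.expectation (\<lambda>x. f (W k x)))"
  have E_low: "fmin \<le> E k" for k
    unfolding E_def using intW bounded_below by (intro M.integral_ge_const) auto
  have descent: "\<forall>\<^sub>F k in sequentially. E (Suc k) \<le> E k - (1 - \<mu>) * (\<alpha> k * a k) + L * v\<^sup>2 * (\<alpha> k)\<^sup>2"
    using small
  proof eventually_elim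
    case (elim k)
    have "E (Suc k) \<le> M.expectation (\<lambda>x. f (W k x) - \<alpha> k * inn k x + L * v\<^sup>2 * (\<alpha> k)\<^sup>2)"
      unfolding E_def
    proof (rule integral_mono_AE)
      show "AE x in M. f (W (Suc k) x) \<le> f (W k x) - \<alpha> k * inn k x + L * v\<^sup>2 * (\<alpha> k)\<^sup>2"
        using AE_good by (rule eventually_mono) (rule pathwise(1)[OF elim])
    qed (intro intW int_inn Bochner_Integration.integrable_add Bochner_Integration.integrable_diff
        integrable_mult_right M.integrable_const)+
    also have "\<dots> = E k - \<alpha> k * M.expectation (inn k) + L * v\<^sup>2 * (\<alpha> k)\<^sup>2"
      unfolding E_def using intW int_inn by (simp add: M.prob_space)
    also have "\<dots> \<le> E k - \<alpha> k * ((1 - \<mu>) * a k) + L * v\<^sup>2 * (\<alpha> k)\<^sup>2"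
      using mult_left_mono[OF inn_ge, of "\<alpha> k" k] \<alpha>[of k] by simp
    finally show ?case by (simp add: mult_ac)
  qed
  have summ: "summable (\<lambda>k. \<alpha> k * a k)"
    by (rule summable_if_descent[OF \<alpha> a E_low square _ _ descent]) (use L(1) \<mu> in simp_all)
  have lip: "\<forall>\<^sub>F k in sequentially. \<bar>a (Suc k) - a k\<bar> \<le> L * v * \<alpha> k"
    using small
  proof eventually_elim
    case (elim k)
    have i: "integrable M (\<lambda>x. grad_sq f (W k x))" for k by (rule intW)
    define Y where "Y = (\<lambda>x. grad_sq f (W (Suc k) x) - grad_sq f (W k x))"
    have Y: "integrable M Y" unfolding Y_def by (rule Bochner_Integration.integrable_diff[OF i i])
    have "a (Suc k) - a k = M.expectation Y"
      unfolding a_def Y_def by (rule Bochner_Integration.integral_diff[OF i i, symmetric])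
    moreover have "\<bar>M.expectation Y\<bar> \<le> M.expectation (\<lambda>x. \<bar>Y x\<bar>)" by (rule integral_abs_bound)
    moreover have "M.expectation (\<lambda>x. \<bar>Y x\<bar>) \<le> M.expectation (\<lambda>x. L * v * \<alpha> k)"
    proof (rule integral_mono_AE[OF integrable_abs[OF Y] M.integrable_const])
      show "AE x in M. \<bar>Y x\<bar> \<le> L * v * \<alpha> k"
        unfolding Y_def using AE_good by (rule eventually_mono) (rule pathwise(2)[OF elim])
    qed
    moreover have "M.expectation (\<lambda>x. L * v * \<alpha> k) = L * v * \<alpha> k" by (simp add: M.prob_space)
    ultimately show ?case by linarith
  qed
  have "a \<longlonglongrightarrow> 0" by (rule tendsto_zero_if_weighted_summable[OF \<alpha> a diverge summ lip])
  then show ?thesis unfolding a_def .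
qed

end

text \<open>The pairs \<open>(s, t)\<close> with \<open>1 \<le> s\<close> and \<open>t < m\<close> correspond to the numbers \<open>k\<close> through
\<open>s = k div m + 1\<close>, \<open>t = k mod m\<close>, and those with a batch, \<open>1 \<le> t\<close>, to the \<open>k\<close> that \<open>m\<close> does not
divide. What remains is to carry the hypotheses on batches and step sizes over to this numbering.\<close>

theorem theorem1:
  fixes A :: "('m::{t2_space,second_countable_topology}, 'e::euclidean_space) chart set"
    and g :: "('m, 'e) metric" and R :: "('m, 'e) retr" and T :: "('m, 'e) transp"
    and F :: "nat \<Rightarrow> 'm \<Rightarrow> real" and n b m :: nat
    and \<mu> \<rho> :: real and \<alpha> \<phi> \<psi> :: "nat \<Rightarrow> nat \<Rightarrow> real"
    and \<Omega> :: "'m set" and wstar w0 :: 'm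
    and M :: "'a measure" and I :: "nat \<Rightarrow> nat \<Rightarrow> 'a \<Rightarrow> nat set"
    and w :: "nat \<Rightarrow> nat \<Rightarrow> 'a \<Rightarrow> 'm" and V :: "nat \<Rightarrow> nat \<Rightarrow> 'a \<Rightarrow> ('m, 'e) tvec"
  assumes manifold: "smooth_manifold A" "riemannian_metric A g"
    and retraction: "smooth_retraction A R"
    and transport: "vector_transport A R T"
    and params: "n \<ge> 1" "1 \<le> b" "b \<le> n" "m \<ge> 1" "0 < \<mu>" "\<mu> < 1"
      "\<And>s t. s \<ge> 1 \<Longrightarrow> t < m \<Longrightarrow> \<alpha> s t > 0"
      "\<And>s t. s \<ge> 1 \<Longrightarrow> t \<in> {1..<m} \<Longrightarrow> \<phi> s t \<ge> 0 \<and> \<psi> s t \<ge> 0 \<and> \<phi> s t + \<psi> s t \<le> 1"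
    and minimizer: "\<And>p. avg_fun n F wstar \<le> avg_fun n F p"
    and prob: "prob_space M"
    and batches: "\<And>s t x. s \<ge> 1 \<Longrightarrow> t \<in> {1..<m} \<Longrightarrow> x \<in> space M \<Longrightarrow>
      I s t x \<subseteq> {1..n} \<and> card (I s t x) = b"
    and batches_indep:
      "prob_space.indep_vars M (\<lambda>_. count_space UNIV) (\<lambda>(s, t). I s t) ({1..} \<times> {1..<m})"
    and batches_uniform: "\<And>s t. s \<ge> 1 \<Longrightarrow> t \<in> {1..<m} \<Longrightarrow>
      distr M (count_space UNIV) (I s t) = measure_pmf (pmf_of_set {B. B \<subseteq> {1..n} \<and> card B = b})"
    and algorithm: "\<And>x. x \<in> space M \<Longrightarrow>
      rshg_run A g R T \<rho> n F m \<mu> \<alpha> \<phi> \<psi> w0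
        (\<lambda>s t. I s t x) (\<lambda>s t. w s t x) (\<lambda>s t. V s t x)"
    and f_regular: "mfd_ck 3 A (avg_fun n F)"
    and fi_regular: "\<And>i. i \<in> {1..n} \<Longrightarrow> mfd_ck 2 A (F i)"
    and Omega: "compact \<Omega>" "wstar \<in> interior \<Omega>"
    and iterates: "AE x in M. \<forall>s\<ge>1. \<forall>t<m. w s t x \<in> \<Omega>"
    and radius: "\<rho> > 0"
      "\<And>p. p \<in> \<Omega> \<Longrightarrow> tangent_diffeo A p (tangent_ball A g p \<rho>) (R p)"
      "\<And>p. p \<in> \<Omega> \<Longrightarrow> \<Omega> \<subseteq> R p ` tangent_ball A g p \<rho>"
    and curves: "AE x in M. \<forall>s\<ge>1. \<forall>t<m. \<forall>\<tau>\<in>{0..1}.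
      R (w s t x) (- ((\<tau> * \<alpha> s t) *\<^sub>R V s t x)) \<in> \<Omega>"
    and steps_diverge: "filterlim (\<lambda>N. \<Sum>s=1..N. \<Sum>t<m. \<alpha> s t) at_top sequentially"
    and steps_square: "summable (\<lambda>s. \<Sum>t<m. (\<alpha> (Suc s) t)\<^sup>2)"
    and transport_cont: "transport_ck 0 A R T"
    and transport_isom: "isometric_transport A g R T"
  shows "(\<lambda>k. prob_space.expectation M (\<lambda>x.
      (rnorm g (w (k div m + 1) (k mod m) x)
        (grad A g (avg_fun n F) (w (k div m + 1) (k mod m) x)))\<^sup>2)) \<longlonglongrightarrow> 0"
proof -
  interpret prob_space M by (rule prob)
  interpret hybrid_gradient A g R T \<rho> \<Omega> n b F \<mu>
  proof
    show "mfd_ck 2 A (avg_fun n F)"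
      using f_regular unfolding mfd_ck_def by (blast intro: ck_on_mono[of 3 _ _ 2, simplified])
  qed (fact manifold transport transport_isom radius(2,3) fi_regular params(2,3,5,6))+
  let ?\<alpha> = "\<lambda>k. \<alpha> (k div m + 1) (k mod m)" and ?I = "\<lambda>k. I (k div m + 1) (k mod m)"
  let ?K = "{k. \<not> m dvd k}"
  have mod_less: "k mod m < m" for k using params(4) by simp
  have inner: "k mod m \<in> {1..<m}" if "\<not> m dvd k" for k
    using that mod_less[of k] by (auto simp: dvd_eq_mod_eq_0 Suc_le_eq)
  have in_batches: "?I k x \<in> batches n b" if "\<not> m dvd k" "x \<in> space M" for k x
    using batches[OF _ inner[OF that(1)] that(2)] by (simp add: batches_def)
  have indep: "indep_vars (\<lambda>_. count_space UNIV) ?I ?K"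
  proof -
    let ?h = "\<lambda>k. (k div m + 1, k mod m)"
    have inj: "inj_on ?h ?K" by (rule inj_onI) (metis Pair_inject add_right_cancel div_mult_mod_eq)
    have "?h ` ?K \<subseteq> {1..} \<times> {1..<m}" using inner by auto
    then show ?thesis
      using indep_vars_reindex[OF inj indep_vars_subset[OF batches_indep]] by simp
  qed
  have uniform: "measure M (?I k -` {B} \<inter> space M) = 1 / real (card (batches n b))"
    if k: "\<not> m dvd k" and B: "B \<in> batches n b" for k B
  proof -
    have rv: "random_variable (count_space UNIV) (?I k)"
      using indep k unfolding indep_vars_def by blast
    have "measure M (?I k -` {B} \<inter> space M) = measure (distr M (count_space UNIV) (?I k)) {B}"
      using rv by (simp add: measure_distr)
    also have "\<dots> = measure (measure_pmf (pmf_of_set (batches n b))) {B}"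
      unfolding batches_def using batches_uniform[OF _ inner[OF k]] by simp
    also have "\<dots> = 1 / real (card (batches n b))"
      using B by (simp add: measure_pmf_single pmf_of_set[OF _ finite_batches] ex_in_conv[symmetric] exI[of _ B])
    finally show ?thesis .
  qed
  have diverge: "filterlim (\<lambda>N. \<Sum>k<N. ?\<alpha> k) at_top sequentially"
    unfolding filterlim_at_top eventually_sequentially
  proof
    fix Z :: real
    obtain N where N: "Z \<le> (\<Sum>s=1..N. \<Sum>t<m. \<alpha> s t)"
      using steps_diverge unfolding filterlim_at_top eventually_sequentially by blast
    have "Z \<le> (\<Sum>k<n. ?\<alpha> k)" if "N * m \<le> n" for n
    proof -
      have "(\<Sum>k<N * m. ?\<alpha> k) \<le> (\<Sum>k<n. ?\<alpha> k)"
        using that params(7) mod_less by (intro sum_mono2) (auto intro: less_imp_le)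
      then show ?thesis using N unfolding sum_nested_as_flat[OF params(4)] by linarith
    qed
    then show "\<exists>N. \<forall>n\<ge>N. Z \<le> (\<Sum>k<n. ?\<alpha> k)" by blast
  qed
  have square: "summable (\<lambda>k. (?\<alpha> k)\<^sup>2)"
  proof (rule summableI_nonneg_bounded)
    fix N
    let ?h = "\<lambda>s t. (\<alpha> s t)\<^sup>2"
    have "(\<Sum>k<N. (?\<alpha> k)\<^sup>2) \<le> (\<Sum>k<N * m. (?\<alpha> k)\<^sup>2)"
      using params(4) by (intro sum_mono2) auto
    also have "\<dots> = (\<Sum>s=1..N. \<Sum>t<m. ?h s t)"
      using sum_nested_as_flat[OF params(4), of ?h N] .
    also have "\<dots> = (\<Sum>s<N. \<Sum>t<m. ?h (Suc s) t)"
      using sum.atLeast1_atMost_eq[of "\<lambda>s. \<Sum>t<m. ?h s t" N] by simp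
    also have "\<dots> \<le> (\<Sum>s. \<Sum>t<m. ?h (Suc s) t)"
      using steps_square by (intro sum_le_suminf) (auto intro: sum_nonneg)
    finally show "(\<Sum>k<N. (?\<alpha> k)\<^sup>2) \<le> (\<Sum>s. \<Sum>t<m. ?h (Suc s) t)" .
  qed simp
  show ?thesis
  proof (rule flat_run_expected_grad_sq_tendsto_0[where \<alpha> = ?\<alpha> and I = ?I and m = m
        and \<phi> = "\<lambda>k. \<phi> (k div m + 1) (k mod m)" and \<psi> = "\<lambda>k. \<psi> (k div m + 1) (k mod m)"
        and V = "\<lambda>k. V (k div m + 1) (k mod m)" and W = "\<lambda>k. w (k div m + 1) (k mod m)"
        and M = M and start = w0 and fmin = "avg_fun n F wstar"])
    show "AE x in M. \<forall>k. w (k div m + 1) (k mod m) x \<in> \<Omega>"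
      using iterates by (rule eventually_mono) (simp add: mod_less)
    show "flat_run m ?\<alpha> (\<lambda>k. \<phi> (k div m + 1) (k mod m)) (\<lambda>k. \<psi> (k div m + 1) (k mod m)) w0
        (\<lambda>k. ?I k x) (\<lambda>k. w (k div m + 1) (k mod m) x) (\<lambda>k. V (k div m + 1) (k mod m) x)"
      if "x \<in> space M" for x
      by (rule flat_run_of_rshg_run[OF algorithm[OF that] params(4)])
    show "0 \<le> \<phi> (k div m + 1) (k mod m) \<and> 0 \<le> \<psi> (k div m + 1) (k mod m) \<and>
        \<phi> (k div m + 1) (k mod m) + \<psi> (k div m + 1) (k mod m) \<le> 1" if "\<not> m dvd k" for k
      by (rule params(8)[OF _ inner[OF that]]) simp
    show "0 < ?\<alpha> k" for k by (rule params(7)) (simp_all add: mod_less)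
  qed (fact prob params(4) in_batches indep uniform minimizer retraction Omega(1) diverge square)+
qed

end
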